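(* Assume consistency and sequential unconfoundedness, and let $\{\pi_\varepsilon\}_{0\le\varepsilon<\bar\varepsilon}$ be a convolutional perturbation path around the baseline policy $\pi$ (all as defined in the context). Suppose that for each $t=1,\ldots,T$ the following hold. (i) $\mathbb E[|\Gamma_t|]<\infty$; $\mathbb E[|H_t^\star(S_t,A_t)\Gamma_t|]<\infty$; $\mathbb E[\int_{\mathcal A_t}|q_t^\star(S_t,a)(L_t^*\pi_t)(a\mid S_t)|\,d\lambda(a)]<\infty$; and $\mathbb E[\int_{\mathcal A_t}|(L_tq_t^\star)(S_t,a)|\,\pi_t(a\mid S_t)\,d\lambda(a)]<\infty$. (ii) There exist an integrable random variable $D_t$ and a measurable function $\widetilde D_t(s,a_0)$ such that, for all sufficiently small $\varepsilon>0$, $$\int_{\mathcal A_t}\Big|q_t^\star(S_t,a)\frac{\pi_{t,\varepsilon}(a\mid S_t)-\pi_t(a\mid S_t)}{\varepsilon}\Big|\,d\lambda(a)\le D_t,\qquad \Big|\frac{\int_{\mathcal A_t}q_t^\star(s,a)M_{t,\varepsilon}(a\mid a_0,s)\,d\lambda(a)-q_t^\star(s,a_0)}{\varepsilon}\Big|\le\widetilde D_t(s,a_0),$$ and $\mathbb E[\int_{\mathcal A_t}\widetilde D_t(S_t,a_0)\,\pi_t(a_0\mid S_t)\,d\lambda(a_0)]<\infty$. (iii) $\Gamma_t\in L^2$, $q_t^\star(S_t,A_t)\in L^2$, $H_t^\star(S_t,A_t)\in L^2$. Suppose also that $\sum_{t=1}^T\gamma^{t-1}\{(L_tq_t^\star)(S_t,A_t)+H_t^\star(S_t,A_t)(\Gamma_t-q_t^\star(S_t,A_t))\}$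 has finite second moment. Let $\widehat\Theta$ be the $K$-fold cross-fitted ASRW estimator (defined in the context) built from i.i.d. trajectories $Z_1,\ldots,Z_n$, with $K$ fixed, and write $(\widehat q_t,\widehat H_t)$ for the out-of-fold nuisance estimates used on a scoring fold. On each scoring fold, assume that, conditionally on the training folds, $\widehat q_t\in\mathcal Q_t$, $\widehat H_t$ is a measurable function of $(S_t,A_t)$, and $\widehat q_t(S_t,A_t)\in L^2$, $\widehat H_t(S_t,A_t)\in L^2$. Assume $|Y_t|\le Y_{\max}$ almost surely for all $t$, let $\Gamma_{\max}=Y_{\max}\sum_{k=0}^{T-1}\gamma^k$, and assume $$\sup_{a\in\mathcal A_t}|\widehat q_t(S_t,a)|\le\Gamma_{\max}.$$ Assume further that, uniformly over $t$, $$\|\widehat q_t-q_t^\star\|_2=o_p(n^{-\alpha_q}),\qquad \|L_t(\widehat q_t-q_t^\star)\|_2=o_p(n^{-\alpha_q}),\qquad \|\widehat H_t-H_t^\star\|_2=o_p(n^{-\alpha_H}),$$ with $\alpha_q,\alpha_H\ge0$ and $\alpha_q+\alpha_H\ge\tfrac12$. Then, with $$\widehat\Theta^\star=\sum_{t=1}^T\frac1n\sum_{i=1}^n\gamma^{t-1}\Big[(L_tq_t^\star)(S_{i,t},A_{i,t})+H_t^\star(S_{i,t},A_{i,t})\{\Gamma_{i,t}-q_t^\star(S_{i,t},A_{i,t})\}\Big],$$ one has, as $n\to\infty$, $\sqrt n\,(\widehat\Theta-\widehat\Theta^\star)\to_p0$, and so $$\sqrt n\,(\widehat\Theta-\Theta)\Rightarrow\mathcal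 N(0,\sigma_\star^2),\qquad \sigma_\star^2=\operatorname{Var}\Big[\sum_{t=1}^T\gamma^{t-1}\big\{(L_tq_t^\star)(S_t,A_t)+H_t^\star(S_t,A_t)(\Gamma_t-q_t^\star(S_t,A_t))\big\}\Big].$$
   Context: Setting. Fix a horizon $T\in\mathbb N$ and a discount factor $\gamma\in(0,1]$. A trajectory is $Z=(X_1,A_1,Y_1,\ldots,X_T,A_T,Y_T,X_{T+1})$ with covariates $X_t\in\mathcal X_t$, actions $A_t\in\mathcal A_t$ and outcomes $Y_t\in\mathbb R$. The history before action $t$ is $S_t=(X_1,A_1,Y_1,\ldots,X_{t-1},A_{t-1},Y_{t-1},X_t)\in\mathcal S_t$. No Markov property is assumed. There is a $\sigma$-finite reference measure $\lambda$ on an action space $\mathcal A$, with each $\mathcal A_t$ a measurable subset of $\mathcal A$. A policy $\pi=\{\pi_t\}_{t=1}^T$ is a collection of conditional action distributions $A_t\sim\pi_t(\cdot\mid S_t)$, where $\pi_t(\cdot\mid s)$ is a density (or mass function) with respect to $\lambda$ restricted to $\mathcal A_t$, for almost every $s$. The observed (status-quo) law of $Z$ is $P$, with expectation $\mathbb E$; the baseline policy $\pi$ is the status-quo policy, i.e. under $P$, $A_t\mid S_t\sim\pi_t(\cdot\mid S_t)$. $L^2$ refers to $P$. Consistency. For each action history $a_{1:t}=(a_1,\ldots,a_t)$ there exist potential outcomes $(X_{t+1}(a_{1:t}),Y_t(a_{1:t}))$ such that, almost surely, $(X_{t+1},Y_t)=(X_{t+1}(A_{1:t}),Y_t(A_{1:t}))$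 for $t=1,\ldots,T$. Sequential unconfoundedness. For each $t=1,\ldots,T$ and any $(a_t,\ldots,a_T)$, $A_t$ is conditionally independent of $\{X_{k+1}(A_{1:t-1},a_t,\ldots,a_k),\,Y_k(A_{1:t-1},a_t,\ldots,a_k):k=t,\ldots,T\}$ given $S_t$. Counterfactual laws. For a policy $\pi'$ whose conditional action distributions are absolutely continuous with respect to the status-quo policy, the induced law of the trajectory is given by the $g$-formula $P^{\pi'}(x_{1:T+1},a_{1:T},y_{1:T})=P(x_1)\prod_{t=1}^T\pi'_t(a_t\mid s_t)\,P(x_{t+1},y_t\mid s_t,a_t)$, where $P(x_1)$ and $P(x_{t+1},y_t\mid s_t,a_t)$ are the law of $X_1$ and the conditional law of $(X_{t+1},Y_t)$ given $(S_t,A_t)$ under $P$. Write $\mathbb E_\varepsilon$ for expectation under $P^{\pi_\varepsilon}$. Values. $\Gamma_t=\sum_{k=t}^T\gamma^{k-t}Y_k$, and $q_t^\star(s,a)=\mathbb E[\Gamma_t\mid S_t=s,A_t=a]$ is the true action-value function under the baseline policy. Convolutional perturbation path. A family of policies $\{\pi_\varepsilon\}_{0\le\varepsilon<\bar\varepsilon}$ is a convolutional perturbation path around $\pi$ if for each $t$ there is a known family of Markov kernels $M_{t,\varepsilon}(a\mid a_0,s)$, $0\le\varepsilon<\bar\varepsilon$, from baseline actions $a_0\in\mathcal A_t$ to perturbed actions $a\in\mathcal A_t$ (written in density/mass form against $d\lambda(a)$, with Dirac masses allowed by abuse of notation, so that $\int q(s,a)M_{t,\varepsilon}(a\mid a_0,s)\,d\lambda(a)$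 means integration against the kernel), such that: (a) $\pi_{t,\varepsilon}(a\mid s)=\int_{\mathcal A_t}M_{t,\varepsilon}(a\mid a_0,s)\,\pi_t(a_0\mid s)\,d\lambda(a_0)$; (b) $M_{t,0}(a\mid a_0,s)=\delta_{a_0}(a)$, so $\pi_{t,0}=\pi_t$; (c) for almost every $s$ and all sufficiently small $\varepsilon>0$, $\pi_t(a\mid s)=0$ implies $\pi_{t,\varepsilon}(a\mid s)=0$ for $\lambda$-almost every $a\in\mathcal A_t$; (d) the path admits a forward operator $(L_t^*\pi_t)(a\mid s)=\lim_{\varepsilon\downarrow0}\{\pi_{t,\varepsilon}(a\mid s)-\pi_t(a\mid s)\}/\varepsilon$, and a backward operator $L_t$ acting on a function class $\mathcal Q_t$ containing $q_t^\star$ by $(L_tq)(s,a_0)=\lim_{\varepsilon\downarrow0}\{\int_{\mathcal A_t}q(s,a)M_{t,\varepsilon}(a\mid a_0,s)\,d\lambda(a)-q(s,a_0)\}/\varepsilon$, $q\in\mathcal Q_t$. Here $L_t(\widehat q_t-q_t^\star)=L_t\widehat q_t-L_tq_t^\star$. The true score is $H_t^\star(s,a)=(L_t^*\pi_t)(a\mid s)/\pi_t(a\mid s)$ on $\{\pi_t(a\mid s)>0\}$. Target. The marginal policy effect is $\Theta=\frac{d}{d\varepsilon}\mathbb E_\varepsilon[\sum_{k=1}^T\gamma^{k-1}Y_k]|_{\varepsilon=0}$ (a right derivative, since $\varepsilon\ge0$). Cross-fitted ASRW (Augmented Sequential Riesz Weighted) estimator. Given i.i.d. trajectories $Z_1,\ldots,Z_n\sim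 P$, partition $\{1,\ldots,n\}$ into disjoint scoring folds $I_1,\ldots,I_K$. For each $k$, using only the training sample $\{Z_i:i\notin I_k\}$, form estimates $\{\widehat q_t^{(-k)},\widehat H_t^{(-k)}\}_{t=1}^T$ of $\{q_t^\star,H_t^\star\}_{t=1}^T$ (by any method). For $i\in I_k$ put $\Gamma_{i,t}=\sum_{u=t}^T\gamma^{u-t}Y_{i,u}$ and $$\widehat\psi^{(-k)}_{i,t}=\gamma^{t-1}(L_t\widehat q_t^{(-k)})(S_{i,t},A_{i,t})+\gamma^{t-1}\widehat H_t^{(-k)}(S_{i,t},A_{i,t})\{\Gamma_{i,t}-\widehat q_t^{(-k)}(S_{i,t},A_{i,t})\}.$$ The estimator is $\widehat\Theta=\frac1n\sum_{k=1}^K\sum_{i\in I_k}\sum_{t=1}^T\widehat\psi^{(-k)}_{i,t}$. Assumptions on $(\widehat q_t,\widehat H_t)$ are imposed on $(\widehat q_t^{(-k)},\widehat H_t^{(-k)})$ for each $k$. Norm. $\|f\|_2^2=\mathbb E[f(S_t,A_t)^2]$ under the baseline law of $(S_t,A_t)$, with estimated functions held fixed (i.e. conditionally on the training folds, for an independent trajectory).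
   Formalization: The limits defining the forward operator and the backward operator (for each q in Q_t) are taken in L¹ under the baseline law rather than pointwise, since with pointwise limits the claim fails; absolute continuity (c) is assumed for small ε uniformly in almost every s. *)

theory Defs
  imports "HOL-Probability.Probability"
begin

section \<open>Trajectories and histories\<close>

text \<open>
  Times run over \<open>1..T\<close>; covariates also have an index \<open>T + 1\<close>. The space \<open>\<X>\<^sub>t\<close> is the
  measurable space \<^term>\<open>cov_space D t\<close>, and \<open>\<lambda>\<close> is \<^term>\<open>ref_measure D\<close>.
\<close>

record ('x, 'a) design =
  horizon :: nat
  discount :: real
  cov_space :: "nat \<Rightarrow> 'x measure"
  ref_measure :: "'a measure"
  act_set :: "nat \<Rightarrow> 'a set"

definition act_space :: "('x, 'a) design \<Rightarrow> nat \<Rightarrow> 'a measure" where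
  "act_space D t = restrict_space (ref_measure D) (act_set D t)"

definition design :: "('x, 'a) design \<Rightarrow> bool" where
  "design D \<longleftrightarrow> 0 < discount D \<and> discount D \<le> 1 \<and> sigma_finite_measure (ref_measure D) \<and>
     (\<forall>t\<in>{1..horizon D}. act_set D t \<in> sets (ref_measure D))"

text \<open>
  A history \<open>S\<^sub>t = (X\<^sub>1, A\<^sub>1, Y\<^sub>1, \<dots>, X\<^sub>t)\<close> is stored as the triple of its covariates (indices
  \<open>1..t\<close>), actions and outcomes (indices \<open>1..<t\<close>). A full trajectory is the history \<open>S\<^bsub>T+1\<^esub>\<close>.
\<close>

type_synonym ('x, 'a) hist = "(nat \<Rightarrow> 'x) \<times> (nat \<Rightarrow> 'a) \<times> (nat \<Rightarrow> real)"

definition hist_space :: "('x, 'a) design \<Rightarrow> nat \<Rightarrow> ('x, 'a) hist measure" where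
  "hist_space D t =
     (\<Pi>\<^sub>M s\<in>{1..t}. cov_space D s) \<Otimes>\<^sub>M (\<Pi>\<^sub>M s\<in>{1..<t}. act_space D s) \<Otimes>\<^sub>M (\<Pi>\<^sub>M s\<in>{1..<t}. borel)"

definition traj_space :: "('x, 'a) design \<Rightarrow> ('x, 'a) hist measure" where
  "traj_space D = hist_space D (Suc (horizon D))"

definition cov_at :: "nat \<Rightarrow> ('x, 'a) hist \<Rightarrow> 'x" where
  "cov_at t z = fst z t"

definition act_at :: "nat \<Rightarrow> ('x, 'a) hist \<Rightarrow> 'a" where
  "act_at t z = fst (snd z) t"

definition out_at :: "nat \<Rightarrow> ('x, 'a) hist \<Rightarrow> real" where
  "out_at t z = snd (snd z) t"

definition hist_at :: "nat \<Rightarrow> ('x, 'a) hist \<Rightarrow> ('x, 'a) hist" where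
  "hist_at t z = (restrict (fst z) {1..t}, restrict (fst (snd z)) {1..<t},
                  restrict (snd (snd z)) {1..<t})"

definition sa_at :: "nat \<Rightarrow> ('x, 'a) hist \<Rightarrow> ('x, 'a) hist \<times> 'a" where
  "sa_at t z = (hist_at t z, act_at t z)"

definition hist_snoc :: "nat \<Rightarrow> ('x, 'a) hist \<Rightarrow> 'a \<Rightarrow> 'x \<times> real \<Rightarrow> ('x, 'a) hist" where
  "hist_snoc t s a xy = ((fst s)(Suc t := fst xy), (fst (snd s))(t := a), (snd (snd s))(t := snd xy))"

definition reward_to_go :: "('x, 'a) design \<Rightarrow> nat \<Rightarrow> ('x, 'a) hist \<Rightarrow> real" where
  "reward_to_go D t z = (\<Sum>k = t..horizon D. discount D ^ (k - t) * out_at k z)"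

abbreviation sa_space :: "('x, 'a) design \<Rightarrow> nat \<Rightarrow> (('x, 'a) hist \<times> 'a) measure" where
  "sa_space D t \<equiv> hist_space D t \<Otimes>\<^sub>M act_space D t"

definition hist_law :: "('x, 'a) design \<Rightarrow> ('x, 'a) hist measure \<Rightarrow> nat \<Rightarrow> ('x, 'a) hist measure" where
  "hist_law D P t = distr P (hist_space D t) (hist_at t)"

definition sa_law ::
  "('x, 'a) design \<Rightarrow> ('x, 'a) hist measure \<Rightarrow> nat \<Rightarrow> (('x, 'a) hist \<times> 'a) measure" where
  "sa_law D P t = distr P (sa_space D t) (sa_at t)"


section \<open>Policies and counterfactual laws\<close>

text \<open>Policies are written uncurried: \<open>\<pi>\<^sub>t(a | s)\<close> is \<^term>\<open>pol t (s, a)\<close>.\<close>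

type_synonym ('x, 'a) policy = "nat \<Rightarrow> ('x, 'a) hist \<times> 'a \<Rightarrow> real"

definition is_policy :: "('x, 'a) design \<Rightarrow> ('x, 'a) hist measure \<Rightarrow> ('x, 'a) policy \<Rightarrow> bool" where
  "is_policy D P pol \<longleftrightarrow> (\<forall>t\<in>{1..horizon D}.
     pol t \<in> borel_measurable (sa_space D t) \<and>
     (AE s in hist_law D P t. (\<forall>a\<in>act_set D t. 0 \<le> pol t (s, a)) \<and>
        (\<integral>\<^sup>+a. ennreal (pol t (s, a)) \<partial>act_space D t) = 1))"

definition status_quo :: "('x, 'a) design \<Rightarrow> ('x, 'a) hist measure \<Rightarrow> ('x, 'a) policy \<Rightarrow> bool" where
  "status_quo D P pol \<longleftrightarrow> is_policy D P pol \<and> (\<forall>t\<in>{1..horizon D}.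
     sa_law D P t = density (hist_law D P t \<Otimes>\<^sub>M act_space D t) (\<lambda>p. ennreal (pol t p)))"

text \<open>
  \<^term>\<open>Tr t (s, a)\<close> is a regular version of the conditional law \<open>P(x\<^bsub>t+1\<^esub>, y\<^sub>t | s, a)\<close> of
  \<open>(X\<^bsub>t+1\<^esub>, Y\<^sub>t)\<close> given \<open>(S\<^sub>t, A\<^sub>t)\<close>.
\<close>

definition is_transition :: "('x, 'a) design \<Rightarrow> ('x, 'a) hist measure \<Rightarrow>
    (nat \<Rightarrow> ('x, 'a) hist \<times> 'a \<Rightarrow> ('x \<times> real) measure) \<Rightarrow> bool" where
  "is_transition D P Tr \<longleftrightarrow> (\<forall>t\<in>{1..horizon D}.
     Tr t \<in> sa_space D t \<rightarrow>\<^sub>M prob_algebra (cov_space D (Suc t) \<Otimes>\<^sub>M borel) \<and>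
     distr P (sa_space D t \<Otimes>\<^sub>M (cov_space D (Suc t) \<Otimes>\<^sub>M borel))
         (\<lambda>z. (sa_at t z, (cov_at (Suc t) z, out_at t z))) =
       sa_law D P t \<bind>
         (\<lambda>p. distr (Tr t p) (sa_space D t \<Otimes>\<^sub>M (cov_space D (Suc t) \<Otimes>\<^sub>M borel)) (\<lambda>xy. (p, xy))))"

text \<open>
  \<^term>\<open>g_hist D P Tr pol n\<close> is the law of \<open>S\<^bsub>n+1\<^esub>\<close> when actions follow \<^term>\<open>pol\<close>: start from the
  \<open>P\<close>-law of \<open>X\<^sub>1\<close> and successively attach the factors \<open>\<pi>'\<^sub>t(a\<^sub>t | s\<^sub>t) P(x\<^bsub>t+1\<^esub>, y\<^sub>t | s\<^sub>t, a\<^sub>t)\<close>.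
\<close>

primrec g_hist :: "('x, 'a) design \<Rightarrow> ('x, 'a) hist measure \<Rightarrow>
    (nat \<Rightarrow> ('x, 'a) hist \<times> 'a \<Rightarrow> ('x \<times> real) measure) \<Rightarrow> ('x, 'a) policy \<Rightarrow> nat \<Rightarrow>
    ('x, 'a) hist measure" where
  "g_hist D P Tr pol 0 = hist_law D P 1"
| "g_hist D P Tr pol (Suc n) =
     density (g_hist D P Tr pol n \<Otimes>\<^sub>M act_space D (Suc n)) (\<lambda>p. ennreal (pol (Suc n) p)) \<bind>
       (\<lambda>(s, a). distr (Tr (Suc n) (s, a)) (hist_space D (Suc (Suc n))) (hist_snoc (Suc n) s a))"

definition g_law :: "('x, 'a) design \<Rightarrow> ('x, 'a) hist measure \<Rightarrow>
    (nat \<Rightarrow> ('x, 'a) hist \<times> 'a \<Rightarrow> ('x \<times> real) measure) \<Rightarrow> ('x, 'a) policy \<Rightarrow> ('x, 'a) hist measure" where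
  "g_law D P Tr pol = g_hist D P Tr pol (horizon D)"

definition policy_value :: "('x, 'a) design \<Rightarrow> ('x, 'a) hist measure \<Rightarrow>
    (nat \<Rightarrow> ('x, 'a) hist \<times> 'a \<Rightarrow> ('x \<times> real) measure) \<Rightarrow> ('x, 'a) policy \<Rightarrow> real" where
  "policy_value D P Tr pol =
     (\<integral>z. (\<Sum>k = 1..horizon D. discount D ^ (k - 1) * out_at k z) \<partial>g_law D P Tr pol)"

text \<open>The derivative within \<open>[0, \<epsilon>\<^sub>0)\<close> at \<open>0\<close> is the right derivative.\<close>

definition marginal_policy_effect :: "('x, 'a) design \<Rightarrow> ('x, 'a) hist measure \<Rightarrow>
    (nat \<Rightarrow> ('x, 'a) hist \<times> 'a \<Rightarrow> ('x \<times> real) measure) \<Rightarrow> (real \<Rightarrow> ('x, 'a) policy) \<Rightarrow> real \<Rightarrow> real" where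
  "marginal_policy_effect D P Tr peps epsbar =
     vector_derivative (\<lambda>e. policy_value D P Tr (peps e)) (at 0 within {0..<epsbar})"


section \<open>Causal assumptions\<close>

definition cond_indep :: "'w measure \<Rightarrow> 'u measure \<Rightarrow> ('w \<Rightarrow> 'u) \<Rightarrow> 'v measure \<Rightarrow> ('w \<Rightarrow> 'v) \<Rightarrow>
    's measure \<Rightarrow> ('w \<Rightarrow> 's) \<Rightarrow> bool" where
  "cond_indep M NU U NV V NS S \<longleftrightarrow>
     U \<in> M \<rightarrow>\<^sub>M NU \<and> V \<in> M \<rightarrow>\<^sub>M NV \<and> S \<in> M \<rightarrow>\<^sub>M NS \<and>
     (\<forall>E\<in>sets NU. \<forall>F\<in>sets NV. AE w in M.
        real_cond_exp M (vimage_algebra (space M) S NS)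
            (indicator {w \<in> space M. U w \<in> E \<and> V w \<in> F}) w =
        real_cond_exp M (vimage_algebra (space M) S NS) (indicator {w \<in> space M. U w \<in> E}) w *
        real_cond_exp M (vimage_algebra (space M) S NS) (indicator {w \<in> space M. V w \<in> F}) w)"

text \<open>
  \<^term>\<open>PO t a\<close> is the pair \<open>(X\<^bsub>t+1\<^esub>(a), Y\<^sub>t(a))\<close> of potential outcomes for the action history
  \<open>a = a\<^bsub>1:t\<^esub>\<close>, given as a function on \<open>{1..t}\<close>; \<^term>\<open>Z\<close> is the observed trajectory.
\<close>

definition consistency :: "('x, 'a) design \<Rightarrow> 'w measure \<Rightarrow> ('w \<Rightarrow> ('x, 'a) hist) \<Rightarrow>
    (nat \<Rightarrow> (nat \<Rightarrow> 'a) \<Rightarrow> 'w \<Rightarrow> 'x \<times> real) \<Rightarrow> bool" where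
  "consistency D M Z PO \<longleftrightarrow> (\<forall>t\<in>{1..horizon D}.
     (\<forall>a\<in>(\<Pi>\<^sub>E s\<in>{1..t}. act_set D s). PO t a \<in> M \<rightarrow>\<^sub>M (cov_space D (Suc t) \<Otimes>\<^sub>M borel)) \<and>
     (AE w in M. (cov_at (Suc t) (Z w), out_at t (Z w)) = PO t (\<lambda>s\<in>{1..t}. act_at s (Z w)) w))"

definition sequential_unconfoundedness :: "('x, 'a) design \<Rightarrow> 'w measure \<Rightarrow>
    ('w \<Rightarrow> ('x, 'a) hist) \<Rightarrow> (nat \<Rightarrow> (nat \<Rightarrow> 'a) \<Rightarrow> 'w \<Rightarrow> 'x \<times> real) \<Rightarrow> bool" where
  "sequential_unconfoundedness D M Z PO \<longleftrightarrow>
     (\<forall>t\<in>{1..horizon D}. \<forall>a\<in>(\<Pi>\<^sub>E s\<in>{t..horizon D}. act_set D s).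
        cond_indep M
          (act_space D t) (\<lambda>w. act_at t (Z w))
          (\<Pi>\<^sub>M k\<in>{t..horizon D}. cov_space D (Suc k) \<Otimes>\<^sub>M borel)
          (\<lambda>w. \<lambda>k\<in>{t..horizon D}. PO k (\<lambda>s\<in>{1..k}. if s < t then act_at s (Z w) else a s) w)
          (hist_space D t) (\<lambda>w. hist_at t (Z w)))"


section \<open>Convolutional perturbation paths\<close>

text \<open>Any version of \<open>q\<^sub>t\<^sup>\<star>(s, a) = E[\<Gamma>\<^sub>t | S\<^sub>t = s, A\<^sub>t = a]\<close>.\<close>

definition is_action_value :: "('x, 'a) design \<Rightarrow> ('x, 'a) hist measure \<Rightarrow>
    (nat \<Rightarrow> ('x, 'a) hist \<times> 'a \<Rightarrow> real) \<Rightarrow> bool" where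
  "is_action_value D P qs \<longleftrightarrow> (\<forall>t\<in>{1..horizon D}.
     qs t \<in> borel_measurable (sa_space D t) \<and>
     (AE z in P. qs t (sa_at t z) =
        real_cond_exp P (vimage_algebra (space P) (sa_at t) (sa_space D t)) (reward_to_go D t) z))"

text \<open>
  The limits defining the forward and the backward operator are limits in mean: in
  \<open>L\<^sup>1(law of S\<^sub>t \<otimes> \<lambda>)\<close> for the densities, and in \<open>L\<^sup>1(law of (S\<^sub>t, A\<^sub>t))\<close> for functions in \<open>\<Q>\<^sub>t\<close>.
  Both hold in particular if they hold almost everywhere and the difference quotients are
  dominated by an integrable function. Almost everywhere limits alone would not do: mass of order
  \<open>\<epsilon>\<close> may move to a vanishing set unseen by the operators, and then \<open>E[L\<^sub>t q]\<close> and
  \<open>E[H\<^sub>t\<^sup>\<star> q]\<close> can differ.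
\<close>

definition is_forward_op :: "('x, 'a) design \<Rightarrow> ('x, 'a) hist measure \<Rightarrow> ('x, 'a) policy \<Rightarrow>
    (real \<Rightarrow> ('x, 'a) policy) \<Rightarrow> nat \<Rightarrow> (('x, 'a) hist \<times> 'a \<Rightarrow> real) \<Rightarrow> bool" where
  "is_forward_op D P pol peps t f \<longleftrightarrow>
     f \<in> borel_measurable (sa_space D t) \<and>
     ((\<lambda>e. \<integral>\<^sup>+p. ennreal \<bar>(peps e t p - pol t p) / e - f p\<bar> \<partial>(hist_law D P t \<Otimes>\<^sub>M act_space D t))
        \<longlongrightarrow> 0) (at_right 0)"

text \<open>
  The perturbation kernel \<open>M\<^bsub>t,\<epsilon>\<^esub>(\<sqdot> | a\<^sub>0, s)\<close> is the measure \<^term>\<open>Ker t e (s, a0)\<close>, so that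
  Dirac masses are covered without convention.
\<close>

definition backward_quotient :: "(nat \<Rightarrow> real \<Rightarrow> ('x, 'a) hist \<times> 'a \<Rightarrow> 'a measure) \<Rightarrow> nat \<Rightarrow>
    (('x, 'a) hist \<times> 'a \<Rightarrow> real) \<Rightarrow> real \<Rightarrow> ('x, 'a) hist \<times> 'a \<Rightarrow> real" where
  "backward_quotient Ker t q e p = ((\<integral>a. q (fst p, a) \<partial>Ker t e p) - q p) / e"

definition is_backward_op :: "('x, 'a) design \<Rightarrow> ('x, 'a) hist measure \<Rightarrow>
    (nat \<Rightarrow> real \<Rightarrow> ('x, 'a) hist \<times> 'a \<Rightarrow> 'a measure) \<Rightarrow> nat \<Rightarrow>
    (('x, 'a) hist \<times> 'a \<Rightarrow> real) set \<Rightarrow>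
    ((('x, 'a) hist \<times> 'a \<Rightarrow> real) \<Rightarrow> ('x, 'a) hist \<times> 'a \<Rightarrow> real) \<Rightarrow> bool" where
  "is_backward_op D P Ker t Q L \<longleftrightarrow> (\<forall>q\<in>Q.
     q \<in> borel_measurable (sa_space D t) \<and> L q \<in> borel_measurable (sa_space D t) \<and>
     (\<forall>\<^sub>F e in at_right 0. AE p in sa_law D P t. integrable (Ker t e p) (\<lambda>a. q (fst p, a))) \<and>
     ((\<lambda>e. \<integral>\<^sup>+p. ennreal \<bar>backward_quotient Ker t q e p - L q p\<bar> \<partial>sa_law D P t) \<longlongrightarrow> 0) (at_right 0))"

definition convolutional_path :: "('x, 'a) design \<Rightarrow> ('x, 'a) hist measure \<Rightarrow> ('x, 'a) policy \<Rightarrow>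
    (nat \<Rightarrow> ('x, 'a) hist \<times> 'a \<Rightarrow> real) \<Rightarrow> real \<Rightarrow> (real \<Rightarrow> ('x, 'a) policy) \<Rightarrow>
    (nat \<Rightarrow> real \<Rightarrow> ('x, 'a) hist \<times> 'a \<Rightarrow> 'a measure) \<Rightarrow>
    (nat \<Rightarrow> ('x, 'a) hist \<times> 'a \<Rightarrow> real) \<Rightarrow>
    (nat \<Rightarrow> (('x, 'a) hist \<times> 'a \<Rightarrow> real) set) \<Rightarrow>
    (nat \<Rightarrow> (('x, 'a) hist \<times> 'a \<Rightarrow> real) \<Rightarrow> ('x, 'a) hist \<times> 'a \<Rightarrow> real) \<Rightarrow> bool" where
  "convolutional_path D P pol qs epsbar peps Ker Lstar Q L \<longleftrightarrow>
     0 < epsbar \<and>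
     (\<forall>e\<in>{0..<epsbar}. is_policy D P (peps e)) \<and>
     (\<forall>t\<in>{1..horizon D}.
        (\<forall>e\<in>{0..<epsbar}. Ker t e \<in> sa_space D t \<rightarrow>\<^sub>M prob_algebra (act_space D t)) \<and>
        (\<forall>e\<in>{0..<epsbar}. AE s in hist_law D P t.
           density (act_space D t) (\<lambda>a. ennreal (peps e t (s, a))) =
           density (act_space D t) (\<lambda>a. ennreal (pol t (s, a))) \<bind> (\<lambda>a0. Ker t e (s, a0))) \<and>
        (\<forall>(s, a0)\<in>space (sa_space D t). Ker t 0 (s, a0) = return (act_space D t) a0) \<and>
        (\<forall>\<^sub>F e in at_right 0. AE s in hist_law D P t. AE a in act_space D t.
           pol t (s, a) = 0 \<longrightarrow> peps e t (s, a) = 0) \<and>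
        is_forward_op D P pol peps t (Lstar t) \<and>
        qs t \<in> Q t \<and>
        is_backward_op D P Ker t (Q t) (L t))"

text \<open>Division by zero gives the value \<open>0\<close> off \<open>{\<pi>\<^sub>t > 0}\<close>, a null set for the law of \<open>(S\<^sub>t, A\<^sub>t)\<close>.\<close>

definition true_score :: "('x, 'a) policy \<Rightarrow> (nat \<Rightarrow> ('x, 'a) hist \<times> 'a \<Rightarrow> real) \<Rightarrow>
    nat \<Rightarrow> ('x, 'a) hist \<times> 'a \<Rightarrow> real" where
  "true_score pol Lstar t p = Lstar t p / pol t p"


section \<open>The estimator\<close>

text \<open>Here \<^term>\<open>Lq\<close> stands for \<open>L\<^sub>t q\<close>.\<close>

definition asrw_score :: "('x, 'a) design \<Rightarrow> nat \<Rightarrow> (('x, 'a) hist \<times> 'a \<Rightarrow> real) \<Rightarrow>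
    (('x, 'a) hist \<times> 'a \<Rightarrow> real) \<Rightarrow> (('x, 'a) hist \<times> 'a \<Rightarrow> real) \<Rightarrow> ('x, 'a) hist \<Rightarrow> real" where
  "asrw_score D t q Lq H z =
     discount D ^ (t - 1) * Lq (sa_at t z) +
     discount D ^ (t - 1) * H (sa_at t z) * (reward_to_go D t z - q (sa_at t z))"

text \<open>
  The sample is \<open>z 0, \<dots>, z (n - 1)\<close> and \<^term>\<open>I k\<close>, for \<open>k < K\<close>, are the scoring folds. A nuisance
  estimate is a map from training samples to functions of \<open>(s, a)\<close>; the estimate for fold \<open>k\<close>
  receives the sample restricted to the complement of \<^term>\<open>I k\<close>.
\<close>

definition training :: "nat \<Rightarrow> nat set \<Rightarrow> (nat \<Rightarrow> 'z) \<Rightarrow> nat \<Rightarrow> 'z" where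
  "training n J z = restrict z ({..<n} - J)"

definition asrw_estimator :: "('x, 'a) design \<Rightarrow>
    (nat \<Rightarrow> (('x, 'a) hist \<times> 'a \<Rightarrow> real) \<Rightarrow> ('x, 'a) hist \<times> 'a \<Rightarrow> real) \<Rightarrow>
    nat \<Rightarrow> (nat \<Rightarrow> nat set) \<Rightarrow>
    (nat \<Rightarrow> nat \<Rightarrow> (nat \<Rightarrow> ('x, 'a) hist) \<Rightarrow> ('x, 'a) hist \<times> 'a \<Rightarrow> real) \<Rightarrow>
    (nat \<Rightarrow> nat \<Rightarrow> (nat \<Rightarrow> ('x, 'a) hist) \<Rightarrow> ('x, 'a) hist \<times> 'a \<Rightarrow> real) \<Rightarrow>
    nat \<Rightarrow> (nat \<Rightarrow> ('x, 'a) hist) \<Rightarrow> real" where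
  "asrw_estimator D L K I qh Hh n z =
     1 / real n * (\<Sum>k<K. \<Sum>i\<in>I k. \<Sum>t = 1..horizon D.
       (let d = training n (I k) z
        in asrw_score D t (qh k t d) (L t (qh k t d)) (Hh k t d) (z i)))"

definition asrw_oracle :: "('x, 'a) design \<Rightarrow>
    (nat \<Rightarrow> (('x, 'a) hist \<times> 'a \<Rightarrow> real) \<Rightarrow> ('x, 'a) hist \<times> 'a \<Rightarrow> real) \<Rightarrow>
    (nat \<Rightarrow> ('x, 'a) hist \<times> 'a \<Rightarrow> real) \<Rightarrow> (nat \<Rightarrow> ('x, 'a) hist \<times> 'a \<Rightarrow> real) \<Rightarrow>
    nat \<Rightarrow> (nat \<Rightarrow> ('x, 'a) hist) \<Rightarrow> real" where
  "asrw_oracle D L qs Hs n z =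
     (\<Sum>t = 1..horizon D. 1 / real n * (\<Sum>i<n. discount D ^ (t - 1) *
        (L t (qs t) (sa_at t (z i)) +
         Hs t (sa_at t (z i)) * (reward_to_go D t (z i) - qs t (sa_at t (z i))))))"

definition influence :: "('x, 'a) design \<Rightarrow>
    (nat \<Rightarrow> (('x, 'a) hist \<times> 'a \<Rightarrow> real) \<Rightarrow> ('x, 'a) hist \<times> 'a \<Rightarrow> real) \<Rightarrow>
    (nat \<Rightarrow> ('x, 'a) hist \<times> 'a \<Rightarrow> real) \<Rightarrow> (nat \<Rightarrow> ('x, 'a) hist \<times> 'a \<Rightarrow> real) \<Rightarrow>
    ('x, 'a) hist \<Rightarrow> real" where
  "influence D L qs Hs z = (\<Sum>t = 1..horizon D. discount D ^ (t - 1) *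
     (L t (qs t) (sa_at t z) + Hs t (sa_at t z) * (reward_to_go D t z - qs t (sa_at t z))))"


section \<open>Norms and stochastic convergence\<close>

definition square_integrable :: "'b measure \<Rightarrow> ('b \<Rightarrow> real) \<Rightarrow> bool" where
  "square_integrable M f \<longleftrightarrow> f \<in> borel_measurable M \<and> integrable M (\<lambda>x. (f x)\<^sup>2)"

definition L2_norm :: "'b measure \<Rightarrow> ('b \<Rightarrow> real) \<Rightarrow> ennreal" where
  "L2_norm M f = (if square_integrable M f then ennreal (sqrt (\<integral>x. (f x)\<^sup>2 \<partial>M)) else \<infinity>)"

definition little_o_p :: "'b measure \<Rightarrow> (nat \<Rightarrow> 'b \<Rightarrow> ennreal) \<Rightarrow> (nat \<Rightarrow> real) \<Rightarrow> bool" where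
  "little_o_p N W r \<longleftrightarrow> (\<forall>n. W n \<in> borel_measurable N) \<and>
     (\<forall>\<delta>>0. (\<lambda>n. measure N {w \<in> space N. W n w > ennreal (\<delta> * r n)}) \<longlonglongrightarrow> 0)"

definition tendsto_in_prob :: "'b measure \<Rightarrow> (nat \<Rightarrow> 'b \<Rightarrow> real) \<Rightarrow> real \<Rightarrow> bool" where
  "tendsto_in_prob N W c \<longleftrightarrow> (\<forall>n. W n \<in> borel_measurable N) \<and>
     (\<forall>\<delta>>0. (\<lambda>n. measure N {w \<in> space N. \<bar>W n w - c\<bar> > \<delta>}) \<longlonglongrightarrow> 0)"

text \<open>The normal law with variance \<open>v \<ge> 0\<close>; for \<open>v = 0\<close> it is the point mass at \<open>m\<close>.\<close>

definition normal_law :: "real \<Rightarrow> real \<Rightarrow> real measure" where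
  "normal_law m v = distr std_normal_distribution borel (\<lambda>x. m + sqrt v * x)"

end

(*
Write w_e for the likelihood ratio of the perturbed against the status-quo policy. For small e the
counterfactual law has density prod_t w_{t,e} with respect to P. Since (w_{t,e} - 1)/e tends to the
score H_t in L1, so does the difference quotient of the product to sum_t H_t; as outcomes are
bounded, Theta = E[Gamma_1 sum_t H_t] = sum_t gamma^(t-1) E[H_t Gamma_t], because H_t has
conditional mean zero given S_t.

The identity between the kernel and the perturbed policy gives E[L_t q] = E[H_t q] for bounded q.
Hence the influence function has mean Theta, and replacing the true pair (q0, H0) by estimates
(q, H) changes the mean of the score at time t only by -gamma^(t-1) E[(H - H0)(q - q0)], which is
o_p(n^(-1/2)), while its second moment tends to zero; for the term H0 (q - q0), with H0 only in L2,
this uses the common bound on q and q0. Conditionally on the training folds, Chebyshev's inequality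
makes the remainder on each scoring fold negligible, and the central limit theorem applies to the
oracle estimator.
*)

theory Submission
  imports Defs
begin

section \<open>Convergence in probability and a central limit theorem with remainder\<close>

text \<open>Difference quotients are handled by convergence in mean, \<open>L1_tendsto\<close>. It
  passes to integrals without a dominating function and survives multiplication by a bounded
  function, but it is not closed under products, and likelihood ratios are unbounded. The product
  over time is therefore built one action at a time; its cross term is controlled by truncating the
  limit, never the quotient.

  The second obstacle is null sets. The bounds on \<open>q\<close> hold only almost surely under the
  baseline law, while the kernel evaluates \<open>q\<close> at moved actions. Mixing the kernels
  over the baseline law gives a measure with density \<open>w\<close> against that law, so
  \<open>q\<close> may be replaced under the kernels by a version bounded everywhere.

  The rates enter only through their product: if \<open>a\<close> and \<open>b\<close> are the two
  rate factors, the means need \<open>n * (a * b)^2\<close> to stay bounded, whereas the second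
  moments merely have to vanish, so one of the exponents may be 0.\<close>

lemma (in prob_space) iid_sum_second_moment:
  fixes X :: "'i \<Rightarrow> 'a \<Rightarrow> real" and m v :: real
  assumes I: "finite I" and ind: "indep_vars (\<lambda>_. borel) X I"
    and sq: "\<And>i. i \<in> I \<Longrightarrow> integrable M (\<lambda>x. (X i x)\<^sup>2)"
    and m: "\<And>i. i \<in> I \<Longrightarrow> expectation (X i) = m"
    and v: "\<And>i. i \<in> I \<Longrightarrow> expectation (\<lambda>x. (X i x)\<^sup>2) = v"
  shows "integrable M (\<lambda>x. (\<Sum>i\<in>I. X i x)\<^sup>2)"
    and "expectation (\<lambda>x. (\<Sum>i\<in>I. X i x)\<^sup>2) \<le> card I * v + (card I)\<^sup>2 * m\<^sup>2"
proof -
  have rv: "X i \<in> borel_measurable M" if "i \<in> I" for i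
    using ind that by (auto simp: indep_vars_def)
  have int: "integrable M (X i)" if "i \<in> I" for i
    using square_integrable_imp_integrable rv sq that by blast
  \<comment> \<open>On the diagonal \<open>v\<close> alone would do. Adding the nonnegative
    \<open>m\<^sup>2\<close> there gives one formula for all pairs.\<close>
  have prod: "integrable M (\<lambda>x. X i x * X j x)
      \<and> expectation (\<lambda>x. X i x * X j x) \<le> m\<^sup>2 + (if i = j then v else 0)"
    if ij: "i \<in> I" "j \<in> I" for i j
  proof (cases "i = j")
    case True
    then show ?thesis using sq[of i] v[of i] ij by (simp add: power2_eq_square)
  next
    case False
    have *: "indep_var borel (X i) borel (X j)"
    proof -
      have "indep_var borel ((\<lambda>f. f i) \<circ> (\<lambda>\<omega>. restrict (\<lambda>i. X i \<omega>) {i}))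
          borel ((\<lambda>f. f j) \<circ> (\<lambda>\<omega>. restrict (\<lambda>i. X i \<omega>) {j}))"
        using ij False
        by (intro indep_var_compose[OF indep_var_restrict[OF ind]]) auto
      then show ?thesis by (simp add: comp_def)
    qed
    show ?thesis
      using indep_var_lebesgue_integral[OF *] indep_var_integrable[OF *] int ij m False
      by (simp add: power2_eq_square)
  qed
  have eq: "(\<Sum>i\<in>I. X i x)\<^sup>2 = (\<Sum>i\<in>I. \<Sum>j\<in>I. X i x * X j x)" for x
    by (simp add: power2_eq_square sum_product)
  show "integrable M (\<lambda>x. (\<Sum>i\<in>I. X i x)\<^sup>2)"
    unfolding eq using prod by (intro Bochner_Integration.integrable_sum) auto
  have "expectation (\<lambda>x. (\<Sum>i\<in>I. X i x)\<^sup>2) =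
      (\<Sum>i\<in>I. \<Sum>j\<in>I. expectation (\<lambda>x. X i x * X j x))"
    unfolding eq using prod
    by (simp add: Bochner_Integration.integral_sum Bochner_Integration.integrable_sum cong: sum.cong)
  also have "\<dots> \<le> (\<Sum>i\<in>I. \<Sum>j\<in>I. m\<^sup>2 + (if i = j then v else 0))"
    using prod by (intro sum_mono) auto
  \<comment> \<open>The second moment is multiplied by \<open>card I\<close>, the squared mean by
    its square: hence a score error needs a rate for its mean and only smallness for its second
    moment.\<close>
  also have "\<dots> = card I * v + (card I)\<^sup>2 * m\<^sup>2"
    using I by (simp add: sum.distrib power2_eq_square algebra_simps)
  finally show "expectation (\<lambda>x. (\<Sum>i\<in>I. X i x)\<^sup>2) \<le> card I * v + (card I)\<^sup>2 * m\<^sup>2" .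
qed

text \<open>
  By independence \<open>d\<close> may be frozen; the summands are then i.i.d. and Chebyshev's inequality applies.
\<close>

lemma (in prob_space) cond_chebyshev:
  fixes G :: "(nat \<Rightarrow> 'b) \<times> 'b \<Rightarrow> real"
  assumes ind: "indep_vars (\<lambda>_. S) Zs UNIV" and law: "\<And>i. distr M S (Zs i) = P"
    and I: "finite I" "I \<inter> J = {}" "card I \<le> n" and n: "0 < n"
    and G: "G \<in> borel_measurable ((\<Pi>\<^sub>M i\<in>J. S) \<Otimes>\<^sub>M S)"
    and eta: "0 < \<eta>" and delta: "0 < \<delta>"
  defines "d \<equiv> \<lambda>w. restrict (\<lambda>i. Zs i w) J"
  shows "prob {w \<in> space M. \<delta> * sqrt n < \<bar>\<Sum>i\<in>I. G (d w, Zs i w)\<bar>} \<le>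
    prob {w \<in> space M. \<not> ((\<integral>\<^sup>+z. ennreal ((G (d w, z))\<^sup>2) \<partial>P) \<le> ennreal \<eta> \<and>
                            n * (\<integral>z. G (d w, z) \<partial>P)\<^sup>2 \<le> \<eta>)} + 2 * \<eta> / \<delta>\<^sup>2"
proof -
  note [measurable] = G
  have Zs [measurable]: "Zs i \<in> M \<rightarrow>\<^sub>M S" for i using ind by (auto simp: indep_vars_def)
  have sP [measurable_cong]: "sets P = sets S" using law[of 0] by auto
  interpret P: prob_space P unfolding law[symmetric, of 0] by (rule prob_space_distr) simp
  define e where "e = (\<lambda>w. restrict (\<lambda>i. Zs i w) I)"
  have d_m [measurable]: "d \<in> M \<rightarrow>\<^sub>M (\<Pi>\<^sub>M i\<in>J. S)" unfolding d_def by measurable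
  have e_m [measurable]: "e \<in> M \<rightarrow>\<^sub>M (\<Pi>\<^sub>M i\<in>I. S)" unfolding e_def by measurable
  define good where "good = (\<lambda>d. (\<integral>\<^sup>+z. ennreal ((G (d, z))\<^sup>2) \<partial>P) \<le> ennreal \<eta> \<and>
                            n * (\<integral>z. G (d, z) \<partial>P)\<^sup>2 \<le> \<eta>)"
  have good_m [measurable]: "Measurable.pred (\<Pi>\<^sub>M i\<in>J. S) good"
    unfolding good_def by measurable
  define big where "big = (\<lambda>(d, e). \<delta> * sqrt n < \<bar>\<Sum>i\<in>I. G (d, e i)\<bar>)"
  have big_m [measurable]: "Measurable.pred ((\<Pi>\<^sub>M i\<in>J. S) \<Otimes>\<^sub>M (\<Pi>\<^sub>M i\<in>I. S)) big"
    unfolding big_def by measurable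
  have cheb: "emeasure M {w \<in> space M. big (x, e w)} \<le> ennreal (2 * \<eta> / \<delta>\<^sup>2)"
    if x: "x \<in> space (\<Pi>\<^sub>M i\<in>J. S)" and gx: "good x" for x
  proof -
    have [measurable]: "(\<lambda>z. G (x, z)) \<in> borel_measurable S" using x by measurable
    define X where "X = (\<lambda>i w. G (x, Zs i w))"
    define m where "m = (\<integral>z. G (x, z) \<partial>P)"
    define v where "v = (\<integral>z. (G (x, z))\<^sup>2 \<partial>P)"
    \<comment> \<open>The second moment in \<open>good\<close> is a nonnegative integral because a
      bound on it entails integrability, which a bound on a Bochner integral would not.\<close>
    have iv: "integrable P (\<lambda>z. (G (x, z))\<^sup>2)"
      using gx unfolding good_def
      by (intro integrableI_bounded) (auto simp: order_le_less_trans[OF _ ennreal_less_top])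
    have v: "v \<le> \<eta>" "0 \<le> v"
      using gx iv eta unfolding good_def v_def
      by (auto simp: nn_integral_eq_integral)
    have X_ind: "indep_vars (\<lambda>_. borel) X I"
      unfolding X_def by (rule indep_vars_compose2[OF indep_vars_subset[OF ind]]) auto
    have "integrable M (\<lambda>w. (X i w)\<^sup>2)" for i
      using iv unfolding law[symmetric, of i] X_def by (subst (asm) integrable_distr_eq) auto
    moreover have "expectation (X i) = m" for i
      unfolding law[symmetric, of i] X_def m_def by (subst integral_distr) auto
    moreover have "expectation (\<lambda>w. (X i w)\<^sup>2) = v" for i
      unfolding law[symmetric, of i] X_def v_def by (subst integral_distr) auto
    ultimately have s: "integrable M (\<lambda>w. (\<Sum>i\<in>I. X i w)\<^sup>2)"
      "expectation (\<lambda>w. (\<Sum>i\<in>I. X i w)\<^sup>2) \<le> card I * v + (card I)\<^sup>2 * m\<^sup>2"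
      using iid_sum_second_moment[OF I(1) X_ind] by auto
    \<comment> \<open>Only \<open>card I \<le> n\<close> is known of the fold size. Variance part
      and mean part contribute \<open>n * \<eta>\<close> each, which is the 2 in the final
      bound.\<close>
    have "card I * v \<le> n * \<eta>" using v I(3) eta by (intro mult_mono) auto
    moreover have "(card I)\<^sup>2 * m\<^sup>2 \<le> n * \<eta>"
    proof -
      have "(card I)\<^sup>2 * m\<^sup>2 \<le> n\<^sup>2 * m\<^sup>2" using I(3) by (intro mult_right_mono) auto
      also have "\<dots> = n * (n * m\<^sup>2)" by (simp add: power2_eq_square)
      also have "\<dots> \<le> n * \<eta>" using gx unfolding good_def m_def by (intro mult_left_mono) auto
      finally show ?thesis .
    qed
    ultimately have s2: "expectation (\<lambda>w. (\<Sum>i\<in>I. X i w)\<^sup>2) \<le> 2 * n * \<eta>"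
      using s(2) by simp
    have pos: "0 < \<delta>\<^sup>2 * n" using delta n by simp
    have "emeasure M {w \<in> space M. big (x, e w)}
        \<le> emeasure M {w \<in> space M. (\<Sum>i\<in>I. X i w)\<^sup>2 \<ge> \<delta>\<^sup>2 * n}"
    proof (rule emeasure_mono)
      show "{w \<in> space M. big (x, e w)} \<subseteq> {w \<in> space M. (\<Sum>i\<in>I. X i w)\<^sup>2 \<ge> \<delta>\<^sup>2 * n}"
      proof safe
        fix w assume "big (x, e w)"
        then have "\<delta> * sqrt n \<le> \<bar>\<Sum>i\<in>I. X i w\<bar>" by (simp add: big_def e_def X_def)
        then have "(\<delta> * sqrt n)\<^sup>2 \<le> \<bar>\<Sum>i\<in>I. X i w\<bar>\<^sup>2" using delta by (intro power_mono) auto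
        then show "\<delta>\<^sup>2 * n \<le> (\<Sum>i\<in>I. X i w)\<^sup>2" by (simp add: power_mult_distrib)
      qed
      show "{w \<in> space M. (\<Sum>i\<in>I. X i w)\<^sup>2 \<ge> \<delta>\<^sup>2 * n} \<in> sets M"
        unfolding X_def by measurable
    qed
    also have "\<dots> \<le> ennreal (1 / (\<delta>\<^sup>2 * n) * expectation (\<lambda>w. (\<Sum>i\<in>I. X i w)\<^sup>2))"
      using s(1) pos by (intro integral_Markov_inequality) auto
    also have "\<dots> \<le> ennreal (1 / (\<delta>\<^sup>2 * n) * (2 * n * \<eta>))"
      using s2 pos by (intro ennreal_leI mult_left_mono) auto
    also have "1 / (\<delta>\<^sup>2 * n) * (2 * n * \<eta>) = 2 * \<eta> / \<delta>\<^sup>2" using n delta by simp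
    finally show ?thesis .
  qed
  \<comment> \<open>As \<open>I\<close> and \<open>J\<close> are disjoint, training and scoring
    samples are independent. Under the product law, Fubini turns the bound for each frozen good
    \<open>x\<close> into one for the joint event.\<close>
  have joint: "distr M (PiM J (\<lambda>_. S)) d \<Otimes>\<^sub>M distr M (PiM I (\<lambda>_. S)) e
      = distr M (PiM J (\<lambda>_. S) \<Otimes>\<^sub>M PiM I (\<lambda>_. S)) (\<lambda>w. (d w, e w))"
    using indep_var_restrict[OF ind, of J I] I(2)
    unfolding indep_var_distribution_eq d_def e_def by auto
  interpret dd: prob_space "distr M (PiM J (\<lambda>_. S)) d" by (rule prob_space_distr) simp
  interpret ee: prob_space "distr M (PiM I (\<lambda>_. S)) e" by (rule prob_space_distr) simp
  have "emeasure M {w \<in> space M. good (d w) \<and> big (d w, e w)}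
      = (\<integral>\<^sup>+w. indicator {w \<in> space M. good (d w) \<and> big (d w, e w)} w \<partial>M)"
    by simp
  also have "\<dots> = (\<integral>\<^sup>+w. (\<lambda>(x, y). indicator {p. good (fst p) \<and> big p} (x, y)) (d w, e w) \<partial>M)"
    by (intro nn_integral_cong) (simp add: indicator_def)
  also have "\<dots> = (\<integral>\<^sup>+p. (\<lambda>(x, y). indicator {p. good (fst p) \<and> big p} (x, y))p
      \<partial>distr M (PiM J (\<lambda>_. S) \<Otimes>\<^sub>M PiM I (\<lambda>_. S)) (\<lambda>w. (d w, e w)))"
    by (subst nn_integral_distr) auto
  also have "\<dots> = (\<integral>\<^sup>+x. \<integral>\<^sup>+y. indicator {p. good (fst p) \<and> big p} (x, y)
      \<partial>distr M (PiM I (\<lambda>_. S)) e \<partial>distr M (PiM J (\<lambda>_. S)) d)"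
    unfolding joint[symmetric] by (subst ee.nn_integral_fst[symmetric]) auto
  also have "\<dots> \<le> (\<integral>\<^sup>+x. ennreal (2 * \<eta> / \<delta>\<^sup>2) \<partial>distr M (PiM J (\<lambda>_. S)) d)"
  proof (rule nn_integral_mono)
    fix x assume x: "x \<in> space (distr M (PiM J (\<lambda>_. S)) d)"
    then have x': "x \<in> space (PiM J (\<lambda>_. S))" by simp
    have "(\<integral>\<^sup>+y. indicator {p. good (fst p) \<and> big p} (x, y) \<partial>distr M (PiM I (\<lambda>_. S)) e)
        = (\<integral>\<^sup>+w. indicator {p. good (fst p) \<and> big p} (x, e w) \<partial>M)"
      using x' by (subst nn_integral_distr) auto
    also have "\<dots> = (\<integral>\<^sup>+w. indicator {w \<in> space M. good x \<and> big (x, e w)} w \<partial>M)"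
      by (intro nn_integral_cong) (simp add: indicator_def)
    also have "\<dots> = emeasure M {w \<in> space M. good x \<and> big (x, e w)}"
      using x' by simp
    also have "\<dots> \<le> ennreal (2 * \<eta> / \<delta>\<^sup>2)"
      using cheb[OF x'] by (cases "good x") auto
    finally show "(\<integral>\<^sup>+y. indicator {p. good (fst p) \<and> big p} (x, y)
        \<partial>distr M (PiM I (\<lambda>_. S)) e) \<le> ennreal (2 * \<eta> / \<delta>\<^sup>2)" .
  qed
  also have "\<dots> = ennreal (2 * \<eta> / \<delta>\<^sup>2)" using dd.emeasure_space_1 by simp
  finally have main: "prob {w \<in> space M. good (d w) \<and> big (d w, e w)} \<le> 2 * \<eta> / \<delta>\<^sup>2"
    using eta by (simp add: emeasure_eq_measure)
  have "{w \<in> space M. \<delta> * sqrt n < \<bar>\<Sum>i\<in>I. G (d w, Zs i w)\<bar>}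
      \<subseteq> {w \<in> space M. \<not> good (d w)} \<union> {w \<in> space M. good (d w) \<and> big (d w, e w)}"
    by (auto simp: big_def e_def)
  then have "prob {w \<in> space M. \<delta> * sqrt n < \<bar>\<Sum>i\<in>I. G (d w, Zs i w)\<bar>} \<le>
     prob ({w \<in> space M. \<not> good (d w)} \<union> {w \<in> space M. good (d w) \<and> big (d w, e w)})"
    by (intro finite_measure_mono) auto
  also have "\<dots> \<le> prob {w \<in> space M. \<not> good (d w)}
      + prob {w \<in> space M. good (d w) \<and> big (d w, e w)}"
    by (intro measure_Un_le) measurable
  finally show ?thesis using main unfolding good_def by simp
qed

text \<open>The integral is split at a threshold for \<open>R\<close>: below it the integrand is at
  most \<open>c\<close> times the threshold, above it at most \<open>C\<close>, on an event whose
  probability vanishes. Used to bound the difference of two characteristic functions.\<close>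

lemma tendsto_in_prob_abs_le:
  assumes "prob_space N" "tendsto_in_prob N R 0"
    and f: "\<And>n. f n \<in> borel_measurable N" "\<And>n w. \<bar>f n w\<bar> \<le> C" "\<And>n w. \<bar>f n w\<bar> \<le> c * \<bar>R n w\<bar>"
    and c: "0 \<le> c"
  shows "(\<lambda>n. \<integral>w. f n w \<partial>N) \<longlonglongrightarrow> (0::real)"
proof (rule tendstoI)
  interpret prob_space N by fact
  fix r :: real assume r: "0 < r"
  \<comment> \<open>The \<open>+ 1\<close> keeps the denominator positive for \<open>c = 0\<close>;
    each of the two parts gets half of \<open>r\<close>.\<close>
  define \<delta> where "\<delta> = r / (2 * (c + 1))"
  have \<delta>: "0 < \<delta>" "c * \<delta> \<le> r / 2"
    using r c by (auto simp: \<delta>_def field_simps)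
  have [measurable]: "R n \<in> borel_measurable N" for n
    using assms(2) by (auto simp: tendsto_in_prob_def)
  note [measurable] = f(1)
  have "(\<lambda>n. prob {w \<in> space N. \<bar>R n w - 0\<bar> > \<delta>}) \<longlonglongrightarrow> 0"
    using assms(2) \<delta> unfolding tendsto_in_prob_def by blast
  then have "(\<lambda>n. C * prob {w \<in> space N. \<bar>R n w\<bar> > \<delta>}) \<longlonglongrightarrow> C * 0"
    by (intro tendsto_intros) simp
  then have "\<forall>\<^sub>F n in sequentially. C * prob {w \<in> space N. \<bar>R n w\<bar> > \<delta>} < r / 2"
    using r by (intro order_tendstoD(2)) auto
  then show "\<forall>\<^sub>F n in sequentially. dist (\<integral>w. f n w \<partial>N) 0 < r"
  proof eventually_elim
    case (elim n)
    have int: "integrable N (f n)"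
      by (rule integrable_const_bound[where B = C]) (use f in auto)
    have "\<bar>f n w\<bar> \<le> c * \<delta> + C * indicator {w \<in> space N. \<bar>R n w\<bar> > \<delta>} w" if "w \<in> space N" for w
    proof (cases "\<bar>R n w\<bar> > \<delta>")
      case True then show ?thesis using f(2)[of n w] c \<delta> that by (simp add: add_increasing)
    next
      case False
      then have "c * \<bar>R n w\<bar> \<le> c * \<delta>" using c by (intro mult_left_mono) auto
      then show ?thesis using f(3)[of n w] False by simp
    qed
    then have "\<bar>\<integral>w. f n w \<partial>N\<bar> \<le>
        (\<integral>w. c * \<delta> + C * indicator {w \<in> space N. \<bar>R n w\<bar> > \<delta>} w \<partial>N)"
      using int
      by (intro order_trans[OF integral_abs_bound] integral_mono integrable_abs Bochner_Integration.integrable_add)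
        (auto intro!: integrable_real_indicator simp: emeasure_eq_measure)
    also have "\<dots> = c * \<delta> + C * prob {w \<in> space N. \<bar>R n w\<bar> > \<delta>}"
      by (subst Bochner_Integration.integral_add)
        (auto intro!: integrable_real_indicator simp: prob_space emeasure_eq_measure)
    finally show ?case using elim \<delta> by simp
  qed
qed

lemma tendsto_in_prob_sum:
  assumes N: "prob_space N" and "finite A" and "\<And>k. k \<in> A \<Longrightarrow> tendsto_in_prob N (R k) 0"
  shows "tendsto_in_prob N (\<lambda>n w. \<Sum>k\<in>A. R k n w) 0"
  using assms(2,3)
proof (induction A rule: finite_induct)
  case empty
  then show ?case by (simp add: tendsto_in_prob_def)
next
  case (insert a A)
  interpret prob_space N by fact
  define X Y where "X = R a" and "Y = (\<lambda>n w. \<Sum>k\<in>A. R k n w)"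
  have XY: "tendsto_in_prob N X 0" "tendsto_in_prob N Y 0"
    using insert unfolding X_def Y_def by auto
  then have [measurable]: "X n \<in> borel_measurable N" "Y n \<in> borel_measurable N" for n
    by (auto simp: tendsto_in_prob_def)
  have "tendsto_in_prob N (\<lambda>n w. X n w + Y n w) 0"
    unfolding tendsto_in_prob_def
  proof (intro conjI allI impI)
    fix \<delta> :: real assume \<delta>: "0 < \<delta>"
    have lim: "(\<lambda>n. prob {w \<in> space N. \<bar>X n w - 0\<bar> > \<delta> / 2}
        + prob {w \<in> space N. \<bar>Y n w - 0\<bar> > \<delta> / 2}) \<longlonglongrightarrow> 0"
      using XY half_gt_zero[OF \<delta>] unfolding tendsto_in_prob_def by (intro tendsto_add_zero) blast+
    show "(\<lambda>n. prob {w \<in> space N. \<bar>X n w + Y n w - 0\<bar> > \<delta>}) \<longlonglongrightarrow> 0"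
    proof (rule Lim_null_comparison[OF _ lim])
      show "\<forall>\<^sub>F n in sequentially. norm (prob {w \<in> space N. \<bar>X n w + Y n w - 0\<bar> > \<delta>}) \<le>
        prob {w \<in> space N. \<bar>X n w - 0\<bar> > \<delta> / 2} + prob {w \<in> space N. \<bar>Y n w - 0\<bar> > \<delta> / 2}"
      proof (rule always_eventually, rule allI)
        fix n
        have "prob {w \<in> space N. \<bar>X n w + Y n w - 0\<bar> > \<delta>} \<le>
          prob ({w \<in> space N. \<bar>X n w - 0\<bar> > \<delta> / 2} \<union> {w \<in> space N. \<bar>Y n w - 0\<bar> > \<delta> / 2})"
          by (intro finite_measure_mono) auto
        also have "\<dots> \<le> prob {w \<in> space N. \<bar>X n w - 0\<bar> > \<delta> / 2} + prob {w \<in> space N. \<bar>Y n w - 0\<bar> > \<delta> / 2}"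
          by (intro measure_Un_le) measurable
        finally show "norm (prob {w \<in> space N. \<bar>X n w + Y n w - 0\<bar> > \<delta>}) \<le> \<dots>" by simp
      qed
    qed
  qed measurable
  then show ?case using insert by (simp add: X_def Y_def)
qed

section \<open>Characteristic functions and the limit law\<close>

lemma char_normal_law: "char (normal_law 0 v) t = char std_normal_distribution (sqrt v * t)"
  unfolding char_def normal_law_def
  by (subst integral_distr) (auto simp: mult_ac)

lemma real_distribution_normal_law: "real_distribution (normal_law m v)"
  unfolding normal_law_def
  using real_dist_normal_dist
  by (intro prob_space.real_distribution_distr real_distribution.axioms) auto

text \<open>Slutsky's theorem for characteristic functions: adding \<open>r\<close> multiplies
  \<open>iexp (t * x)\<close> by a factor whose distance to 1 is at most
  \<open>\<bar>t * r\<bar>\<close> and at most 2, and the mean of the smaller bound tends to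
  zero.\<close>

lemma char_perturb:
  assumes N: "prob_space N" and X [measurable]: "\<And>n. X n \<in> borel_measurable N"
    and R: "tendsto_in_prob N R 0" and "(\<lambda>n. char (distr N borel (X n)) t) \<longlonglongrightarrow> c"
  shows "(\<lambda>n. char (distr N borel (\<lambda>w. X n w + R n w)) t) \<longlonglongrightarrow> c"
proof -
  interpret prob_space N by fact
  have [measurable]: "R n \<in> borel_measurable N" for n
    using R by (auto simp: tendsto_in_prob_def)
  have int: "integrable N (\<lambda>w. iexp (f w))" if [measurable]: "f \<in> borel_measurable N" for f
    by (rule integrable_const_bound[where B = 1]) auto
  have c: "char (distr N borel f) t = (CLINT w|N. iexp (t * f w))"
    if [measurable]: "f \<in> borel_measurable N" for f
    unfolding char_def by (subst integral_distr) auto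
  define f where "f = (\<lambda>n w. min 2 (\<bar>t\<bar> * \<bar>R n w\<bar>))"
  have f: "(\<lambda>n. \<integral>w. f n w \<partial>N) \<longlonglongrightarrow> 0"
    by (rule tendsto_in_prob_abs_le[OF N R, where C = 2 and c = "\<bar>t\<bar>"]) (auto simp: f_def)
  have bd: "norm (iexp (t * (x + r)) - iexp (t * x)) \<le> min 2 (\<bar>t\<bar> * \<bar>r\<bar>)" for x r
  proof -
    have "iexp (t * (x + r)) - iexp (t * x) = iexp (t * x) * (iexp (t * r) - 1)"
      by (simp add: exp_add[symmetric] algebra_simps)
    moreover have "norm (iexp (t * r) - 1) \<le> \<bar>t * r\<bar>"
      using iexp_approx1[of "t * r" 0] by simp
    moreover have "norm (iexp (t * r) - 1) \<le> 2"
      using norm_triangle_ineq4[of "iexp (t * r)" 1] by simp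
    ultimately show ?thesis by (simp add: norm_mult abs_mult)
  qed
  have "(\<lambda>n. char (distr N borel (\<lambda>w. X n w + R n w)) t - char (distr N borel (X n)) t) \<longlonglongrightarrow> 0"
  proof (rule Lim_null_comparison[OF _ f], rule always_eventually, rule allI)
    fix n
    have "char (distr N borel (\<lambda>w. X n w + R n w)) t - char (distr N borel (X n)) t
        = (CLINT w|N. iexp (t * (X n w + R n w)) - iexp (t * X n w))"
      by (subst Bochner_Integration.integral_diff)
        (auto simp: c simp del: of_real_add of_real_mult intro!: int)
    also have "norm \<dots> \<le> (\<integral>w. norm (iexp (t * (X n w + R n w)) - iexp (t * X n w)) \<partial>N)"
      by (rule integral_norm_bound)
    also have "\<dots> \<le> (\<integral>w. f n w \<partial>N)"
    proof (rule integral_mono)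
      show "integrable N (\<lambda>w. norm (iexp (t * (X n w + R n w)) - iexp (t * X n w)))"
        by (intro integrable_norm Bochner_Integration.integrable_diff int) auto
      show "integrable N (f n)"
        by (rule integrable_const_bound[where B = 2]) (auto simp: f_def)
    qed (simp only: f_def bd)
    finally show "norm (char (distr N borel (\<lambda>w. X n w + R n w)) t - char (distr N borel (X n)) t)
      \<le> (\<integral>w. f n w \<partial>N)" .
  qed
  from tendsto_add[OF this assms(4)] show ?thesis by simp
qed

text \<open>The degenerate case \<open>v = 0\<close>, excluded from the library's central limit theorem, is included.\<close>

theorem clt_perturbed:
  fixes X :: "nat \<Rightarrow> 'n \<Rightarrow> real"
  assumes N: "prob_space N" and ind: "prob_space.indep_vars N (\<lambda>_. borel) X UNIV"
    and law: "\<And>i. distr N borel (X i) = \<mu>"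
    and sq: "integrable N (\<lambda>w. (X 0 w)\<^sup>2)" and mean: "(\<integral>w. X 0 w \<partial>N) = 0"
    and R: "tendsto_in_prob N R 0"
  shows "weak_conv_m (\<lambda>n. distr N borel (\<lambda>w. (\<Sum>i<n. X i w) / sqrt n + R n w))
    (normal_law 0 (\<integral>w. (X 0 w)\<^sup>2 \<partial>N))"
proof -
  interpret prob_space N by fact
  have [measurable]: "X i \<in> borel_measurable N" for i
    using ind by (auto simp: indep_vars_def)
  have R_m [measurable]: "R n \<in> borel_measurable N" for n
    using R by (auto simp: tendsto_in_prob_def)
  define v where "v = (\<integral>w. (X 0 w)\<^sup>2 \<partial>N)"
  have v0: "0 \<le> v" by (simp add: v_def)
  have sq': "integrable N (\<lambda>w. (X i w)\<^sup>2)" for i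
  proof -
    have "integrable \<mu> (\<lambda>x. x\<^sup>2)" unfolding law[of 0, symmetric] using sq
      by (subst integrable_distr_eq) auto
    then show ?thesis unfolding law[of i, symmetric] by (subst (asm) integrable_distr_eq) auto
  qed
  have mean': "expectation (X i) = 0" for i
  proof -
    have "(\<integral>x. x \<partial>\<mu>) = 0" unfolding law[of 0, symmetric] using mean
      by (subst integral_distr) auto
    then show ?thesis unfolding law[of i, symmetric] by (subst (asm) integral_distr) auto
  qed
  have var': "expectation (\<lambda>w. (X i w)\<^sup>2) = v" for i
  proof -
    have "(\<integral>x. x\<^sup>2 \<partial>\<mu>) = v" unfolding law[of 0, symmetric] v_def
      by (subst integral_distr) auto
    then show ?thesis unfolding law[of i, symmetric] by (subst (asm) integral_distr) auto
  qed
  have ch: "(\<lambda>n. char (distr N borel (\<lambda>w. (\<Sum>i<n. X i w) / sqrt n)) t) \<longlonglongrightarrow> char (normal_law 0 v) t" for t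
  proof (cases "v = 0")
    case True
    \<comment> \<open>Zero variance makes every summand vanish almost surely; the characteristic
      function is constantly 1, that of the point mass at 0.\<close>
    have z: "AE w in N. X i w = 0" for i
      using var'[of i] True integral_nonneg_eq_0_iff_AE[OF sq'[of i]] by auto
    have "char (distr N borel (\<lambda>w. (\<Sum>i<n. X i w) / sqrt n)) t = 1" for n
    proof -
      have "AE w in N. \<forall>i\<in>{..<n}. X i w = 0"
        using z by (intro AE_finite_allI) auto
      then have "AE w in N. iexp (t * ((\<Sum>i<n. X i w) / sqrt n)) = 1"
        by eventually_elim (simp)
      then have "(CLINT w|N. iexp (t * ((\<Sum>i<n. X i w) / sqrt n))) = (CLINT w|N. 1)"
        by (intro integral_cong_AE) auto
      then show ?thesis unfolding char_def by (subst integral_distr) (auto simp: prob_space)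
    qed
    moreover have "char (normal_law 0 v) t = 1"
      unfolding char_normal_law True by (simp add: char_std_normal_distribution)
    ultimately show ?thesis by simp
  next
    case False
    define \<sigma> where "\<sigma> = sqrt v"
    have \<sigma>: "0 < \<sigma>" "\<sigma>\<^sup>2 = v" using False v0 by (auto simp: \<sigma>_def)
    have "weak_conv_m (\<lambda>n. distr N borel (\<lambda>x. (\<Sum>i<n. X i x) / sqrt (n * \<sigma>\<^sup>2))) std_normal_distribution"
      using \<sigma> by (intro central_limit_theorem_zero_mean[OF ind mean' _ sq' _ law]) (auto simp: mean' var')
    \<comment> \<open>The limit theorem normalises by \<open>sqrt (n * \<sigma>\<^sup>2)\<close>;
      evaluating the characteristic functions at \<open>\<sigma> * t\<close> removes the factor
      \<open>\<sigma>\<close>.\<close>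
    from levy_continuity1[OF _ _ this, of "\<sigma> * t"]
    have "(\<lambda>n. char (distr N borel (\<lambda>x. (\<Sum>i<n. X i x) / sqrt (n * \<sigma>\<^sup>2))) (\<sigma> * t))
        \<longlonglongrightarrow> char std_normal_distribution (\<sigma> * t)"
      using real_dist_normal_dist by (auto intro: real_distribution_distr)
    moreover have "char (distr N borel (\<lambda>x. (\<Sum>i<n. X i x) / sqrt (n * \<sigma>\<^sup>2))) (\<sigma> * t)
       = char (distr N borel (\<lambda>w. (\<Sum>i<n. X i w) / sqrt n)) t" for n
      unfolding char_def using \<sigma>(1)
      by (subst (1 2) integral_distr) (auto simp: real_sqrt_mult mult_ac)
    ultimately show ?thesis by (simp add: char_normal_law \<sigma>_def)
  qed
  show ?thesis unfolding v_def[symmetric]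
    by (intro levy_continuity real_distribution_distr real_distribution_normal_law
        char_perturb[OF N _ R ch]) measurable
qed

section \<open>Perturbations differentiable in mean\<close>

text \<open>The distance is a nonnegative integral, meaningful before any integrability is known.
  Measurability is asked only eventually, because the perturbed policies are controlled only for
  small parameters.\<close>

definition L1_tendsto :: "'b measure \<Rightarrow> ('e \<Rightarrow> 'b \<Rightarrow> real) \<Rightarrow> ('b \<Rightarrow> real) \<Rightarrow> 'e filter \<Rightarrow> bool" where
  "L1_tendsto M f g F \<longleftrightarrow> g \<in> borel_measurable M \<and> (\<forall>\<^sub>F e in F. f e \<in> borel_measurable M) \<and>
     ((\<lambda>e. \<integral>\<^sup>+x. ennreal \<bar>f e x - g x\<bar> \<partial>M) \<longlongrightarrow> 0) F"

text \<open>A single integrable member of the family at distance less than one from the limit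
  already forces the limit to be integrable.\<close>

lemma L1_tendsto_integrable:
  assumes "L1_tendsto M f g F" and F: "F \<noteq> bot" and int: "\<forall>\<^sub>F e in F. integrable M (f e)"
  shows "integrable M g"
proof -
  have g [measurable]: "g \<in> borel_measurable M"
    and lim: "((\<lambda>e. \<integral>\<^sup>+x. ennreal \<bar>f e x - g x\<bar> \<partial>M) \<longlongrightarrow> 0) F"
    using assms(1) by (auto simp: L1_tendsto_def)
  have "\<forall>\<^sub>F e in F. (\<integral>\<^sup>+x. ennreal \<bar>f e x - g x\<bar> \<partial>M) < 1"
    using lim by (rule order_tendstoD) simp
  then have "\<forall>\<^sub>F e in F. integrable M (f e) \<and> (\<integral>\<^sup>+x. ennreal \<bar>f e x - g x\<bar> \<partial>M) < 1"
    using int by eventually_elim simp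
  then obtain e where e: "integrable M (f e)" "(\<integral>\<^sup>+x. ennreal \<bar>f e x - g x\<bar> \<partial>M) < 1"
    using eventually_happens'[OF F] by blast
  then have "(\<integral>\<^sup>+x. ennreal \<bar>f e x - g x\<bar> \<partial>M) < \<infinity>"
    using order_less_trans[OF e(2), of "\<infinity>"] by simp
  then have "integrable M (\<lambda>x. f e x - g x)"
    using e(1) by (intro integrableI_bounded) auto
  from Bochner_Integration.integrable_diff[OF e(1) this] show ?thesis by simp
qed

lemma L1_tendsto_integral:
  fixes g :: "'b \<Rightarrow> real"
  assumes L: "L1_tendsto M f g F" and int: "\<forall>\<^sub>F e in F. integrable M (f e)"
  shows "((\<lambda>e. \<integral>x. f e x \<partial>M) \<longlongrightarrow> (\<integral>x. g x \<partial>M)) F"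
proof (cases "F = bot")
  case False
  have g: "integrable M g" by (rule L1_tendsto_integrable[OF L False int])
  \<comment> \<open>\<open>tendsto_L1_int\<close> wants integrability at every index, but it holds
    only eventually; elsewhere the limit itself is substituted.\<close>
  define f' where "f' = (\<lambda>e. if integrable M (f e) then f e else g)"
  have "((\<lambda>e. \<integral>x. f' e x \<partial>M) \<longlongrightarrow> (\<integral>x. g x \<partial>M)) F"
  proof (rule tendsto_L1_int)
    show "integrable M (f' e)" for e using g by (simp add: f'_def)
    show "((\<lambda>e. \<integral>\<^sup>+ x. ennreal (norm (f' e x - g x)) \<partial>M) \<longlongrightarrow> 0) F"
      using L int unfolding L1_tendsto_def
      by (elim conjE Lim_transform_eventually) (auto elim!: eventually_mono simp: f'_def)
  qed (rule g)
  then show ?thesis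
    using int by (elim Lim_transform_eventually) (auto elim!: eventually_mono simp: f'_def)
qed simp

lemma L1_tendsto_mult_bounded:
  assumes L: "L1_tendsto M f g F" and u [measurable]: "u \<in> borel_measurable M"
    and B: "AE x in M. \<bar>u x\<bar> \<le> B"
  shows "L1_tendsto M (\<lambda>e x. u x * f e x) (\<lambda>x. u x * g x) F"
  unfolding L1_tendsto_def
proof (intro conjI)
  have g [measurable]: "g \<in> borel_measurable M"
    and fm: "\<forall>\<^sub>F e in F. f e \<in> borel_measurable M"
    and lim: "((\<lambda>e. \<integral>\<^sup>+x. ennreal \<bar>f e x - g x\<bar> \<partial>M) \<longlongrightarrow> 0) F"
    using L by (auto simp: L1_tendsto_def)
  show "(\<lambda>x. u x * g x) \<in> borel_measurable M" by simp
  show "\<forall>\<^sub>F e in F. (\<lambda>x. u x * f e x) \<in> borel_measurable M"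
    using fm by eventually_elim simp
  \<comment> \<open>The sign of \<open>B\<close> is unknown, since an almost everywhere bound says
    nothing on a null measure; hence \<open>\<bar>B\<bar>\<close>.\<close>
  have "((\<lambda>e. ennreal \<bar>B\<bar> * (\<integral>\<^sup>+x. ennreal \<bar>f e x - g x\<bar> \<partial>M)) \<longlongrightarrow> ennreal \<bar>B\<bar> * 0) F"
    using lim by (intro ennreal_tendsto_cmult) auto
  then have lim2: "((\<lambda>e. ennreal \<bar>B\<bar> * (\<integral>\<^sup>+x. ennreal \<bar>f e x - g x\<bar> \<partial>M)) \<longlongrightarrow> 0) F" by simp
  show "((\<lambda>e. \<integral>\<^sup>+x. ennreal \<bar>u x * f e x - u x * g x\<bar> \<partial>M) \<longlongrightarrow> 0) F"
  proof (rule tendsto_sandwich[OF _ _ tendsto_const lim2])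
    show "\<forall>\<^sub>F e in F. (\<integral>\<^sup>+x. ennreal \<bar>u x * f e x - u x * g x\<bar> \<partial>M)
        \<le> ennreal \<bar>B\<bar> * (\<integral>\<^sup>+x. ennreal \<bar>f e x - g x\<bar> \<partial>M)"
      using fm
    proof eventually_elim
      case (elim e)
      then have [measurable]: "f e \<in> borel_measurable M" .
      have "(\<integral>\<^sup>+x. ennreal \<bar>u x * f e x - u x * g x\<bar> \<partial>M)
          \<le> (\<integral>\<^sup>+x. ennreal \<bar>B\<bar> * ennreal \<bar>f e x - g x\<bar> \<partial>M)"
      proof (rule nn_integral_mono_AE)
        show "AE x in M. ennreal \<bar>u x * f e x - u x * g x\<bar> \<le> ennreal \<bar>B\<bar> * ennreal \<bar>f e x - g x\<bar>"
          using B
        proof eventually_elim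
          case (elim x)
          then have "\<bar>u x\<bar> * \<bar>f e x - g x\<bar> \<le> \<bar>B\<bar> * \<bar>f e x - g x\<bar>"
            by (intro mult_right_mono) auto
          then show ?case
            by (simp add: ennreal_mult[symmetric] right_diff_distrib[symmetric] abs_mult)
        qed
      qed
      then show ?case by (simp add: nn_integral_cmult)
    qed
  qed auto
qed

lemma L1_tendsto_add:
  assumes "L1_tendsto M f g F" "L1_tendsto M f' g' F"
  shows "L1_tendsto M (\<lambda>e x. f e x + f' e x) (\<lambda>x. g x + g' x) F"
  unfolding L1_tendsto_def
proof (intro conjI)
  have [measurable]: "g \<in> borel_measurable M" "g' \<in> borel_measurable M"
    and fm: "\<forall>\<^sub>F e in F. f e \<in> borel_measurable M" "\<forall>\<^sub>F e in F. f' e \<in> borel_measurable M"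
    and lim: "((\<lambda>e. \<integral>\<^sup>+x. ennreal \<bar>f e x - g x\<bar> \<partial>M) \<longlongrightarrow> 0) F"
      "((\<lambda>e. \<integral>\<^sup>+x. ennreal \<bar>f' e x - g' x\<bar> \<partial>M) \<longlongrightarrow> 0) F"
    using assms by (auto simp: L1_tendsto_def)
  show "(\<lambda>x. g x + g' x) \<in> borel_measurable M" by simp
  show "\<forall>\<^sub>F e in F. (\<lambda>x. f e x + f' e x) \<in> borel_measurable M"
    using fm by eventually_elim simp
  have lim2: "((\<lambda>e. (\<integral>\<^sup>+x. ennreal \<bar>f e x - g x\<bar> \<partial>M) + (\<integral>\<^sup>+x. ennreal \<bar>f' e x - g' x\<bar> \<partial>M)) \<longlongrightarrow> 0) F"
    using tendsto_add[OF lim] by simp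
  show "((\<lambda>e. \<integral>\<^sup>+x. ennreal \<bar>f e x + f' e x - (g x + g' x)\<bar> \<partial>M) \<longlongrightarrow> 0) F"
  proof (rule tendsto_sandwich[OF _ _ tendsto_const lim2])
    show "\<forall>\<^sub>F e in F. (\<integral>\<^sup>+x. ennreal \<bar>f e x + f' e x - (g x + g' x)\<bar> \<partial>M)
        \<le> (\<integral>\<^sup>+x. ennreal \<bar>f e x - g x\<bar> \<partial>M) + (\<integral>\<^sup>+x. ennreal \<bar>f' e x - g' x\<bar> \<partial>M)"
      using fm
    proof eventually_elim
      case (elim e)
      then have [measurable]: "f e \<in> borel_measurable M" "f' e \<in> borel_measurable M" by auto
      have "(\<integral>\<^sup>+x. ennreal \<bar>f e x + f' e x - (g x + g' x)\<bar> \<partial>M)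
        \<le> (\<integral>\<^sup>+x. ennreal \<bar>f e x - g x\<bar> + ennreal \<bar>f' e x - g' x\<bar> \<partial>M)"
        by (intro nn_integral_mono) (auto simp: ennreal_plus[symmetric] simp del: ennreal_plus intro!: ennreal_leI)
      then show ?case by (simp add: nn_integral_add)
    qed
  qed auto
qed

lemma L1_tendsto_cong:
  assumes "L1_tendsto M f g F" and "\<forall>\<^sub>F e in F. f' e \<in> borel_measurable M \<and> (AE x in M. f e x = f' e x)"
  shows "L1_tendsto M f' g F"
  unfolding L1_tendsto_def
proof (intro conjI)
  show "((\<lambda>e. \<integral>\<^sup>+x. ennreal \<bar>f' e x - g x\<bar> \<partial>M) \<longlongrightarrow> 0) F"
  proof (rule Lim_transform_eventually)
    show "((\<lambda>e. \<integral>\<^sup>+x. ennreal \<bar>f e x - g x\<bar> \<partial>M) \<longlongrightarrow> 0) F"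
      using assms(1) by (simp add: L1_tendsto_def)
    show "\<forall>\<^sub>F e in F. (\<integral>\<^sup>+x. ennreal \<bar>f e x - g x\<bar> \<partial>M) = (\<integral>\<^sup>+x. ennreal \<bar>f' e x - g x\<bar> \<partial>M)"
      using assms(2) by eventually_elim (auto intro!: nn_integral_cong_AE)
  qed
qed (use assms in \<open>auto simp: L1_tendsto_def elim!: eventually_mono\<close>)

text \<open>Dominated convergence along integer levels. The truncation serves twice, for the limit
  attached to a whole history and for the squared score at one time, neither of which is
  bounded.\<close>

lemma integrable_excess_small:
  fixes f :: "'b \<Rightarrow> real"
  assumes f: "integrable M f" and r: "0 < r"
  obtains c where "0 \<le> c" "(\<integral>\<^sup>+x. ennreal (max 0 (f x - c)) \<partial>M) < ennreal r"
proof -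
  have [measurable]: "f \<in> borel_measurable M" using f by simp
  have "(\<lambda>n. \<integral>x. max 0 (f x - real n) \<partial>M) \<longlonglongrightarrow> (\<integral>x. 0 \<partial>M)"
  proof (rule integral_dominated_convergence[where w = "\<lambda>x. \<bar>f x\<bar>"])
    show "AE x in M. (\<lambda>n. max 0 (f x - real n)) \<longlonglongrightarrow> 0"
    proof (rule AE_I2)
      fix x
      have "\<forall>\<^sub>F n in sequentially. max 0 (f x - real n) = 0"
        using eventually_ge_at_top[of "nat \<lceil>f x\<rceil>"]
        by eventually_elim (auto simp: max_def ceiling_le_iff nat_le_iff)
      then show "(\<lambda>n. max 0 (f x - real n)) \<longlonglongrightarrow> 0" by (rule tendsto_eventually)
    qed
  qed (use f in auto)
  then have "\<forall>\<^sub>F n in sequentially. (\<integral>x. max 0 (f x - real n) \<partial>M) < r"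
    using r by (intro order_tendstoD(2)) auto
  then obtain n where n: "(\<integral>x. max 0 (f x - real n) \<partial>M) < r"
    by (meson eventually_happens sequentially_bot)
  have "integrable M (\<lambda>x. max 0 (f x - real n))"
    by (rule Bochner_Integration.integrable_bound[OF f]) auto
  then have "(\<integral>\<^sup>+x. ennreal (max 0 (f x - real n)) \<partial>M) = ennreal (\<integral>x. max 0 (f x - real n) \<partial>M)"
    by (intro nn_integral_eq_integral) auto
  also have "\<dots> < ennreal r" using n r by (auto intro!: ennreal_lessI)
  finally show ?thesis using that[of n] by simp
qed

text \<open>
  The likelihood ratio \<open>1 + e a\<^sub>e\<close> of a history is multiplied by the ratio \<open>w\<^sub>e\<close> of the next action,
  whose conditional mean given the history is one. The cross term \<open>a\<^sub>e (w\<^sub>e - 1)\<close> vanishes in mean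
  although \<open>a\<^sub>e\<close> is unbounded, because \<open>w\<^sub>e - 1\<close> has conditional mean modulus at most two.
\<close>

lemma L1_tendsto_ratio_step:
  assumes s [measurable]: "s \<in> M \<rightarrow>\<^sub>M S"
    and a: "L1_tendsto M (\<lambda>e z. a e (s z)) (\<lambda>z. A (s z)) (at_right (0::real))"
    and am: "\<forall>\<^sub>F e in at_right 0. a e \<in> borel_measurable S" and Am [measurable]: "A \<in> borel_measurable S"
    and Aint: "integrable M (\<lambda>z. A (s z))"
    and w: "L1_tendsto M (\<lambda>e z. (w e z - 1) / e) H (at_right 0)"
    and wp: "\<forall>\<^sub>F e in at_right 0. w e \<in> borel_measurable M \<and> (\<forall>z. 0 \<le> w e z) \<and>
      (\<forall>g\<in>borel_measurable S. (\<integral>\<^sup>+z. g (s z) * ennreal (w e z) \<partial>M) = (\<integral>\<^sup>+z. g (s z) \<partial>M))"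
    and Hint: "integrable M H"
  shows "L1_tendsto M (\<lambda>e z. ((1 + e * a e (s z)) * w e z - 1) / e) (\<lambda>z. A (s z) + H z) (at_right 0)"
proof -
  have [measurable]: "H \<in> borel_measurable M" using Hint by simp
  \<comment> \<open>\<open>\<bar>w e z - 1\<bar> \<le> w e z + 1\<close>, and \<open>w e\<close> has
    conditional mean one given \<open>s\<close>; so a weight \<open>g (s z)\<close>, however
    unbounded, is at most doubled in mean.\<close>
  have w1: "\<forall>\<^sub>F e in at_right 0. \<forall>g\<in>borel_measurable S.
      (\<integral>\<^sup>+z. g (s z) * ennreal \<bar>w e z - 1\<bar> \<partial>M) \<le> 2 * (\<integral>\<^sup>+z. g (s z) \<partial>M)"
    using wp
  proof eventually_elim
    case (elim e)
    show ?case
    proof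
      fix g :: "_ \<Rightarrow> ennreal" assume [measurable]: "g \<in> borel_measurable S"
      have [measurable]: "w e \<in> borel_measurable M" using elim by simp
      have "(\<integral>\<^sup>+z. g (s z) * ennreal \<bar>w e z - 1\<bar> \<partial>M) \<le>
         (\<integral>\<^sup>+z. g (s z) * ennreal (w e z) + g (s z) \<partial>M)"
      proof (rule nn_integral_mono)
        fix z
        have "ennreal \<bar>w e z - 1\<bar> \<le> ennreal (w e z + 1)"
          using elim by (intro ennreal_leI) (auto simp: abs_le_iff add_increasing)
        also have "\<dots> = ennreal (w e z) + 1" using elim by simp
        finally have "g (s z) * ennreal \<bar>w e z - 1\<bar> \<le> g (s z) * (ennreal (w e z) + 1)"
          by (rule mult_left_mono) simp
        then show "g (s z) * ennreal \<bar>w e z - 1\<bar> \<le> g (s z) * ennreal (w e z) + g (s z)"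
          by (simp add: distrib_left)
      qed
      also have "\<dots> = (\<integral>\<^sup>+z. g (s z) \<partial>M) + (\<integral>\<^sup>+z. g (s z) \<partial>M)"
        using elim by (subst nn_integral_add) auto
      finally show "(\<integral>\<^sup>+z. g (s z) * ennreal \<bar>w e z - 1\<bar> \<partial>M) \<le> 2 * (\<integral>\<^sup>+z. g (s z) \<partial>M)"
        by (simp add: mult_2)
    qed
  qed
  have epos: "\<forall>\<^sub>F e in at_right 0. (0::real) < e"
    by (simp add: eventually_at_right_less)
  \<comment> \<open>\<open>w e - 1\<close> is \<open>e\<close> times a quotient that stays bounded
    in mean.\<close>
  have wm1: "((\<lambda>e. \<integral>\<^sup>+z. ennreal \<bar>w e z - 1\<bar> \<partial>M) \<longlongrightarrow> 0) (at_right 0)"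
  proof -
    have "((\<lambda>e. ennreal e * ((\<integral>\<^sup>+z. ennreal \<bar>(w e z - 1) / e - H z\<bar> \<partial>M) + (\<integral>\<^sup>+z. ennreal \<bar>H z\<bar> \<partial>M)))
        \<longlongrightarrow> ennreal 0 * (0 + (\<integral>\<^sup>+z. ennreal \<bar>H z\<bar> \<partial>M))) (at_right 0)"
    proof (rule tendsto_mult_ennreal)
      show "(ennreal \<longlongrightarrow> ennreal 0) (at_right 0)"
        by (intro tendsto_ennrealI tendsto_ident_at)
      show "((\<lambda>e. (\<integral>\<^sup>+z. ennreal \<bar>(w e z - 1) / e - H z\<bar> \<partial>M) + (\<integral>\<^sup>+z. ennreal \<bar>H z\<bar> \<partial>M))
         \<longlongrightarrow> 0 + (\<integral>\<^sup>+z. ennreal \<bar>H z\<bar> \<partial>M)) (at_right 0)"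
        using w by (intro tendsto_add tendsto_const) (auto simp: L1_tendsto_def)
    qed (use Hint in \<open>auto simp: integrable_iff_bounded\<close>)
    then have lim: "((\<lambda>e. ennreal e * ((\<integral>\<^sup>+z. ennreal \<bar>(w e z - 1) / e - H z\<bar> \<partial>M)
        + (\<integral>\<^sup>+z. ennreal \<bar>H z\<bar> \<partial>M))) \<longlongrightarrow> 0) (at_right 0)" by simp
    show ?thesis
    proof (rule tendsto_sandwich[OF _ _ tendsto_const lim])
      show "\<forall>\<^sub>F e in at_right 0. (\<integral>\<^sup>+z. ennreal \<bar>w e z - 1\<bar> \<partial>M)
         \<le> ennreal e * ((\<integral>\<^sup>+z. ennreal \<bar>(w e z - 1) / e - H z\<bar> \<partial>M) + (\<integral>\<^sup>+z. ennreal \<bar>H z\<bar> \<partial>M))"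
        using wp epos
      proof eventually_elim
        case (elim e)
        then have [measurable]: "w e \<in> borel_measurable M" by simp
        have "(\<integral>\<^sup>+z. ennreal \<bar>w e z - 1\<bar> \<partial>M)
            \<le> (\<integral>\<^sup>+z. ennreal e * (ennreal \<bar>(w e z - 1) / e - H z\<bar> + ennreal \<bar>H z\<bar>) \<partial>M)"
        proof (rule nn_integral_mono)
          fix z
          have "\<bar>w e z - 1\<bar> = e * \<bar>(w e z - 1) / e\<bar>" using elim by simp
          also have "\<dots> \<le> e * (\<bar>(w e z - 1) / e - H z\<bar> + \<bar>H z\<bar>)"
            using elim by (intro mult_left_mono) auto
          finally have "ennreal \<bar>w e z - 1\<bar> \<le> ennreal (e * (\<bar>(w e z - 1) / e - H z\<bar> + \<bar>H z\<bar>))"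
            by (rule ennreal_leI)
          then show "ennreal \<bar>w e z - 1\<bar> \<le> ennreal e * (ennreal \<bar>(w e z - 1) / e - H z\<bar> + ennreal \<bar>H z\<bar>)"
            using elim by (simp add: ennreal_mult ennreal_plus[symmetric] del: ennreal_plus)
        qed
        then show ?case by (simp add: nn_integral_cmult nn_integral_add)
      qed
    qed auto
  qed
  have aA: "((\<lambda>e. \<integral>\<^sup>+z. ennreal \<bar>a e (s z) - A (s z)\<bar> \<partial>M) \<longlongrightarrow> 0) (at_right 0)"
    using a by (simp add: L1_tendsto_def)
  have cross: "((\<lambda>e. \<integral>\<^sup>+z. ennreal \<bar>a e (s z) * (w e z - 1) - 0\<bar> \<partial>M) \<longlongrightarrow> 0) (at_right 0)"
  proof (rule order_tendstoI)
    fix r :: ennreal assume r: "0 < r"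
    \<comment> \<open>Order convergence in \<open>ennreal\<close> includes
      \<open>r = \<infinity>\<close>, so a finite level below \<open>r\<close> is chosen.
      \<open>w1\<close> doubles each of the two eighths used below; with the quarter, three quarters
      of \<open>r'\<close> are spent.\<close>
    obtain r' where r': "0 < r'" "ennreal r' \<le> r"
    proof (cases r)
      case (real q) then show ?thesis using that[of q] r by simp
    next
      case top then show ?thesis using that[of 1] by simp
    qed
    have "integrable M (\<lambda>z. \<bar>A (s z)\<bar>)" using Aint by simp
    from integrable_excess_small[OF this, of "r' / 8"] r'
    obtain c where c: "0 \<le> c" "(\<integral>\<^sup>+z. ennreal (max 0 (\<bar>A (s z)\<bar> - c)) \<partial>M) < ennreal (r' / 8)"
      by auto
    have "((\<lambda>e. ennreal c * (\<integral>\<^sup>+z. ennreal \<bar>w e z - 1\<bar> \<partial>M)) \<longlongrightarrow> ennreal c * 0) (at_right 0)"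
      using wm1 by (intro ennreal_tendsto_cmult) auto
    then have e1: "\<forall>\<^sub>F e in at_right 0. ennreal c * (\<integral>\<^sup>+z. ennreal \<bar>w e z - 1\<bar> \<partial>M) < ennreal (r' / 4)"
      using r' by (intro order_tendstoD(2)) auto
    have e2: "\<forall>\<^sub>F e in at_right 0. (\<integral>\<^sup>+z. ennreal \<bar>a e (s z) - A (s z)\<bar> \<partial>M) < ennreal (r' / 8)"
      using aA r' by (intro order_tendstoD(2)) auto
    show "\<forall>\<^sub>F e in at_right 0. (\<integral>\<^sup>+z. ennreal \<bar>a e (s z) * (w e z - 1) - 0\<bar> \<partial>M) < r"
      using w1 wp am e1 e2
    proof eventually_elim
      case (elim e)
      have [measurable]: "w e \<in> borel_measurable M" "a e \<in> borel_measurable S" using elim by auto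
      have "(\<integral>\<^sup>+z. ennreal \<bar>a e (s z) * (w e z - 1) - 0\<bar> \<partial>M) \<le>
        (\<integral>\<^sup>+z. ennreal \<bar>a e (s z) - A (s z)\<bar> * ennreal \<bar>w e z - 1\<bar> +
            (ennreal c * ennreal \<bar>w e z - 1\<bar> + ennreal (max 0 (\<bar>A (s z)\<bar> - c)) * ennreal \<bar>w e z - 1\<bar>) \<partial>M)"
      proof (rule nn_integral_mono)
        fix z
        \<comment> \<open>The unbounded factor splits into its distance to the limit, a constant
          \<open>c\<close>, and the excess of the limit over \<open>c\<close>. The first and third
          are functions of \<open>s z\<close>, as \<open>w1\<close> requires; the second multiplies
          an integral that vanishes.\<close>
        have "\<bar>a e (s z)\<bar> \<le> \<bar>a e (s z) - A (s z)\<bar> + (c + max 0 (\<bar>A (s z)\<bar> - c))" by auto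
        then have "\<bar>a e (s z)\<bar> * \<bar>w e z - 1\<bar> \<le>
            (\<bar>a e (s z) - A (s z)\<bar> + (c + max 0 (\<bar>A (s z)\<bar> - c))) * \<bar>w e z - 1\<bar>"
          by (rule mult_right_mono) simp
        then have "ennreal \<bar>a e (s z) * (w e z - 1) - 0\<bar> \<le>
            ennreal (\<bar>a e (s z) - A (s z)\<bar> * \<bar>w e z - 1\<bar> +
              (c * \<bar>w e z - 1\<bar> + max 0 (\<bar>A (s z)\<bar> - c) * \<bar>w e z - 1\<bar>))"
          by (intro ennreal_leI) (simp only: abs_mult diff_0_right distrib_right)
        then show "ennreal \<bar>a e (s z) * (w e z - 1) - 0\<bar> \<le> ennreal \<bar>a e (s z) - A (s z)\<bar> * ennreal \<bar>w e z - 1\<bar> +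
            (ennreal c * ennreal \<bar>w e z - 1\<bar> + ennreal (max 0 (\<bar>A (s z)\<bar> - c)) * ennreal \<bar>w e z - 1\<bar>)"
          using c by (simp add: ennreal_mult)
      qed
      also have "\<dots> = (\<integral>\<^sup>+z. ennreal \<bar>a e (s z) - A (s z)\<bar> * ennreal \<bar>w e z - 1\<bar> \<partial>M) +
          (ennreal c * (\<integral>\<^sup>+z. ennreal \<bar>w e z - 1\<bar> \<partial>M) +
           (\<integral>\<^sup>+z. ennreal (max 0 (\<bar>A (s z)\<bar> - c)) * ennreal \<bar>w e z - 1\<bar> \<partial>M))"
        by (simp add: nn_integral_add nn_integral_cmult)
      also have "\<dots> \<le> 2 * (\<integral>\<^sup>+z. ennreal \<bar>a e (s z) - A (s z)\<bar> \<partial>M) +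
          (ennreal c * (\<integral>\<^sup>+z. ennreal \<bar>w e z - 1\<bar> \<partial>M) +
           2 * (\<integral>\<^sup>+z. ennreal (max 0 (\<bar>A (s z)\<bar> - c)) \<partial>M))"
        using elim(1)[rule_format, of "\<lambda>x. ennreal \<bar>a e x - A x\<bar>"]
          elim(1)[rule_format, of "\<lambda>x. ennreal (max 0 (\<bar>A x\<bar> - c))"]
        by (intro add_mono order_refl) auto
      also have "\<dots> \<le> 2 * ennreal (r' / 8) + (ennreal (r' / 4) + 2 * ennreal (r' / 8))"
        using elim c by (intro add_mono mult_left_mono) auto
      also have "\<dots> = ennreal (2 * (r' / 8) + (r' / 4 + 2 * (r' / 8)))"
        using r' by (simp only: ennreal_mult ennreal_plus ennreal_numeral)
      also have "\<dots> = ennreal (3 / 4 * r')" by simp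
      also have "\<dots> < ennreal r'" using r' by (intro ennreal_lessI) auto
      also have "\<dots> \<le> r" by (rule r')
      finally show ?case .
    qed
  qed auto
  have "L1_tendsto M (\<lambda>e z. a e (s z) * (w e z - 1)) (\<lambda>z. 0) (at_right 0)"
    unfolding L1_tendsto_def
  proof (intro conjI cross)
    show "\<forall>\<^sub>F e in at_right 0. (\<lambda>z. a e (s z) * (w e z - 1)) \<in> borel_measurable M"
      using am wp
    proof eventually_elim
      case (elim e)
      then have [measurable]: "a e \<in> borel_measurable S" "w e \<in> borel_measurable M" by auto
      show ?case by measurable
    qed
  qed simp
  \<comment> \<open>Product rule: \<open>((1 + e * a) * w - 1) / e\<close> equals
    \<open>a + (w - 1) / e + a * (w - 1)\<close>, and the last term has just been shown to vanish in
    mean.\<close>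
  from L1_tendsto_add[OF L1_tendsto_add[OF a w] this]
  have "L1_tendsto M (\<lambda>e z. a e (s z) + (w e z - 1) / e + a e (s z) * (w e z - 1))
      (\<lambda>z. A (s z) + H z) (at_right 0)" by simp
  then show ?thesis
  proof (rule L1_tendsto_cong)
    show "\<forall>\<^sub>F e in at_right 0. (\<lambda>z. ((1 + e * a e (s z)) * w e z - 1) / e) \<in> borel_measurable M \<and>
       (AE z in M. a e (s z) + (w e z - 1) / e + a e (s z) * (w e z - 1) =
          ((1 + e * a e (s z)) * w e z - 1) / e)"
      using am wp epos
    proof eventually_elim
      case (elim e)
      then have [measurable]: "a e \<in> borel_measurable S" "w e \<in> borel_measurable M" by auto
      have "e \<noteq> 0" using elim by simp
      then have "a e (s z) + (w e z - 1) / e + a e (s z) * (w e z - 1) =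
          ((1 + e * a e (s z)) * w e z - 1) / e" for z
        by (simp add: field_simps)
      then show ?case by simp
    qed
  qed
qed

text \<open>Weighting by \<open>w e\<close> leaves the law of \<open>s\<close> unchanged, so
  \<open>u (s z) * ((w e z - 1) / e)\<close> has mean zero for every small \<open>e\<close>, and
  limits in mean preserve this.\<close>

lemma score_mean_zero:
  fixes u :: "'s \<Rightarrow> real"
  assumes M: "prob_space M" and s [measurable]: "s \<in> M \<rightarrow>\<^sub>M S"
    and w: "L1_tendsto M (\<lambda>e z. (w e z - 1) / e) H (at_right (0::real))"
    and wp: "\<forall>\<^sub>F e in at_right 0. w e \<in> borel_measurable M \<and> (\<forall>z. 0 \<le> w e z) \<and>
      (\<forall>g\<in>borel_measurable S. (\<integral>\<^sup>+z. g (s z) * ennreal (w e z) \<partial>M) = (\<integral>\<^sup>+z. g (s z) \<partial>M))"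
    and u [measurable]: "u \<in> borel_measurable S" and B: "AE z in M. \<bar>u (s z)\<bar> \<le> B"
  shows "integrable M (\<lambda>z. u (s z) * H z)" and "(\<integral>z. u (s z) * H z \<partial>M) = 0"
proof -
  interpret prob_space M by fact
  have uint: "integrable M (\<lambda>z. u (s z))"
    by (rule integrable_const_bound[where B = B]) (use B in auto)
  have q: "\<forall>\<^sub>F e in at_right 0. integrable M (\<lambda>z. u (s z) * ((w e z - 1) / e)) \<and>
      (\<integral>z. u (s z) * ((w e z - 1) / e) \<partial>M) = 0"
    using wp
  proof eventually_elim
    case (elim e)
    have [measurable]: "w e \<in> borel_measurable M" and nn: "\<And>z. 0 \<le> w e z" using elim by auto
    \<comment> \<open>Equality of image measures carries the hypothesis from nonnegative test
      functions to the signed function \<open>u\<close>.\<close>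
    have eq: "distr (density M (\<lambda>z. ennreal (w e z))) S s = distr M S s"
    proof (rule measure_eqI)
      fix X assume "X \<in> sets (distr (density M (\<lambda>z. ennreal (w e z))) S s)"
      then have X [measurable]: "X \<in> sets S" by simp
      have "emeasure (distr (density M (\<lambda>z. ennreal (w e z))) S s) X =
          (\<integral>\<^sup>+z. indicator X (s z) * ennreal (w e z) \<partial>M)"
        by (subst emeasure_distr, simp, simp, subst emeasure_density)
          (auto intro!: nn_integral_cong simp: indicator_def)
      also have "\<dots> = (\<integral>\<^sup>+z. indicator X (s z) \<partial>M)" using elim by simp
      also have "\<dots> = (\<integral>\<^sup>+x. indicator X x \<partial>distr M S s)" by (subst nn_integral_distr) auto
      finally show "emeasure (distr (density M (\<lambda>z. ennreal (w e z))) S s) X = emeasure (distr M S s) X"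
        by simp
    qed simp
    have 1: "integrable (density M (\<lambda>z. ennreal (w e z))) (\<lambda>z. u (s z))"
      using uint integrable_distr_eq[of s "density M (\<lambda>z. ennreal (w e z))" S u]
        integrable_distr_eq[of s M S u] eq by simp
    have 2: "(\<integral>z. u (s z) \<partial>density M (\<lambda>z. ennreal (w e z))) = (\<integral>z. u (s z) \<partial>M)"
      using integral_distr[of s "density M (\<lambda>z. ennreal (w e z))" S u]
        integral_distr[of s M S u] eq by simp
    have i: "integrable M (\<lambda>z. w e z * u (s z))"
      using 1 nn by (subst (asm) integrable_density) auto
    have j: "(\<integral>z. w e z * u (s z) \<partial>M) = (\<integral>z. u (s z) \<partial>M)"
      using 2 nn by (subst (asm) integral_density) auto
    have eq: "u (s z) * ((w e z - 1) / e) = (w e z * u (s z) - u (s z)) / e" for z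
      by (simp add: algebra_simps diff_divide_distrib)
    show ?case unfolding eq using i j uint by simp
  qed
  have L: "L1_tendsto M (\<lambda>e z. u (s z) * ((w e z - 1) / e)) (\<lambda>z. u (s z) * H z) (at_right 0)"
    by (rule L1_tendsto_mult_bounded[OF w _ B]) simp
  have q1: "\<forall>\<^sub>F e in at_right 0. integrable M (\<lambda>z. u (s z) * ((w e z - 1) / e))"
    using q by eventually_elim simp
  show "integrable M (\<lambda>z. u (s z) * H z)"
    by (rule L1_tendsto_integrable[OF L _ q1]) simp
  have "((\<lambda>e. \<integral>z. u (s z) * ((w e z - 1) / e) \<partial>M) \<longlongrightarrow> 0) (at_right 0)"
    by (rule tendsto_eventually) (use q in eventually_elim, simp)
  from tendsto_unique[OF _ L1_tendsto_integral[OF L q1] this]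
  show "(\<integral>z. u (s z) * H z \<partial>M) = 0" by simp
qed

text \<open>At fixed \<open>e\<close> the kernel average of \<open>q\<close> and the mean of
  \<open>q\<close> weighted by \<open>w e\<close> coincide, so backward and forward quotients have
  the same integral. Both converge in mean, the forward one because its factor \<open>q\<close> is
  bounded.\<close>

lemma backward_forward_adjoint:
  fixes q :: "'s \<times> 'a \<Rightarrow> real"
  assumes M: "prob_space M" and sM: "sets M = sets (S \<Otimes>\<^sub>M A)"
    and w: "L1_tendsto M (\<lambda>e p. (w e p - 1) / e) H (at_right (0::real))"
    and ker: "\<forall>\<^sub>F e in at_right 0. w e \<in> borel_measurable M \<and> (\<forall>p. 0 \<le> w e p) \<and>
      Ke e \<in> S \<Otimes>\<^sub>M A \<rightarrow>\<^sub>M prob_algebra A \<and>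
      (\<forall>h\<in>borel_measurable (S \<Otimes>\<^sub>M A).
         (\<integral>\<^sup>+p. \<integral>\<^sup>+a. h (fst p, a) \<partial>Ke e p \<partial>M) = (\<integral>\<^sup>+p. h p * ennreal (w e p) \<partial>M))"
    and q [measurable]: "q \<in> borel_measurable (S \<Otimes>\<^sub>M A)" and B: "AE p in M. \<bar>q p\<bar> \<le> B"
    and Lm: "Lq \<in> borel_measurable (S \<Otimes>\<^sub>M A)"
    and Lq: "((\<lambda>e. \<integral>\<^sup>+p. ennreal \<bar>((\<integral>a. q (fst p, a) \<partial>Ke e p) - q p) / e - Lq p\<bar> \<partial>M) \<longlongrightarrow> 0) (at_right 0)"
  shows "integrable M Lq" and "(\<integral>p. Lq p \<partial>M) = (\<integral>p. H p * q p \<partial>M)"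
    and "integrable M H" and "integrable M (\<lambda>p. H p * q p)"
proof -
  interpret prob_space M by fact
  note [measurable_cong] = sM
  \<comment> \<open>Clamping makes the bound hold everywhere; with \<open>\<bar>B\<bar>\<close> the
    interval is nonempty whatever the sign of \<open>B\<close>.\<close>
  define qt where "qt = (\<lambda>p. max (- \<bar>B\<bar>) (min \<bar>B\<bar> (q p)))"
  have qt [measurable]: "qt \<in> borel_measurable (S \<Otimes>\<^sub>M A)" unfolding qt_def by measurable
  have qtB: "\<bar>qt p\<bar> \<le> \<bar>B\<bar>" for p by (auto simp: qt_def)
  have qqt: "AE p in M. q p = qt p" using B by eventually_elim (auto simp: qt_def)
  have wint: "\<forall>\<^sub>F e in at_right 0. integrable M (\<lambda>p. (w e p - 1) / e)"
    using ker
  proof eventually_elim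
    case (elim e)
    \<comment> \<open>The constant test function 1 shows that \<open>w e\<close> has mean one, the
      kernels being probability measures.\<close>
    have "(\<integral>\<^sup>+p. ennreal (w e p) \<partial>M) = (\<integral>\<^sup>+p. \<integral>\<^sup>+a. 1 \<partial>Ke e p \<partial>M)"
      using elim by (elim conjE ballE[where x = "\<lambda>_. 1"]) auto
    also have "\<dots> = (\<integral>\<^sup>+p. 1 \<partial>M)"
    proof (rule nn_integral_cong)
      fix p assume "p \<in> space M"
      then have "Ke e p \<in> space (prob_algebra A)"
        using elim sets_eq_imp_space_eq[OF sM] by (auto dest: measurable_space)
      then show "(\<integral>\<^sup>+a. 1 \<partial>Ke e p) = 1"
        by (simp add: space_prob_algebra prob_space.emeasure_space_1)
    qed
    finally have "(\<integral>\<^sup>+p. ennreal (w e p) \<partial>M) = 1" by (simp add: emeasure_space_1)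
    moreover have "norm (w e p) = w e p" for p
      unfolding real_norm_def by (rule abs_of_nonneg) (use elim in blast)
    ultimately have "(\<integral>\<^sup>+p. ennreal (norm (w e p)) \<partial>M) < \<infinity>" by (simp only:) simp
    then have "integrable M (w e)"
      using elim by (intro integrableI_bounded) blast+
    then show ?case by simp
  qed
  show Hint: "integrable M H" by (rule L1_tendsto_integrable[OF w _ wint]) simp
  define bq where "bq = (\<lambda>e p. ((\<integral>a. q (fst p, a) \<partial>Ke e p) - q p) / e)"
  have bq: "\<forall>\<^sub>F e in at_right 0. integrable M (bq e) \<and>
      (\<integral>p. bq e p \<partial>M) = (\<integral>p. qt p * ((w e p - 1) / e) \<partial>M)"
    using ker wint eventually_at_right_less[of 0]
  proof eventually_elim
    case (elim e)
    have K [measurable]: "Ke e \<in> S \<Otimes>\<^sub>M A \<rightarrow>\<^sub>M subprob_algebra A"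
      and wm [measurable]: "w e \<in> borel_measurable M" and w0: "\<And>p. 0 \<le> w e p" and e: "0 < e"
      using elim by (auto intro: measurable_prob_algebraD)
    have Kp: "prob_space (Ke e p)" "sets (Ke e p) = sets A" if "p \<in> space (S \<Otimes>\<^sub>M A)" for p
      using elim measurable_space[OF _ that, of "Ke e" "prob_algebra A"]
      by (auto simp: space_prob_algebra)
    \<comment> \<open>\<open>N p\<close> keeps the history of \<open>p\<close> and redraws its
      action by the kernel. It lives on the pair space, so that its mixture over \<open>M\<close>
      can be compared with a density of \<open>M\<close>.\<close>
    define N where "N = (\<lambda>p. distr (Ke e p) (S \<Otimes>\<^sub>M A) (\<lambda>a. (fst p, a)))"
    have N [measurable]: "N \<in> M \<rightarrow>\<^sub>M subprob_algebra (S \<Otimes>\<^sub>M A)"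
      unfolding N_def by (rule measurable_distr2) measurable
    have spM: "space M = space (S \<Otimes>\<^sub>M A)" by (rule sets_eq_imp_space_eq[OF sM])
    have nnN: "(\<integral>\<^sup>+x. h x \<partial>N p) = (\<integral>\<^sup>+a. h (fst p, a) \<partial>Ke e p)"
      if h: "h \<in> borel_measurable (S \<Otimes>\<^sub>M A)" and p: "p \<in> space M" for h p
    proof -
      have "(\<lambda>a. (fst p, a)) \<in> A \<rightarrow>\<^sub>M S \<Otimes>\<^sub>M A"
        using p unfolding spM by (intro measurable_Pair1') (auto simp: space_pair_measure)
      then show ?thesis
        using p h Kp[of p] unfolding N_def spM by (subst nn_integral_distr) (auto cong: measurable_cong_sets)
    qed
    have bind: "M \<bind> N = density M (\<lambda>p. ennreal (w e p))"
    proof (rule measure_eqI)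
      have ne: "space M \<noteq> {}" by (rule not_empty)
      show sb: "sets (M \<bind> N) = sets (density M (\<lambda>p. ennreal (w e p)))"
        using ne by (subst sets_bind[where N = "S \<Otimes>\<^sub>M A"]) (auto simp: N_def sM)
      fix X assume "X \<in> sets (M \<bind> N)"
      then have X [measurable]: "X \<in> sets (S \<Otimes>\<^sub>M A)" using sb sM by simp
      have "emeasure (M \<bind> N) X = (\<integral>\<^sup>+x. indicator X x \<partial>(M \<bind> N))"
        using X sb sM by simp
      also have "\<dots> = (\<integral>\<^sup>+p. \<integral>\<^sup>+x. indicator X x \<partial>N p \<partial>M)"
        by (rule nn_integral_bind[OF _ N]) simp
      also have "\<dots> = (\<integral>\<^sup>+p. \<integral>\<^sup>+a. indicator X (fst p, a) \<partial>Ke e p \<partial>M)"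
        by (intro nn_integral_cong nnN) auto
      also have "\<dots> = (\<integral>\<^sup>+p. indicator X p * ennreal (w e p) \<partial>M)"
        using elim by (elim conjE ballE[where x = "indicator X"]) auto
      also have "\<dots> = emeasure (density M (\<lambda>p. ennreal (w e p))) X"
        using X sM by (subst emeasure_density) (auto simp: mult.commute)
      finally show "emeasure (M \<bind> N) X = emeasure (density M (\<lambda>p. ennreal (w e p))) X" .
    qed
    have qN: "(\<integral>a. q (fst p, a) \<partial>Ke e p) = (\<integral>x. q x \<partial>N p)" if p: "p \<in> space M" for p
    proof -
      have m [measurable]: "(\<lambda>a. (fst p, a)) \<in> Ke e p \<rightarrow>\<^sub>M S \<Otimes>\<^sub>M A"
        using p Kp(2)[of p] unfolding spM
        by (subst measurable_cong_sets[OF _ refl]) (auto intro!: measurable_Pair1' simp: space_pair_measure)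
      show ?thesis unfolding N_def by (simp add: integral_distr)
    qed
    \<comment> \<open>The mixture is absolutely continuous with respect to \<open>M\<close>, so null
      sets of \<open>M\<close> stay null after the action is moved. This is what permits exchanging
      \<open>q\<close> and \<open>qt\<close> under the kernels.\<close>
    have "AE x in density M (\<lambda>p. ennreal (w e p)). q x = qt x"
      using qqt by (subst AE_density) (auto elim: eventually_mono)
    then have "AE p in M. AE x in N p. q x = qt x"
      unfolding bind[symmetric] by (subst (asm) AE_bind[OF N]) auto
    then have ae: "AE p in M. (\<integral>a. q (fst p, a) \<partial>Ke e p) = (\<integral>x. qt x \<partial>N p)"
    proof (rule AE_mp, intro AE_I2 impI)
      fix p assume p: "p \<in> space M" and ap: "AE x in N p. q x = qt x"
      have "(\<integral>x. qt x \<partial>N p) = (\<integral>x. q x \<partial>N p)"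
        using ap by (intro integral_cong_AE) (auto simp: N_def)
      then show "(\<integral>a. q (fst p, a) \<partial>Ke e p) = (\<integral>x. qt x \<partial>N p)"
        using qN[OF p] by simp
    qed
    have N1: "AE p in M. emeasure (N p) (space (N p)) \<le> ennreal 1"
      using measurable_space[OF N]
      by (auto intro!: AE_I2 subprob_space.emeasure_space_le_1 simp: space_subprob_algebra)
    have ib: "integrable (density M (\<lambda>p. ennreal (w e p))) qt"
      and eb: "(\<integral>x. qt x \<partial>density M (\<lambda>p. ennreal (w e p))) = (\<integral>p. (\<integral>x. qt x \<partial>N p) \<partial>M)"
      unfolding bind[symmetric]
      using integrable_bind[OF qt _ N finite_measure_axioms N1, of "\<bar>B\<bar>"]
        integral_bind[OF qt _ N finite_measure_axioms N1, of "\<bar>B\<bar>"] qtB by auto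
    have i: "integrable M (\<lambda>p. w e p * qt p)"
      using ib w0 by (subst (asm) integrable_density) auto
    have j: "(\<integral>p. w e p * qt p \<partial>M) = (\<integral>p. (\<integral>x. qt x \<partial>N p) \<partial>M)"
      using eb w0 by (subst (asm) integral_density) auto
    have iq: "integrable M qt" by (rule integrable_const_bound[where B = "\<bar>B\<bar>"]) (auto simp: qtB)
    have mk [measurable]: "(\<lambda>p. \<integral>x. qt x \<partial>N p) \<in> borel_measurable M"
      using measurable_compose[OF N integral_measurable_subprob_algebra[OF qt]] .
    have nb: "\<bar>\<integral>x. qt x \<partial>N p\<bar> \<le> \<bar>B\<bar>" if p: "p \<in> space M" for p
    proof -
      interpret Np: subprob_space "N p" using measurable_space[OF N p] by (simp add: space_subprob_algebra)
      have "\<bar>\<integral>x. qt x \<partial>N p\<bar> \<le> (\<integral>x. \<bar>B\<bar> \<partial>N p)"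
        by (intro order_trans[OF integral_abs_bound] integral_mono integrable_abs Np.integrable_const_bound[where B = "\<bar>B\<bar>"])
          (auto simp: qtB N_def)
      also have "\<dots> \<le> \<bar>B\<bar>" using Np.subprob_measure_le_1[of "space (N p)"]
        by (simp add: mult_left_le_one_le)
      finally show ?thesis .
    qed
    have ik: "integrable M (\<lambda>p. \<integral>x. qt x \<partial>N p)"
      by (rule integrable_const_bound[where B = "\<bar>B\<bar>"]) (use nb in \<open>auto intro!: AE_I2\<close>)
    have qm: "(\<lambda>p. \<integral>a. q (fst p, a) \<partial>Ke e p) \<in> borel_measurable M"
      using measurable_compose[OF N integral_measurable_subprob_algebra[OF q]]
      by (subst measurable_cong[OF qN]) auto
    have bq_m: "bq e \<in> borel_measurable M" unfolding bq_def using qm by measurable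
    have ae2: "AE p in M. bq e p = ((\<integral>x. qt x \<partial>N p) - qt p) / e"
      using ae qqt by eventually_elim (simp add: bq_def)
    have "integrable M (bq e)"
      by (rule integrable_cong_AE_imp[where g = "\<lambda>p. ((\<integral>x. qt x \<partial>N p) - qt p) / e"])
        (use ik iq bq_m ae2 in \<open>auto elim!: eventually_mono\<close>)
    moreover have "(\<integral>p. bq e p \<partial>M) = (\<integral>p. ((\<integral>x. qt x \<partial>N p) - qt p) / e \<partial>M)"
      by (rule integral_cong_AE[OF bq_m _ ae2]) simp
    moreover have "\<dots> = ((\<integral>p. w e p * qt p \<partial>M) - (\<integral>p. qt p \<partial>M)) / e"
      using ik iq j by simp
    moreover have "\<dots> = (\<integral>p. (w e p * qt p - qt p) / e \<partial>M)" using i iq by simp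
    moreover have "(w e p * qt p - qt p) / e = qt p * ((w e p - 1) / e)" for p
      by (simp add: algebra_simps diff_divide_distrib)
    ultimately show ?case by simp
  qed
  have bq_int: "\<forall>\<^sub>F e in at_right 0. integrable M (bq e)" using bq by eventually_elim simp
  have L1: "L1_tendsto M bq Lq (at_right 0)"
    unfolding L1_tendsto_def
  proof (intro conjI)
    show "\<forall>\<^sub>F e in at_right 0. bq e \<in> borel_measurable M"
      using bq_int by eventually_elim (rule borel_measurable_integrable)
    show "((\<lambda>e. \<integral>\<^sup>+ x. ennreal \<bar>bq e x - Lq x\<bar> \<partial>M) \<longlongrightarrow> 0) (at_right 0)"
      using Lq by (simp add: bq_def)
  qed (use Lm in simp)
  show "integrable M Lq" by (rule L1_tendsto_integrable[OF L1 _ bq_int]) simp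
  have L2: "L1_tendsto M (\<lambda>e p. qt p * ((w e p - 1) / e)) (\<lambda>p. qt p * H p) (at_right 0)"
    by (rule L1_tendsto_mult_bounded[OF w, where B = "\<bar>B\<bar>"]) (auto simp: qtB)
  have L2i: "\<forall>\<^sub>F e in at_right 0. integrable M (\<lambda>p. qt p * ((w e p - 1) / e))"
    using wint
  proof eventually_elim
    case (elim e)
    have "integrable M (\<lambda>p. \<bar>B\<bar> * ((w e p - 1) / e))" using elim by (intro integrable_mult_right)
    then show ?case
    proof (rule Bochner_Integration.integrable_bound)
      show "(\<lambda>p. qt p * ((w e p - 1) / e)) \<in> borel_measurable M"
        using borel_measurable_integrable[OF elim] by measurable
    qed (auto simp: abs_mult qtB intro!: AE_I2 mult_right_mono divide_right_mono)
  qed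
  have "((\<lambda>e. \<integral>p. bq e p \<partial>M) \<longlongrightarrow> (\<integral>p. qt p * H p \<partial>M)) (at_right 0)"
    using L1_tendsto_integral[OF L2 L2i]
    by (rule Lim_transform_eventually) (use bq in eventually_elim, simp)
  from tendsto_unique[OF _ L1_tendsto_integral[OF L1 bq_int] this]
  have "(\<integral>p. Lq p \<partial>M) = (\<integral>p. qt p * H p \<partial>M)" by simp
  moreover have "AE p in M. qt p * H p = H p * q p" using qqt by eventually_elim simp
  moreover have "H \<in> borel_measurable M" using Hint by simp
  ultimately show "(\<integral>p. Lq p \<partial>M) = (\<integral>p. H p * q p \<partial>M)"
    by (subst integral_cong_AE[where g = "\<lambda>p. qt p * H p"]) (auto elim!: eventually_mono)
  have "integrable M (\<lambda>p. qt p * H p)" by (rule L1_tendsto_integrable[OF L2 _ L2i]) simp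
  then show "integrable M (\<lambda>p. H p * q p)"
    by (rule integrable_cong_AE_imp)
      (use qqt \<open>H \<in> borel_measurable M\<close> in \<open>auto elim!: eventually_mono\<close>)
qed

section \<open>Likelihood ratios of counterfactual laws\<close>

lemma hist_at_hist_at: "t \<le> n \<Longrightarrow> hist_at t (hist_at n z) = hist_at t z"
  by (auto simp: hist_at_def restrict_def fun_eq_iff)

lemma sa_at_hist_at: "1 \<le> t \<Longrightarrow> t < n \<Longrightarrow> sa_at t (hist_at n z) = sa_at t z"
  by (simp add: sa_at_def hist_at_hist_at act_at_def) (simp add: hist_at_def)

lemma hist_at_space: "z \<in> space (hist_space D n) \<Longrightarrow> hist_at n z = z"
  unfolding hist_space_def hist_at_def
  by (auto simp: space_pair_measure space_PiM intro!: prod_eqI PiE_restrict)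

text \<open>The covariate is written at \<open>Suc t\<close>, action and outcome at
  \<open>t\<close>; for \<open>t = 0\<close> the latter two would fall outside the index set
  \<open>{1..<Suc t}\<close>.\<close>

lemma hist_snoc_eq:
  assumes "1 \<le> t"
  shows "hist_snoc t (hist_at t z) (act_at t z) (cov_at (Suc t) z, out_at t z) = hist_at (Suc t) z"
  using assms unfolding hist_snoc_def hist_at_def act_at_def cov_at_def out_at_def
  by (auto simp: restrict_def fun_eq_iff)

lemma measurable_hist_at [measurable]:
  assumes "t \<le> n"
  shows "hist_at t \<in> hist_space D n \<rightarrow>\<^sub>M hist_space D t"
proof -
  have "(\<lambda>z. restrict (fst z) {1..t}) \<in> hist_space D n \<rightarrow>\<^sub>M (\<Pi>\<^sub>M s\<in>{1..t}. cov_space D s)"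
    unfolding hist_space_def using assms
    by (intro measurable_compose[OF measurable_fst] measurable_restrict_subset) auto
  moreover have "(\<lambda>z. restrict (fst (snd z)) {1..<t}) \<in> hist_space D n \<rightarrow>\<^sub>M (\<Pi>\<^sub>M s\<in>{1..<t}. act_space D s)"
    unfolding hist_space_def using assms
    by (intro measurable_compose[OF measurable_compose[OF measurable_snd measurable_fst]]
        measurable_restrict_subset) auto
  moreover have "(\<lambda>z. restrict (snd (snd z)) {1..<t}) \<in> hist_space D n \<rightarrow>\<^sub>M (\<Pi>\<^sub>M s\<in>{1..<t}. borel)"
    unfolding hist_space_def using assms
    by (intro measurable_compose[OF measurable_compose[OF measurable_snd measurable_snd]]
        measurable_restrict_subset) auto
  ultimately show ?thesis
    unfolding hist_at_def by (subst (2) hist_space_def) (intro measurable_Pair)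
qed

lemma measurable_act_at [measurable]:
  "1 \<le> t \<Longrightarrow> t < n \<Longrightarrow> act_at t \<in> hist_space D n \<rightarrow>\<^sub>M act_space D t"
  unfolding act_at_def hist_space_def
  by (intro measurable_compose[OF measurable_compose[OF measurable_snd measurable_fst]]
      measurable_component_singleton) auto

lemma measurable_out_at [measurable]:
  "1 \<le> t \<Longrightarrow> t < n \<Longrightarrow> out_at t \<in> hist_space D n \<rightarrow>\<^sub>M borel"
  unfolding out_at_def hist_space_def
  by (intro measurable_compose[OF measurable_compose[OF measurable_snd measurable_snd]]
      measurable_component_singleton[where M = "\<lambda>_. borel"]) auto

lemma measurable_cov_at [measurable]:
  "1 \<le> t \<Longrightarrow> t \<le> n \<Longrightarrow> cov_at t \<in> hist_space D n \<rightarrow>\<^sub>M cov_space D t"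
  unfolding cov_at_def hist_space_def
  by (intro measurable_compose[OF measurable_fst] measurable_component_singleton) auto

lemma measurable_sa_at [measurable]:
  "1 \<le> t \<Longrightarrow> t < n \<Longrightarrow> sa_at t \<in> hist_space D n \<rightarrow>\<^sub>M sa_space D t"
  unfolding sa_at_def by measurable

lemma measurable_hist_snoc:
  assumes "1 \<le> t"
  shows "(\<lambda>((s, a), xy). hist_snoc t s a xy) \<in>
    sa_space D t \<Otimes>\<^sub>M (cov_space D (Suc t) \<Otimes>\<^sub>M borel) \<rightarrow>\<^sub>M hist_space D (Suc t)"
proof -
  have i: "{1..Suc t} = {1..t} \<union> {Suc t}" "{1..<Suc t} = {1..<t} \<union> {t}" using assms by auto
  have [measurable]: "fst \<in> hist_space D t \<rightarrow>\<^sub>M (\<Pi>\<^sub>M s\<in>{1..t}. cov_space D s)"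
    "(\<lambda>z. fst (snd z)) \<in> hist_space D t \<rightarrow>\<^sub>M (\<Pi>\<^sub>M s\<in>{1..<t}. act_space D s)"
    "(\<lambda>z. snd (snd z)) \<in> hist_space D t \<rightarrow>\<^sub>M (\<Pi>\<^sub>M s\<in>{1..<t}. borel)"
    unfolding hist_space_def by measurable
  show ?thesis
    unfolding hist_snoc_def split_beta'
    by (subst (2) hist_space_def) (intro measurable_Pair measurable_fun_upd[OF i(1)] measurable_fun_upd[OF i(2)]; measurable)
qed

section \<open>Change of measure from the status quo to a dominated policy\<close>

locale observed_design =
  fixes D :: "('x, 'a) design" and P :: "('x, 'a) hist measure" and pol :: "('x, 'a) policy"
    and Tr :: "nat \<Rightarrow> ('x, 'a) hist \<times> 'a \<Rightarrow> ('x \<times> real) measure"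
  assumes design: "design D" and prob_P: "prob_space P" and sets_P: "sets P = sets (traj_space D)"
    and status_quo: "status_quo D P pol" and transition: "is_transition D P Tr"
begin

sublocale prob_space P by (rule prob_P)

abbreviation "T \<equiv> horizon D"
abbreviation "base_law t \<equiv> hist_law D P t \<Otimes>\<^sub>M act_space D t"

lemma sets_P_hist [measurable_cong]: "sets P = sets (hist_space D (Suc T))"
  using sets_P by (simp add: traj_space_def)

lemma space_P: "space P = space (hist_space D (Suc T))"
  by (rule sets_eq_imp_space_eq[OF sets_P_hist])

lemma hist_at_P [measurable]: "t \<le> Suc T \<Longrightarrow> hist_at t \<in> P \<rightarrow>\<^sub>M hist_space D t"
  by (subst measurable_cong_sets[OF sets_P_hist refl]) (rule measurable_hist_at)

lemma sa_at_P [measurable]: "t \<in> {1..T} \<Longrightarrow> sa_at t \<in> P \<rightarrow>\<^sub>M sa_space D t"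
  by (subst measurable_cong_sets[OF sets_P_hist refl]) (rule measurable_sa_at, auto)

lemma out_at_P [measurable]: "t \<in> {1..T} \<Longrightarrow> out_at t \<in> P \<rightarrow>\<^sub>M borel"
  by (subst measurable_cong_sets[OF sets_P_hist refl]) (rule measurable_out_at, auto)

lemma cov_at_P [measurable]: "t \<in> {1..Suc T} \<Longrightarrow> cov_at t \<in> P \<rightarrow>\<^sub>M cov_space D t"
  by (subst measurable_cong_sets[OF sets_P_hist refl]) (rule measurable_cov_at, auto)

lemma sets_hist_law [simp, measurable_cong]: "sets (hist_law D P t) = sets (hist_space D t)"
  by (simp add: hist_law_def)

lemma sets_sa_law [simp, measurable_cong]: "sets (sa_law D P t) = sets (sa_space D t)"
  by (simp add: sa_law_def)

lemma prob_sa_law: "t \<in> {1..T} \<Longrightarrow> prob_space (sa_law D P t)"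
  unfolding sa_law_def by (rule prob_space_distr) (rule sa_at_P)

lemma prob_hist_law: "t \<le> Suc T \<Longrightarrow> prob_space (hist_law D P t)"
  unfolding hist_law_def by (rule prob_space_distr) (rule hist_at_P)

lemma sigma_finite_act: "t \<in> {1..T} \<Longrightarrow> sigma_finite_measure (act_space D t)"
  using design unfolding design_def act_space_def
  by (intro sigma_finite_measure_restrict_space) auto

lemma pair_hist_act: "t \<in> {1..T} \<Longrightarrow> pair_sigma_finite (hist_law D P t) (act_space D t)"
  unfolding pair_sigma_finite_def
  using prob_hist_law[of t] sigma_finite_act[of t]
  by (auto intro: prob_space_imp_sigma_finite)

lemma pol_m [measurable]: "t \<in> {1..T} \<Longrightarrow> pol t \<in> borel_measurable (sa_space D t)"
  using status_quo by (auto simp: status_quo_def is_policy_def)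

lemma sa_law_density: "t \<in> {1..T} \<Longrightarrow>
    sa_law D P t = density (base_law t) (\<lambda>p. ennreal (pol t p))"
  using status_quo by (auto simp: status_quo_def)

lemma AE_hist_act:
  assumes t: "t \<in> {1..T}" and Q: "Measurable.pred (sa_space D t) Q"
    and "AE s in hist_law D P t. AE a in act_space D t. Q (s, a)"
  shows "AE p in base_law t. Q p"
proof -
  interpret pair_sigma_finite "hist_law D P t" "act_space D t" by (rule pair_hist_act[OF t])
  have "{p \<in> space (base_law t). Q p} \<in> sets (base_law t)"
    using Q by measurable
  from AE_pair_measure[OF this assms(3)] show ?thesis .
qed

lemma space_act: "space (act_space D t) \<subseteq> act_set D t"
  by (auto simp: act_space_def space_restrict_space)

lemma policy_nonneg:
  assumes "is_policy D P pe" and t: "t \<in> {1..T}"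
  shows "AE p in base_law t. 0 \<le> pe t p"
proof (rule AE_hist_act[OF t])
  have [measurable]: "pe t \<in> borel_measurable (sa_space D t)"
    using assms by (auto simp: is_policy_def)
  show "Measurable.pred (sa_space D t) (\<lambda>p. 0 \<le> pe t p)" by measurable
  show "AE s in hist_law D P t. AE a in act_space D t. 0 \<le> pe t (s, a)"
    using assms space_act[of t] unfolding is_policy_def
    by (auto elim!: ballE[where x = t] eventually_mono)
qed

text \<open>Condition (c) of a perturbation path for one policy at all times, bundled with being a
  policy: the density computations below rest on both.\<close>

definition dominated :: "('x, 'a) policy \<Rightarrow> bool" where
  "dominated pe \<longleftrightarrow> is_policy D P pe \<and> (\<forall>t\<in>{1..T}. AE s in hist_law D P t.
     AE a in act_space D t. pol t (s, a) = 0 \<longrightarrow> pe t (s, a) = 0)"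

text \<open>The maximum with zero makes the ratio nonnegative everywhere; almost surely it changes nothing.\<close>

definition ratio :: "('x, 'a) policy \<Rightarrow> nat \<Rightarrow> ('x, 'a) hist \<times> 'a \<Rightarrow> real" where
  "ratio pe t p = max 0 (pe t p / pol t p)"

lemma ratio_nonneg: "0 \<le> ratio pe t p" by (simp add: ratio_def)

lemma policy_m: "is_policy D P pe \<Longrightarrow> t \<in> {1..T} \<Longrightarrow> pe t \<in> borel_measurable (sa_space D t)"
  by (auto simp: is_policy_def)

lemma ratio_m [measurable]: "dominated pe \<Longrightarrow> t \<in> {1..T} \<Longrightarrow> ratio pe t \<in> borel_measurable (sa_space D t)"
  unfolding ratio_def[abs_def] dominated_def
  by (intro borel_measurable_max borel_measurable_divide) (auto simp: policy_m)

lemma status_quo_policy: "is_policy D P pol"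
  using status_quo by (simp add: status_quo_def)

text \<open>Where the status-quo density vanishes the quotient is 0 by convention, and domination
  makes the perturbed density vanish there too; so the product formula has no exceptional case
  beyond null sets.\<close>

lemma ratio_pol:
  assumes d: "dominated pe" and t: "t \<in> {1..T}"
  shows "AE p in base_law t.
    0 \<le> pol t p \<and> 0 \<le> pe t p \<and> (pol t p = 0 \<longrightarrow> pe t p = 0) \<and>
    ennreal (pol t p) * ennreal (ratio pe t p) = ennreal (pe t p)"
proof -
  have pe: "is_policy D P pe" using d by (simp add: dominated_def)
  note [measurable] = policy_m[OF pe t] pol_m[OF t]
  have "AE p in base_law t. pol t p = 0 \<longrightarrow> pe t p = 0"
    using d t by (intro AE_hist_act) (auto simp: dominated_def)
  with policy_nonneg[OF pe t] policy_nonneg[OF status_quo_policy t]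
  show ?thesis
    by eventually_elim (auto simp: ratio_def ennreal_mult[symmetric])
qed

text \<open>Change of measure for the action at time \<open>t\<close> alone: the history keeps its
  law under \<open>P\<close>.\<close>

lemma nn_integral_ratio:
  assumes d: "dominated pe" and t: "t \<in> {1..T}" and h: "h \<in> borel_measurable (sa_space D t)"
  shows "(\<integral>\<^sup>+p. h p * ennreal (ratio pe t p) \<partial>sa_law D P t) =
    (\<integral>\<^sup>+s. \<integral>\<^sup>+a. h (s, a) * ennreal (pe t (s, a)) \<partial>act_space D t \<partial>hist_law D P t)"
proof -
  have pe: "is_policy D P pe" using d by (simp add: dominated_def)
  note [measurable] = policy_m[OF pe t] pol_m[OF t] h ratio_m[OF d t]
  interpret pair_sigma_finite "hist_law D P t" "act_space D t" by (rule pair_hist_act[OF t])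
  have "(\<integral>\<^sup>+p. h p * ennreal (ratio pe t p) \<partial>sa_law D P t) =
      (\<integral>\<^sup>+p. ennreal (pol t p) * (h p * ennreal (ratio pe t p)) \<partial>base_law t)"
    unfolding sa_law_density[OF t] by (subst nn_integral_density) auto
  also have "\<dots> = (\<integral>\<^sup>+p. h p * ennreal (pe t p) \<partial>base_law t)"
    by (rule nn_integral_cong_AE, use ratio_pol[OF d t] in eventually_elim) (simp add: mult_ac)
  also have "\<dots> = (\<integral>\<^sup>+s. \<integral>\<^sup>+a. h (s, a) * ennreal (pe t (s, a)) \<partial>act_space D t \<partial>hist_law D P t)"
    by (subst M2.nn_integral_fst[symmetric]) auto
  finally show ?thesis .
qed

text \<open>The ratio has conditional mean one given the history, because a policy integrates to
  one. The form with test functions avoids conditional expectations of possibly infinite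
  integrands.\<close>

lemma ratio_marginal:
  assumes d: "dominated pe" and t: "t \<in> {1..T}" and g: "g \<in> borel_measurable (hist_space D t)"
  shows "(\<integral>\<^sup>+z. g (hist_at t z) * ennreal (ratio pe t (sa_at t z)) \<partial>P) = (\<integral>\<^sup>+z. g (hist_at t z) \<partial>P)"
proof -
  have pe: "is_policy D P pe" using d by (simp add: dominated_def)
  note [measurable] = policy_m[OF pe t] pol_m[OF t] g ratio_m[OF d t] sa_at_P[OF t]
  have "(\<integral>\<^sup>+z. g (hist_at t z) * ennreal (ratio pe t (sa_at t z)) \<partial>P) =
      (\<integral>\<^sup>+p. g (fst p) * ennreal (ratio pe t p) \<partial>sa_law D P t)"
    unfolding sa_law_def by (subst nn_integral_distr) (auto simp: sa_at_def)
  also have "\<dots> = (\<integral>\<^sup>+s. \<integral>\<^sup>+a. g s * ennreal (pe t (s, a)) \<partial>act_space D t \<partial>hist_law D P t)"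
    by (subst nn_integral_ratio[OF d t]) auto
  also have "\<dots> = (\<integral>\<^sup>+s. g s \<partial>hist_law D P t)"
  proof (rule nn_integral_cong_AE)
    have "AE s in hist_law D P t. (\<integral>\<^sup>+a. ennreal (pe t (s, a)) \<partial>act_space D t) = 1"
      using pe t by (auto simp: is_policy_def elim!: eventually_mono)
    then show "AE s in hist_law D P t. (\<integral>\<^sup>+a. g s * ennreal (pe t (s, a)) \<partial>act_space D t) = g s"
    proof (rule AE_mp, intro AE_I2 impI)
      fix s assume "s \<in> space (hist_law D P t)" "(\<integral>\<^sup>+a. ennreal (pe t (s, a)) \<partial>act_space D t) = 1"
      then show "(\<integral>\<^sup>+a. g s * ennreal (pe t (s, a)) \<partial>act_space D t) = g s"
        by (subst nn_integral_cmult) (auto simp: hist_law_def)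
    qed
  qed
  also have "\<dots> = (\<integral>\<^sup>+z. g (hist_at t z) \<partial>P)"
    unfolding hist_law_def using t by (subst nn_integral_distr) auto
  finally show ?thesis .
qed

lemma nn_integral_transition:
  assumes t: "t \<in> {1..T}"
    and f: "f \<in> borel_measurable (sa_space D t \<Otimes>\<^sub>M (cov_space D (Suc t) \<Otimes>\<^sub>M borel))"
  shows "(\<integral>\<^sup>+z. f (sa_at t z, (cov_at (Suc t) z, out_at t z)) \<partial>P) =
    (\<integral>\<^sup>+p. \<integral>\<^sup>+xy. f (p, xy) \<partial>Tr t p \<partial>sa_law D P t)"
proof -
  let ?N = "sa_space D t \<Otimes>\<^sub>M (cov_space D (Suc t) \<Otimes>\<^sub>M borel)"
  have t': "Suc t \<in> {1..Suc T}" using t by auto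
  note [measurable] = f sa_at_P[OF t] out_at_P[OF t] cov_at_P[OF t']
  have Tr: "Tr t \<in> sa_space D t \<rightarrow>\<^sub>M prob_algebra (cov_space D (Suc t) \<Otimes>\<^sub>M borel)"
    and eq: "distr P ?N (\<lambda>z. (sa_at t z, (cov_at (Suc t) z, out_at t z))) =
       sa_law D P t \<bind> (\<lambda>p. distr (Tr t p) ?N (\<lambda>xy. (p, xy)))"
    using transition t by (auto simp: is_transition_def)
  have Tr' [measurable]: "Tr t \<in> sa_space D t \<rightarrow>\<^sub>M subprob_algebra (cov_space D (Suc t) \<Otimes>\<^sub>M borel)"
    by (rule measurable_prob_algebraD[OF Tr])
  have "(\<integral>\<^sup>+z. f (sa_at t z, (cov_at (Suc t) z, out_at t z)) \<partial>P) =
      (\<integral>\<^sup>+x. f x \<partial>distr P ?N (\<lambda>z. (sa_at t z, (cov_at (Suc t) z, out_at t z))))"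
    by (subst nn_integral_distr) auto
  also have "\<dots> = (\<integral>\<^sup>+p. \<integral>\<^sup>+x. f x \<partial>distr (Tr t p) ?N (\<lambda>xy. (p, xy)) \<partial>sa_law D P t)"
    unfolding eq
  proof (rule nn_integral_bind[where B = ?N])
    have "(\<lambda>p. distr (Tr t p) ?N (\<lambda>xy. (p, xy))) \<in> sa_space D t \<rightarrow>\<^sub>M subprob_algebra ?N"
      by (rule measurable_distr2) measurable
    then show "(\<lambda>p. distr (Tr t p) ?N (\<lambda>xy. (p, xy))) \<in> sa_law D P t \<rightarrow>\<^sub>M subprob_algebra ?N" by simp
  qed simp
  also have "\<dots> = (\<integral>\<^sup>+p. \<integral>\<^sup>+xy. f (p, xy) \<partial>Tr t p \<partial>sa_law D P t)"
  proof (rule nn_integral_cong)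
    fix p assume "p \<in> space (sa_law D P t)"
    then have p: "p \<in> space (sa_space D t)" by (simp add: sa_law_def)
    have s: "sets (Tr t p) = sets (cov_space D (Suc t) \<Otimes>\<^sub>M borel)"
      using measurable_space[OF Tr p] by (simp add: space_prob_algebra)
    have "(\<lambda>xy. (p, xy)) \<in> Tr t p \<rightarrow>\<^sub>M ?N"
      using p by (subst measurable_cong_sets[OF s refl]) (rule measurable_Pair1')
    then show "(\<integral>\<^sup>+x. f x \<partial>distr (Tr t p) ?N (\<lambda>xy. (p, xy))) = (\<integral>\<^sup>+xy. f (p, xy) \<partial>Tr t p)"
      by (subst nn_integral_distr) auto
  qed
  finally show ?thesis .
qed

definition path_ratio :: "('x, 'a) policy \<Rightarrow> nat \<Rightarrow> ('x, 'a) hist \<Rightarrow> real" where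
  "path_ratio pe n z = (\<Prod>t = 1..n. ratio pe t (sa_at t z))"

lemma path_ratio_nonneg: "0 \<le> path_ratio pe n z"
  by (simp add: path_ratio_def ratio_nonneg prod_nonneg)

lemma path_ratio_hist_at: "path_ratio pe n (hist_at (Suc n) z) = path_ratio pe n z"
  unfolding path_ratio_def by (intro prod.cong refl arg_cong[where f = "ratio pe _"] sa_at_hist_at) auto

lemma path_ratio_m:
  assumes "dominated pe" "n \<le> T" "n < m"
  shows "path_ratio pe n \<in> borel_measurable (hist_space D m)"
  unfolding path_ratio_def[abs_def]
proof (rule borel_measurable_prod)
  fix t assume "t \<in> {1..n}"
  then show "(\<lambda>z. ratio pe t (sa_at t z)) \<in> borel_measurable (hist_space D m)"
    using assms by (intro measurable_compose[OF measurable_sa_at ratio_m]) auto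
qed

text \<open>The counterfactual law and \<open>P\<close> share the law of the first covariate and the
  transition kernels; they differ only in the action factors, whose quotient is the ratio. The
  induction trades one action density for a ratio and then reabsorbs the kernel into
  \<open>P\<close>.\<close>

lemma g_hist_density:
  assumes d: "dominated pe" and n: "n \<le> T"
  shows "g_hist D P Tr pe n = density (hist_law D P (Suc n)) (\<lambda>s. ennreal (path_ratio pe n s))"
  using n
proof (induction n)
  case 0
  have "density (hist_law D P 1) (\<lambda>s. 1) = hist_law D P 1" by (rule density_1)
  then show ?case by (simp add: path_ratio_def)
next
  case (Suc n)
  let ?t = "Suc n"
  have t: "?t \<in> {1..T}" using Suc by auto
  have t': "Suc ?t \<in> {1..Suc T}" using t by auto
  have pe: "is_policy D P pe" using d by (simp add: dominated_def)
  let ?Y = "cov_space D (Suc ?t) \<Otimes>\<^sub>M (borel :: real measure)"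
  define S2 where "S2 = hist_space D (Suc ?t)"
  have sn [measurable]: "(\<lambda>((s, a), xy). hist_snoc ?t s a xy) \<in> sa_space D ?t \<Otimes>\<^sub>M ?Y \<rightarrow>\<^sub>M S2"
    unfolding S2_def by (rule measurable_hist_snoc) simp
  have Tr: "Tr ?t \<in> sa_space D ?t \<rightarrow>\<^sub>M prob_algebra ?Y"
    using transition t by (auto simp: is_transition_def)
  have Tr' [measurable]: "Tr ?t \<in> sa_space D ?t \<rightarrow>\<^sub>M subprob_algebra ?Y"
    by (rule measurable_prob_algebraD[OF Tr])
  note [measurable] = policy_m[OF pe t] pol_m[OF t] ratio_m[OF d t] sa_at_P[OF t] out_at_P[OF t] cov_at_P[OF t']
  have W [measurable]: "path_ratio pe n \<in> borel_measurable (hist_space D ?t)"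
    using Suc by (intro path_ratio_m d) auto
  have W2 [measurable]: "path_ratio pe ?t \<in> borel_measurable S2"
    using Suc unfolding S2_def by (intro path_ratio_m d) auto
  interpret act: sigma_finite_measure "act_space D ?t" by (rule sigma_finite_act[OF t])
  define \<kappa> where "\<kappa> = (\<lambda>(s, a). distr (Tr ?t (s, a)) S2 (hist_snoc ?t s a))"
  have \<kappa>: "\<kappa> \<in> sa_space D ?t \<rightarrow>\<^sub>M subprob_algebra S2"
    unfolding \<kappa>_def split_beta'
  proof (rule measurable_distr2[where M = ?Y])
    show "(\<lambda>(x, y). hist_snoc ?t (fst x) (snd x) y) \<in> sa_space D ?t \<Otimes>\<^sub>M ?Y \<rightarrow>\<^sub>M S2"
      using sn by (simp add: split_beta')
  qed simp
  define \<nu> where "\<nu> = density (g_hist D P Tr pe n \<Otimes>\<^sub>M act_space D ?t) (\<lambda>p. ennreal (pe ?t p))"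
  have g: "g_hist D P Tr pe n = density (hist_law D P ?t) (\<lambda>s. ennreal (path_ratio pe n s))"
    using Suc by simp
  have s\<nu>: "sets \<nu> = sets (sa_space D ?t)" unfolding \<nu>_def g by (simp cong: sets_pair_measure_cong)
  have \<kappa>\<nu>: "\<kappa> \<in> \<nu> \<rightarrow>\<^sub>M subprob_algebra S2" using \<kappa> s\<nu> by (simp cong: measurable_cong_sets)
  have gs: "g_hist D P Tr pe ?t = \<nu> \<bind> \<kappa>" by (simp add: \<nu>_def \<kappa>_def S2_def)
  \<comment> \<open>\<open>bind\<close> over an empty space is a default measure; its sigma-algebra
    is the expected one only if \<open>space \<nu>\<close> is nonempty.\<close>
  have ne: "space \<nu> \<noteq> {}"
    using prob_space.not_empty[OF prob_sa_law[OF t]] sets_eq_imp_space_eq[OF s\<nu>]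
      sets_eq_imp_space_eq[OF sets_sa_law[of ?t]] by simp
  show ?case
  proof (rule measure_eqI)
    show sb: "sets (g_hist D P Tr pe ?t) = sets (density (hist_law D P (Suc ?t)) (\<lambda>s. ennreal (path_ratio pe ?t s)))"
      unfolding gs using ne sets_kernel[OF \<kappa>\<nu>] by (subst sets_bind) (auto simp: S2_def)
    fix X assume "X \<in> sets (g_hist D P Tr pe ?t)"
    then have X [measurable]: "X \<in> sets S2" using sb by (simp add: S2_def)
    \<comment> \<open>\<open>k (s, a)\<close> is the conditional probability, given history and
      action, that the extended history lands in \<open>X\<close>.\<close>
    define k where "k = (\<lambda>p. \<integral>\<^sup>+y. indicator X y \<partial>\<kappa> p)"
    have k [measurable]: "k \<in> borel_measurable (sa_space D ?t)"
      unfolding k_def by (rule measurable_compose[OF \<kappa> nn_integral_measurable_subprob_algebra]) simp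
    have k_eq: "k p = (\<integral>\<^sup>+xy. indicator X (hist_snoc ?t (fst p) (snd p) xy) \<partial>Tr ?t p)"
      if p: "p \<in> space (sa_space D ?t)" for p
    proof -
      have s: "sets (Tr ?t p) = sets ?Y"
        using measurable_space[OF Tr p] by (simp add: space_prob_algebra)
      have "(\<lambda>xy. (\<lambda>((s, a), xy). hist_snoc ?t s a xy) (p, xy)) \<in> ?Y \<rightarrow>\<^sub>M S2"
        using p by (intro measurable_compose[OF measurable_Pair1' sn])
      then have "hist_snoc ?t (fst p) (snd p) \<in> Tr ?t p \<rightarrow>\<^sub>M S2"
        by (subst measurable_cong_sets[OF s refl]) (simp add: split_beta')
      then show ?thesis unfolding k_def \<kappa>_def split_beta' by (subst nn_integral_distr) auto
    qed
    have "emeasure (g_hist D P Tr pe ?t) X = (\<integral>\<^sup>+y. indicator X y \<partial>(\<nu> \<bind> \<kappa>))"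
      using X sb unfolding gs[symmetric] by (simp add: S2_def)
    also have "\<dots> = (\<integral>\<^sup>+p. k p \<partial>\<nu>)"
      unfolding k_def by (rule nn_integral_bind[OF _ \<kappa>\<nu>]) simp
    also have "\<dots> = (\<integral>\<^sup>+p. ennreal (pe ?t p) * k p \<partial>(g_hist D P Tr pe n \<Otimes>\<^sub>M act_space D ?t))"
      unfolding \<nu>_def g by (subst nn_integral_density) auto
    also have "\<dots> = (\<integral>\<^sup>+s. \<integral>\<^sup>+a. ennreal (pe ?t (s, a)) * k (s, a) \<partial>act_space D ?t \<partial>g_hist D P Tr pe n)"
      unfolding g by (subst act.nn_integral_fst[symmetric]) auto
    also have "\<dots> = (\<integral>\<^sup>+s. ennreal (path_ratio pe n s) *
        (\<integral>\<^sup>+a. ennreal (pe ?t (s, a)) * k (s, a) \<partial>act_space D ?t) \<partial>hist_law D P ?t)"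
      unfolding g by (subst nn_integral_density) (auto intro!: act.borel_measurable_nn_integral)
    also have "\<dots> = (\<integral>\<^sup>+s. \<integral>\<^sup>+a. (ennreal (path_ratio pe n (fst (s, a))) * k (s, a)) * ennreal (pe ?t (s, a))
         \<partial>act_space D ?t \<partial>hist_law D P ?t)"
    proof (rule nn_integral_cong)
      fix s assume "s \<in> space (hist_law D P ?t)"
      then have [simp]: "s \<in> space (hist_space D ?t)" by (simp add: hist_law_def)
      show "ennreal (path_ratio pe n s) * (\<integral>\<^sup>+a. ennreal (pe ?t (s, a)) * k (s, a) \<partial>act_space D ?t) =
        (\<integral>\<^sup>+a. (ennreal (path_ratio pe n (fst (s, a))) * k (s, a)) * ennreal (pe ?t (s, a)) \<partial>act_space D ?t)"
        by (subst nn_integral_cmult[symmetric]) (auto simp: mult_ac)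
    qed
    \<comment> \<open>Here the action density of the new policy becomes a ratio under the status-quo
      law.\<close>
    also have "\<dots> = (\<integral>\<^sup>+p. (ennreal (path_ratio pe n (fst p)) * k p) * ennreal (ratio pe ?t p) \<partial>sa_law D P ?t)"
      by (rule nn_integral_ratio[OF d t, symmetric]) measurable
    also have "\<dots> = (\<integral>\<^sup>+p. \<integral>\<^sup>+xy. ennreal (path_ratio pe n (fst p)) * ennreal (ratio pe ?t p) *
        indicator X (hist_snoc ?t (fst p) (snd p) xy) \<partial>Tr ?t p \<partial>sa_law D P ?t)"
    proof (rule nn_integral_cong)
      fix p assume "p \<in> space (sa_law D P ?t)"
      then have p: "p \<in> space (sa_space D ?t)" by (simp add: sa_law_def)
      have s: "sets (Tr ?t p) = sets ?Y"
        using measurable_space[OF Tr p] by (simp add: space_prob_algebra)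
      have "(\<lambda>xy. (\<lambda>((s, a), xy). hist_snoc ?t s a xy) (p, xy)) \<in> ?Y \<rightarrow>\<^sub>M S2"
        using p by (intro measurable_compose[OF measurable_Pair1' sn])
      then have [measurable]: "hist_snoc ?t (fst p) (snd p) \<in> Tr ?t p \<rightarrow>\<^sub>M S2"
        by (subst measurable_cong_sets[OF s refl]) (simp add: split_beta')
      show "(ennreal (path_ratio pe n (fst p)) * k p) * ennreal (ratio pe ?t p) =
        (\<integral>\<^sup>+xy. ennreal (path_ratio pe n (fst p)) * ennreal (ratio pe ?t p) *
          indicator X (hist_snoc ?t (fst p) (snd p) xy) \<partial>Tr ?t p)"
        by (subst nn_integral_cmult) (auto simp: k_eq[OF p] mult_ac)
    qed
    also have "\<dots> = (\<integral>\<^sup>+z. (\<lambda>(p, xy). ennreal (path_ratio pe n (fst p)) * ennreal (ratio pe ?t p) *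
        indicator X (hist_snoc ?t (fst p) (snd p) xy)) (sa_at ?t z, (cov_at (Suc ?t) z, out_at ?t z)) \<partial>P)"
    proof (subst nn_integral_transition[OF t])
      have "(\<lambda>x. indicator X (hist_snoc ?t (fst (fst x)) (snd (fst x)) (snd x)) :: ennreal)
          \<in> borel_measurable (sa_space D ?t \<Otimes>\<^sub>M ?Y)"
        using measurable_compose[OF sn borel_measurable_indicator[OF X]] by (simp add: split_beta')
      then show "(\<lambda>(p, xy). ennreal (path_ratio pe n (fst p)) * ennreal (ratio pe ?t p) *
        indicator X (hist_snoc ?t (fst p) (snd p) xy)) \<in> borel_measurable (sa_space D ?t \<Otimes>\<^sub>M ?Y)"
        unfolding split_beta' by measurable
    qed simp
    also have "\<dots> = (\<integral>\<^sup>+z. ennreal (path_ratio pe ?t (hist_at (Suc ?t) z)) * indicator X (hist_at (Suc ?t) z) \<partial>P)"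
    proof (rule nn_integral_cong)
      fix z
      have "path_ratio pe n (fst (sa_at ?t z)) = path_ratio pe n z"
        by (simp add: sa_at_def path_ratio_hist_at)
      moreover have "hist_snoc ?t (fst (sa_at ?t z)) (snd (sa_at ?t z)) (cov_at (Suc ?t) z, out_at ?t z) = hist_at (Suc ?t) z"
        using hist_snoc_eq[of ?t z] by (simp add: sa_at_def)
      ultimately show "(\<lambda>(p, xy). ennreal (path_ratio pe n (fst p)) * ennreal (ratio pe ?t p) *
        indicator X (hist_snoc ?t (fst p) (snd p) xy)) (sa_at ?t z, (cov_at (Suc ?t) z, out_at ?t z)) =
        ennreal (path_ratio pe ?t (hist_at (Suc ?t) z)) * indicator X (hist_at (Suc ?t) z)"
        unfolding path_ratio_hist_at
        by (simp add: path_ratio_def ennreal_mult ratio_nonneg prod_nonneg)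
    qed
    also have "\<dots> = (\<integral>\<^sup>+s. ennreal (path_ratio pe ?t s) * indicator X s \<partial>hist_law D P (Suc ?t))"
      unfolding hist_law_def S2_def[symmetric]
      using hist_at_P[of "Suc ?t"] t by (subst nn_integral_distr) (auto simp: S2_def[symmetric])
    also have "\<dots> = emeasure (density (hist_law D P (Suc ?t)) (\<lambda>s. ennreal (path_ratio pe ?t s))) X"
      by (subst emeasure_density) (auto simp: S2_def[symmetric] hist_law_def)
    finally show "emeasure (g_hist D P Tr pe ?t) X =
      emeasure (density (hist_law D P (Suc ?t)) (\<lambda>s. ennreal (path_ratio pe ?t s))) X" .
  qed
qed

end

section \<open>Likelihood ratios along the perturbation path\<close>

locale perturbed_design = observed_design D P pol Tr
  for D :: "('x, 'a) design" and P :: "('x, 'a) hist measure" and pol :: "('x, 'a) policy"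
    and Tr :: "nat \<Rightarrow> ('x, 'a) hist \<times> 'a \<Rightarrow> ('x \<times> real) measure" +
  fixes qs Lstar :: "nat \<Rightarrow> ('x, 'a) hist \<times> 'a \<Rightarrow> real"
    and epsbar :: real
    and peps :: "real \<Rightarrow> ('x, 'a) policy"
    and Ker :: "nat \<Rightarrow> real \<Rightarrow> ('x, 'a) hist \<times> 'a \<Rightarrow> 'a measure"
    and Q :: "nat \<Rightarrow> (('x, 'a) hist \<times> 'a \<Rightarrow> real) set"
    and L :: "nat \<Rightarrow> (('x, 'a) hist \<times> 'a \<Rightarrow> real) \<Rightarrow> ('x, 'a) hist \<times> 'a \<Rightarrow> real"
    and Ymax :: real
  assumes path: "convolutional_path D P pol qs epsbar peps Ker Lstar Q L"
    and bounded_outcomes: "\<forall>t\<in>{1..horizon D}. AE z in P. \<bar>out_at t z\<bar> \<le> Ymax"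
begin

abbreviation "Hstar \<equiv> true_score pol Lstar"

lemma epsbar_pos: "0 < epsbar"
  using path by (simp add: convolutional_path_def)

lemma eventually_epsbar: "\<forall>\<^sub>F e in at_right 0. 0 < e \<and> e < epsbar"
  using eventually_at_right[OF epsbar_pos, of "\<lambda>e. 0 < e \<and> e < epsbar"] epsbar_pos by auto

lemma peps_policy: "e \<in> {0..<epsbar} \<Longrightarrow> is_policy D P (peps e)"
  using path by (simp add: convolutional_path_def)

lemma eventually_dominated: "\<forall>\<^sub>F e in at_right 0. dominated (peps e)"
proof -
  have "\<forall>\<^sub>F e in at_right 0. \<forall>t\<in>{1..T}. AE s in hist_law D P t. AE a in act_space D t.
           pol t (s, a) = 0 \<longrightarrow> peps e t (s, a) = 0"
    using path by (intro eventually_ball_finite) (auto simp: convolutional_path_def)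
  with eventually_epsbar show ?thesis
    by eventually_elim (use peps_policy in \<open>auto simp: dominated_def\<close>)
qed

text \<open>The kernel at 0 is a Dirac mass, so both policies define the same measure given almost
  every history, and densities against a sigma-finite measure are unique. The lemma matters because
  the derivative is based at \<open>peps 0\<close>, which agrees with \<open>pol\<close> only almost
  everywhere.\<close>

lemma peps_0:
  assumes t: "t \<in> {1..T}"
  shows "AE s in hist_law D P t. AE a in act_space D t. peps 0 t (s, a) = pol t (s, a)"
proof -
  have e0: "0 \<in> {0..<epsbar}" using epsbar_pos by simp
  have a: "AE s in hist_law D P t. density (act_space D t) (\<lambda>a. ennreal (peps 0 t (s, a))) =
           density (act_space D t) (\<lambda>a. ennreal (pol t (s, a))) \<bind> (\<lambda>a0. Ker t 0 (s, a0))"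
    using path t e0 by (auto simp: convolutional_path_def)
  have b: "Ker t 0 (s, a0) = return (act_space D t) a0"
    if "s \<in> space (hist_space D t)" "a0 \<in> space (act_space D t)" for s a0
    using path t that by (auto simp: convolutional_path_def space_pair_measure)
  have nn: "AE s in hist_law D P t. \<forall>a\<in>act_set D t. 0 \<le> peps 0 t (s, a)"
    "AE s in hist_law D P t. \<forall>a\<in>act_set D t. 0 \<le> pol t (s, a)"
    using peps_policy[OF e0] status_quo_policy t unfolding is_policy_def
    by (auto elim!: ballE[where x = t] eventually_mono)
  note [measurable] = policy_m[OF peps_policy[OF e0] t] pol_m[OF t]
  interpret act: sigma_finite_measure "act_space D t" by (rule sigma_finite_act[OF t])
  show ?thesis
    using a nn AE_space
  proof eventually_elim
    case (elim s)
    have s: "s \<in> space (hist_space D t)" using elim(4) by (simp add: hist_law_def)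
    have "density (act_space D t) (\<lambda>a. ennreal (pol t (s, a))) \<bind> (\<lambda>a0. Ker t 0 (s, a0)) =
      density (act_space D t) (\<lambda>a. ennreal (pol t (s, a))) \<bind>
        return (density (act_space D t) (\<lambda>a. ennreal (pol t (s, a))))"
      using b[OF s] by (intro bind_cong refl) (auto intro!: return_cong)
    also have "\<dots> = density (act_space D t) (\<lambda>a. ennreal (pol t (s, a)))" by (rule bind_return')
    finally have "density (act_space D t) (\<lambda>a. ennreal (peps 0 t (s, a))) =
        density (act_space D t) (\<lambda>a. ennreal (pol t (s, a)))"
      using elim(1) by simp
    then have "AE a in act_space D t. ennreal (peps 0 t (s, a)) = ennreal (pol t (s, a))"
      using s by (intro act.density_unique) auto
    with AE_space show ?case
    proof eventually_elim
      case (elim a)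
      then have "a \<in> act_set D t" using space_act[of t] by auto
      then show ?case using elim \<open>\<forall>a\<in>act_set D t. 0 \<le> peps 0 t (s, a)\<close>
          \<open>\<forall>a\<in>act_set D t. 0 \<le> pol t (s, a)\<close> by simp
    qed
  qed
qed

text \<open>What holds eventually along \<open>at_right 0\<close> says nothing at 0 itself, where
  the difference quotient of the value is based.\<close>

lemma dominated_0: "dominated (peps 0)"
  unfolding dominated_def
proof (intro conjI ballI)
  show "is_policy D P (peps 0)" using epsbar_pos by (intro peps_policy) simp
  fix t assume "t \<in> {1..T}"
  from peps_0[OF this] show "AE s in hist_law D P t. AE a in act_space D t. pol t (s, a) = 0 \<longrightarrow> peps 0 t (s, a) = 0"
    by (auto elim!: eventually_mono)
qed

lemma AE_sa_pos:
  assumes t: "t \<in> {1..T}"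
  shows "AE p in sa_law D P t. 0 < pol t p"
  unfolding sa_law_density[OF t] using pol_m[OF t]
  by (subst AE_density) (auto simp: ennreal_eq_0_iff)

lemma AE_sa_at:
  assumes t: "t \<in> {1..T}" and "AE p in sa_law D P t. R p"
  shows "AE z in P. R (sa_at t z)"
  using AE_distrD[OF sa_at_P[OF t]] assms(2) unfolding sa_law_def by blast

lemma ratio_0:
  assumes t: "t \<in> {1..T}"
  shows "AE p in sa_law D P t. ratio (peps 0) t p = 1"
proof -
  note [measurable] = policy_m[OF peps_policy t, of 0] pol_m[OF t]
  have [measurable]: "peps 0 t \<in> borel_measurable (sa_space D t)"
    using epsbar_pos by (intro policy_m[OF peps_policy t]) simp
  have "AE p in base_law t. peps 0 t p = pol t p"
    by (rule AE_hist_act[OF t _ peps_0[OF t]]) measurable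
  then have "AE p in sa_law D P t. peps 0 t p = pol t p"
    unfolding sa_law_density[OF t] by (subst AE_density) (auto elim: eventually_mono)
  with AE_sa_pos[OF t] show ?thesis by eventually_elim (simp add: ratio_def)
qed

lemma path_ratio_0: "AE z in P. path_ratio (peps 0) T z = 1"
proof -
  have "AE z in P. \<forall>t\<in>{1..T}. ratio (peps 0) t (sa_at t z) = 1"
    by (intro AE_finite_allI AE_sa_at ratio_0) auto
  then show ?thesis by eventually_elim (simp add: path_ratio_def)
qed

lemma Lstar_m: "t \<in> {1..T} \<Longrightarrow> Lstar t \<in> borel_measurable (sa_space D t)"
  using path by (auto simp: convolutional_path_def is_forward_op_def)

lemma Hstar_m [measurable]: "t \<in> {1..T} \<Longrightarrow> Hstar t \<in> borel_measurable (sa_space D t)"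
  unfolding true_score_def[abs_def] by (intro borel_measurable_divide Lstar_m pol_m)

text \<open>Integrating against the law of history and action multiplies by \<open>pol t\<close>,
  which clears the denominators of ratio and score and leaves the forward quotient. Points with
  \<open>pol t p = 0\<close> contribute nothing on the left, so an inequality between the integrals
  is enough.\<close>

lemma ratio_score:
  assumes t: "t \<in> {1..T}"
  shows "L1_tendsto (sa_law D P t) (\<lambda>e p. (ratio (peps e) t p - 1) / e) (Hstar t) (at_right 0)"
  unfolding L1_tendsto_def
proof (intro conjI)
  show "Hstar t \<in> borel_measurable (sa_law D P t)" using Hstar_m[OF t] by simp
  show "\<forall>\<^sub>F e in at_right 0. (\<lambda>p. (ratio (peps e) t p - 1) / e) \<in> borel_measurable (sa_law D P t)"
    using eventually_dominated
  proof eventually_elim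
    case (elim e)
    note [measurable] = ratio_m[OF elim t]
    show ?case by measurable
  qed
  have lim: "((\<lambda>e. \<integral>\<^sup>+p. ennreal \<bar>(peps e t p - pol t p) / e - Lstar t p\<bar>
      \<partial>base_law t) \<longlongrightarrow> 0) (at_right 0)"
    using path t by (auto simp: convolutional_path_def is_forward_op_def)
  show "((\<lambda>e. \<integral>\<^sup>+p. ennreal \<bar>(ratio (peps e) t p - 1) / e - Hstar t p\<bar> \<partial>sa_law D P t) \<longlongrightarrow> 0) (at_right 0)"
  proof (rule tendsto_sandwich[OF _ _ tendsto_const lim])
    show "\<forall>\<^sub>F e in at_right 0. (\<integral>\<^sup>+p. ennreal \<bar>(ratio (peps e) t p - 1) / e - Hstar t p\<bar> \<partial>sa_law D P t) \<le>
       (\<integral>\<^sup>+p. ennreal \<bar>(peps e t p - pol t p) / e - Lstar t p\<bar> \<partial>base_law t)"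
      using eventually_dominated eventually_at_right_less[of 0]
    proof eventually_elim
      case (elim e)
      note [measurable] = ratio_m[OF elim(1) t] pol_m[OF t] Hstar_m[OF t]
      have "(\<integral>\<^sup>+p. ennreal \<bar>(ratio (peps e) t p - 1) / e - Hstar t p\<bar> \<partial>sa_law D P t) =
        (\<integral>\<^sup>+p. ennreal (pol t p) * ennreal \<bar>(ratio (peps e) t p - 1) / e - Hstar t p\<bar>
          \<partial>base_law t)"
        unfolding sa_law_density[OF t] by (subst nn_integral_density) auto
      also have "\<dots> \<le> (\<integral>\<^sup>+p. ennreal \<bar>(peps e t p - pol t p) / e - Lstar t p\<bar>
          \<partial>base_law t)"
      proof (rule nn_integral_mono_AE, use ratio_pol[OF elim(1) t] in eventually_elim)
        fix p
        assume p: "0 \<le> pol t p \<and> 0 \<le> peps e t p \<and> (pol t p = 0 \<longrightarrow> peps e t p = 0) \<and>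
          ennreal (pol t p) * ennreal (ratio (peps e) t p) = ennreal (peps e t p)"
        show "ennreal (pol t p) * ennreal \<bar>(ratio (peps e) t p - 1) / e - Hstar t p\<bar> \<le>
          ennreal \<bar>(peps e t p - pol t p) / e - Lstar t p\<bar>"
        proof (cases "pol t p = 0")
          case False
          then have pos: "0 < pol t p" using p by simp
          have "pol t p * \<bar>(ratio (peps e) t p - 1) / e - Hstar t p\<bar> =
              \<bar>pol t p * ((ratio (peps e) t p - 1) / e - Hstar t p)\<bar>"
            using pos by (simp add: abs_mult)
          also have "pol t p * ((ratio (peps e) t p - 1) / e - Hstar t p) = (peps e t p - pol t p) / e - Lstar t p"
            using pos p elim(2) by (simp add: ratio_def true_score_def field_simps)
          finally show ?thesis using pos by (simp add: ennreal_mult[symmetric])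
        qed simp
      qed
      finally show ?case .
    qed
  qed auto
qed

text \<open>The convolution identity between kernel and perturbed policy, integrated over histories:
  redrawing the action by the kernel amounts to weighting by the ratio. The form is the one that
  \<open>backward_forward_adjoint\<close> asks for.\<close>

lemma kernel_ratio:
  assumes t: "t \<in> {1..T}"
  shows "\<forall>\<^sub>F e in at_right 0. ratio (peps e) t \<in> borel_measurable (sa_law D P t) \<and>
    (\<forall>p. 0 \<le> ratio (peps e) t p) \<and>
    Ker t e \<in> sa_space D t \<rightarrow>\<^sub>M prob_algebra (act_space D t) \<and>
    (\<forall>h\<in>borel_measurable (sa_space D t).
         (\<integral>\<^sup>+p. \<integral>\<^sup>+a. h (fst p, a) \<partial>Ker t e p \<partial>sa_law D P t) =
         (\<integral>\<^sup>+p. h p * ennreal (ratio (peps e) t p) \<partial>sa_law D P t))"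
  using eventually_dominated eventually_epsbar
proof eventually_elim
  case (elim e)
  have e: "e \<in> {0..<epsbar}" using elim by simp
  note [measurable] = ratio_m[OF elim(1) t] pol_m[OF t] policy_m[OF peps_policy[OF e] t]
  have Kp: "Ker t e \<in> sa_space D t \<rightarrow>\<^sub>M prob_algebra (act_space D t)"
    using path t e by (auto simp: convolutional_path_def)
  have K [measurable]: "Ker t e \<in> sa_space D t \<rightarrow>\<^sub>M subprob_algebra (act_space D t)"
    by (rule measurable_prob_algebraD[OF Kp])
  have a: "AE s in hist_law D P t. density (act_space D t) (\<lambda>a. ennreal (peps e t (s, a))) =
           density (act_space D t) (\<lambda>a. ennreal (pol t (s, a))) \<bind> (\<lambda>a0. Ker t e (s, a0))"
    using path t e by (auto simp: convolutional_path_def)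
  interpret act: sigma_finite_measure "act_space D t" by (rule sigma_finite_act[OF t])
  have "(\<integral>\<^sup>+p. \<integral>\<^sup>+a. h (fst p, a) \<partial>Ker t e p \<partial>sa_law D P t) =
         (\<integral>\<^sup>+p. h p * ennreal (ratio (peps e) t p) \<partial>sa_law D P t)"
    if h [measurable]: "h \<in> borel_measurable (sa_space D t)" for h
  proof -
    define k where "k = (\<lambda>p. \<integral>\<^sup>+a. h (fst p, a) \<partial>Ker t e p)"
    have k [measurable]: "k \<in> borel_measurable (sa_space D t)"
      unfolding k_def by (rule nn_integral_measurable_subprob_algebra2[OF _ K]) measurable
    have "(\<integral>\<^sup>+p. k p \<partial>sa_law D P t) =
        (\<integral>\<^sup>+p. ennreal (pol t p) * k p \<partial>base_law t)"
      unfolding sa_law_density[OF t] by (subst nn_integral_density) auto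
    also have "\<dots> = (\<integral>\<^sup>+s. \<integral>\<^sup>+a. ennreal (pol t (s, a)) * k (s, a) \<partial>act_space D t \<partial>hist_law D P t)"
      by (subst act.nn_integral_fst[symmetric]) auto
    also have "\<dots> = (\<integral>\<^sup>+s. \<integral>\<^sup>+a. h (s, a) * ennreal (peps e t (s, a)) \<partial>act_space D t \<partial>hist_law D P t)"
    proof (rule nn_integral_cong_AE, use a AE_space in eventually_elim)
      fix s assume eq: "density (act_space D t) (\<lambda>a. ennreal (peps e t (s, a))) =
           density (act_space D t) (\<lambda>a. ennreal (pol t (s, a))) \<bind> (\<lambda>a0. Ker t e (s, a0))"
        and "s \<in> space (hist_law D P t)"
      then have s [simp]: "s \<in> space (hist_space D t)" by (simp add: hist_law_def)
      have Ks: "(\<lambda>a0. Ker t e (s, a0)) \<in> act_space D t \<rightarrow>\<^sub>M subprob_algebra (act_space D t)"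
        using s by measurable
      have hs [measurable]: "(\<lambda>a. h (s, a)) \<in> borel_measurable (act_space D t)" using s by measurable
      have "(\<integral>\<^sup>+a. ennreal (pol t (s, a)) * k (s, a) \<partial>act_space D t) =
          (\<integral>\<^sup>+a0. k (s, a0) \<partial>density (act_space D t) (\<lambda>a. ennreal (pol t (s, a))))"
        by (subst nn_integral_density) auto
      also have "\<dots> = (\<integral>\<^sup>+a. h (s, a) \<partial>(density (act_space D t) (\<lambda>a. ennreal (pol t (s, a))) \<bind> (\<lambda>a0. Ker t e (s, a0))))"
        unfolding k_def using Ks by (subst nn_integral_bind[where B = "act_space D t"]) auto
      also have "\<dots> = (\<integral>\<^sup>+a. ennreal (peps e t (s, a)) * h (s, a) \<partial>act_space D t)"
        unfolding eq[symmetric] by (subst nn_integral_density) auto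
      finally show "(\<integral>\<^sup>+a. ennreal (pol t (s, a)) * k (s, a) \<partial>act_space D t) =
        (\<integral>\<^sup>+a. h (s, a) * ennreal (peps e t (s, a)) \<partial>act_space D t)"
        by (simp add: mult.commute)
    qed
    also have "\<dots> = (\<integral>\<^sup>+p. h p * ennreal (ratio (peps e) t p) \<partial>sa_law D P t)"
      by (rule nn_integral_ratio[OF elim(1) t h, symmetric])
    finally show ?thesis by (simp add: k_def)
  qed
  then show ?case using Kp ratio_nonneg by simp
qed

lemma backward_adjoint:
  assumes t: "t \<in> {1..T}" and q: "q \<in> Q t" and B: "AE p in sa_law D P t. \<bar>q p\<bar> \<le> B"
  shows "integrable (sa_law D P t) (L t q)"
    and "(\<integral>p. L t q p \<partial>sa_law D P t) = (\<integral>p. Hstar t p * q p \<partial>sa_law D P t)"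
    and "integrable (sa_law D P t) (\<lambda>p. Hstar t p * q p)"
proof -
  have "is_backward_op D P Ker t (Q t) (L t)" using path t by (auto simp: convolutional_path_def)
  then have m: "q \<in> borel_measurable (sa_space D t)" "L t q \<in> borel_measurable (sa_space D t)"
    and lim: "((\<lambda>e. \<integral>\<^sup>+p. ennreal \<bar>((\<integral>a. q (fst p, a) \<partial>Ker t e p) - q p) / e - L t q p\<bar> \<partial>sa_law D P t)
      \<longlongrightarrow> 0) (at_right 0)"
    using q by (auto simp: is_backward_op_def backward_quotient_def)
  note adj = backward_forward_adjoint[OF prob_sa_law[OF t] sets_sa_law ratio_score[OF t] kernel_ratio[OF t] m(1) B m(2) lim]
  show "integrable (sa_law D P t) (L t q)"
    "(\<integral>p. L t q p \<partial>sa_law D P t) = (\<integral>p. Hstar t p * q p \<partial>sa_law D P t)"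
    "integrable (sa_law D P t) (\<lambda>p. Hstar t p * q p)" by (fact adj)+
qed

lemma ratio_score_P:
  assumes t: "t \<in> {1..T}"
  shows "L1_tendsto P (\<lambda>e z. (ratio (peps e) t (sa_at t z) - 1) / e) (\<lambda>z. Hstar t (sa_at t z)) (at_right 0)"
  unfolding L1_tendsto_def
proof (intro conjI)
  note [measurable] = Hstar_m[OF t] sa_at_P[OF t]
  show "(\<lambda>z. Hstar t (sa_at t z)) \<in> borel_measurable P" by measurable
  show "\<forall>\<^sub>F e in at_right 0. (\<lambda>z. (ratio (peps e) t (sa_at t z) - 1) / e) \<in> borel_measurable P"
    using eventually_dominated
  proof eventually_elim
    case (elim e)
    note [measurable] = ratio_m[OF elim t]
    show ?case by measurable
  qed
  have "((\<lambda>e. \<integral>\<^sup>+p. ennreal \<bar>(ratio (peps e) t p - 1) / e - Hstar t p\<bar> \<partial>sa_law D P t) \<longlongrightarrow> 0) (at_right 0)"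
    using ratio_score[OF t] by (simp add: L1_tendsto_def)
  then show "((\<lambda>e. \<integral>\<^sup>+z. ennreal \<bar>(ratio (peps e) t (sa_at t z) - 1) / e - Hstar t (sa_at t z)\<bar> \<partial>P) \<longlongrightarrow> 0) (at_right 0)"
  proof (rule Lim_transform_eventually, use eventually_dominated in eventually_elim)
    fix e assume "dominated (peps e)"
    note [measurable] = ratio_m[OF this t]
    show "(\<integral>\<^sup>+p. ennreal \<bar>(ratio (peps e) t p - 1) / e - Hstar t p\<bar> \<partial>sa_law D P t) =
      (\<integral>\<^sup>+z. ennreal \<bar>(ratio (peps e) t (sa_at t z) - 1) / e - Hstar t (sa_at t z)\<bar> \<partial>P)"
      unfolding sa_law_def by (subst nn_integral_distr) auto
  qed
qed

lemma ratio_P: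
  assumes t: "t \<in> {1..T}"
  shows "\<forall>\<^sub>F e in at_right 0. (\<lambda>z. ratio (peps e) t (sa_at t z)) \<in> borel_measurable P \<and>
    (\<forall>z. 0 \<le> ratio (peps e) t (sa_at t z)) \<and>
    (\<forall>g\<in>borel_measurable (hist_space D t).
      (\<integral>\<^sup>+z. g (hist_at t z) * ennreal (ratio (peps e) t (sa_at t z)) \<partial>P) = (\<integral>\<^sup>+z. g (hist_at t z) \<partial>P))"
  using eventually_dominated
proof eventually_elim
  case (elim e)
  note [measurable] = ratio_m[OF elim t] sa_at_P[OF t]
  show ?case using ratio_marginal[OF elim t] ratio_nonneg by auto
qed

lemma score_orthogonal:
  assumes t: "t \<in> {1..T}" and u: "u \<in> borel_measurable (hist_space D t)"
    and B: "AE z in P. \<bar>u (hist_at t z)\<bar> \<le> B"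
  shows "integrable P (\<lambda>z. u (hist_at t z) * Hstar t (sa_at t z))"
    and "(\<integral>z. u (hist_at t z) * Hstar t (sa_at t z) \<partial>P) = 0"
  using score_mean_zero[OF prob_P hist_at_P ratio_score_P[OF t] ratio_P[OF t] u B] t by auto

lemma Hstar_integrable: "t \<in> {1..T} \<Longrightarrow> integrable P (\<lambda>z. Hstar t (sa_at t z))"
  using score_orthogonal(1)[of t "\<lambda>_. 1" 1] by simp

lemma path_ratio_score:
  assumes "n \<le> T"
  shows "L1_tendsto P (\<lambda>e z. (path_ratio (peps e) n z - 1) / e) (\<lambda>z. \<Sum>t = 1..n. Hstar t (sa_at t z)) (at_right 0)"
  using assms
proof (induction n)
  case 0
  show ?case by (simp add: path_ratio_def L1_tendsto_def)
next
  case (Suc n)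
  let ?t = "Suc n"
  have t: "?t \<in> {1..T}" using Suc by auto
  \<comment> \<open>Chosen so that \<open>1 + e * a e z\<close> is the ratio of the first
    \<open>n\<close> actions when \<open>e \<noteq> 0\<close>. Both \<open>a e\<close> and
    \<open>A\<close> depend only on the history before action \<open>n + 1\<close>.\<close>
  define a where "a = (\<lambda>e z. (path_ratio (peps e) n z - 1) / e)"
  define A where "A = (\<lambda>z. \<Sum>t = 1..n. Hstar t (sa_at t z))"
  have ah: "a e (hist_at ?t z) = a e z" for e z by (simp add: a_def path_ratio_hist_at)
  have Ah: "A (hist_at ?t z) = A z" for z
    unfolding A_def by (intro sum.cong refl arg_cong[where f = "Hstar _"] sa_at_hist_at) auto
  have step: "L1_tendsto P (\<lambda>e z. ((1 + e * a e (hist_at ?t z)) * ratio (peps e) ?t (sa_at ?t z) - 1) / e)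
      (\<lambda>z. A (hist_at ?t z) + Hstar ?t (sa_at ?t z)) (at_right 0)"
  proof (rule L1_tendsto_ratio_step[where S = "hist_space D ?t"])
    show "hist_at ?t \<in> P \<rightarrow>\<^sub>M hist_space D ?t" using t by (intro hist_at_P) auto
    show "L1_tendsto P (\<lambda>e z. a e (hist_at ?t z)) (\<lambda>z. A (hist_at ?t z)) (at_right 0)"
      unfolding ah Ah unfolding a_def A_def using Suc by simp
    show "\<forall>\<^sub>F e in at_right 0. a e \<in> borel_measurable (hist_space D ?t)"
      using eventually_dominated
    proof eventually_elim
      case (elim e)
      have [measurable]: "path_ratio (peps e) n \<in> borel_measurable (hist_space D ?t)"
        using Suc by (intro path_ratio_m elim) auto
      show ?case unfolding a_def by measurable
    qed
    show "A \<in> borel_measurable (hist_space D ?t)"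
      unfolding A_def
    proof (rule borel_measurable_sum)
      fix t assume "t \<in> {1..n}"
      then show "(\<lambda>z. Hstar t (sa_at t z)) \<in> borel_measurable (hist_space D ?t)"
        using Suc by (intro measurable_compose[OF measurable_sa_at Hstar_m]) auto
    qed
    show "integrable P (\<lambda>z. A (hist_at ?t z))"
      unfolding Ah unfolding A_def using Suc by (intro Bochner_Integration.integrable_sum Hstar_integrable) auto
  qed (fact ratio_score_P[OF t] ratio_P[OF t] Hstar_integrable[OF t])+
  have "(\<lambda>z. A (hist_at ?t z) + Hstar ?t (sa_at ?t z)) = (\<lambda>z. \<Sum>t = 1..?t. Hstar t (sa_at t z))"
    unfolding Ah by (simp add: A_def)
  from step[unfolded this] show ?case
  proof (rule L1_tendsto_cong)
    show "\<forall>\<^sub>F e in at_right 0. (\<lambda>z. (path_ratio (peps e) ?t z - 1) / e) \<in> borel_measurable P \<and>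
      (AE z in P. ((1 + e * a e (hist_at ?t z)) * ratio (peps e) ?t (sa_at ?t z) - 1) / e =
        (path_ratio (peps e) ?t z - 1) / e)"
      using eventually_dominated eventually_at_right_less[of 0]
    proof eventually_elim
      case (elim e)
      have [measurable]: "path_ratio (peps e) ?t \<in> borel_measurable P"
        using Suc by (subst measurable_cong_sets[OF sets_P_hist refl], intro path_ratio_m elim) auto
      have "(1 + e * a e (hist_at ?t z)) * ratio (peps e) ?t (sa_at ?t z) = path_ratio (peps e) ?t z" for z
        using elim unfolding ah unfolding a_def by (simp add: path_ratio_def)
      then show ?case by simp
    qed
  qed
qed

end

section \<open>The marginal policy effect\<close>

lemma at_within_Ico_at_right:
  fixes a b :: "'b :: linorder_topology"
  assumes "a < b"
  shows "at a within {a..<b} = at_right a"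
  by (rule at_within_nhd[of a "{..<b}"]) (use assms in auto)

context perturbed_design
begin

definition "max_reward = Ymax * (\<Sum>k<T. discount D ^ k)"

lemma discount: "0 < discount D" "discount D \<le> 1"
  using design by (auto simp: design_def)

lemma reward_m [measurable]: "t \<in> {1..T} \<Longrightarrow> reward_to_go D t \<in> borel_measurable P"
  unfolding reward_to_go_def[abs_def]
  by (intro borel_measurable_sum borel_measurable_times borel_measurable_const out_at_P) auto

lemma reward_bound:
  assumes t: "t \<in> {1..T}"
  shows "AE z in P. \<bar>reward_to_go D t z\<bar> \<le> max_reward"
proof -
  have "AE z in P. \<forall>k\<in>{1..T}. \<bar>out_at k z\<bar> \<le> Ymax"
    using bounded_outcomes by (intro AE_finite_allI) auto
  then show ?thesis
  proof eventually_elim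
    case (elim z)
    \<comment> \<open>The sign of \<open>Ymax\<close> follows from an outcome that it bounds; it is
      needed to enlarge the sum to all exponents below the horizon.\<close>
    then have Y: "0 \<le> Ymax" using t abs_ge_zero[of "out_at t z"] by (auto intro: order_trans)
    have "\<bar>reward_to_go D t z\<bar> \<le> (\<Sum>k = t..T. \<bar>discount D ^ (k - t) * out_at k z\<bar>)"
      unfolding reward_to_go_def by (rule sum_abs)
    also have "\<dots> \<le> (\<Sum>k = t..T. discount D ^ (k - t) * Ymax)"
      using elim t discount by (intro sum_mono) (auto simp: abs_mult intro!: mult_left_mono)
    also have "\<dots> = (\<Sum>j\<in>(\<lambda>k. k - t) ` {t..T}. discount D ^ j * Ymax)"
      by (subst sum.reindex) (auto simp: inj_on_def)
    also have "\<dots> \<le> (\<Sum>j<T. discount D ^ j * Ymax)"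
      using t Y discount by (intro sum_mono2) auto
    also have "\<dots> = max_reward" by (simp add: max_reward_def sum_distrib_left mult.commute)
    finally show ?case .
  qed
qed

lemma max_reward_nonneg: "t \<in> {1..T} \<Longrightarrow> 0 \<le> max_reward"
  using reward_bound[of t] AE_E_prob by (smt (verit) AE_False eventually_mono)

lemma policy_value_ratio:
  assumes d: "dominated pe" and T: "1 \<le> T"
  shows "policy_value D P Tr pe = (\<integral>z. reward_to_go D 1 z * path_ratio pe T z \<partial>P)"
proof -
  have m [measurable]: "path_ratio pe T \<in> borel_measurable P"
    by (subst measurable_cong_sets[OF sets_P_hist refl]) (intro path_ratio_m d; simp)
  have R: "reward_to_go D 1 \<in> borel_measurable P" using T by (intro reward_m) auto
  note [measurable] = R R[simplified]
  have P: "hist_law D P (Suc T) = P"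
  proof -
    have "distr P (hist_space D (Suc T)) (hist_at (Suc T)) = distr P P (\<lambda>z. z)"
      by (rule distr_cong) (auto simp: sets_P_hist space_P hist_at_space)
    then show ?thesis by (simp add: hist_law_def)
  qed
  have "policy_value D P Tr pe = (\<integral>z. reward_to_go D 1 z \<partial>density P (\<lambda>z. ennreal (path_ratio pe T z)))"
    unfolding policy_value_def g_law_def g_hist_density[OF d order_refl] P
    by (simp add: reward_to_go_def)
  also have "\<dots> = (\<integral>z. path_ratio pe T z * reward_to_go D 1 z \<partial>P)"
    by (subst integral_density) (auto simp: path_ratio_nonneg)
  finally show ?thesis by (simp add: mult.commute)
qed

text \<open>Martingale argument: given the history the next ratio has mean one, so the total mass of
  the product stays one.\<close>

lemma path_ratio_integrable:
  assumes d: "dominated pe"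
  shows "integrable P (path_ratio pe T)"
proof -
  have m [measurable]: "path_ratio pe T \<in> borel_measurable P"
    by (subst measurable_cong_sets[OF sets_P_hist refl]) (intro path_ratio_m d; simp)
  have "(\<integral>\<^sup>+z. ennreal (path_ratio pe n z) \<partial>P) = 1" if "n \<le> T" for n
    using that
  proof (induction n)
    case 0
    then show ?case by (simp add: path_ratio_def emeasure_space_1)
  next
    case (Suc n)
    let ?t = "Suc n"
    have t: "?t \<in> {1..T}" using Suc by auto
    have g: "(\<lambda>s. ennreal (path_ratio pe n s)) \<in> borel_measurable (hist_space D ?t)"
      using Suc by (intro measurable_compose[OF path_ratio_m[OF d] measurable_ennreal]) auto
    have "(\<integral>\<^sup>+z. ennreal (path_ratio pe ?t z) \<partial>P) =
        (\<integral>\<^sup>+z. ennreal (path_ratio pe n (hist_at ?t z)) * ennreal (ratio pe ?t (sa_at ?t z)) \<partial>P)"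
      unfolding path_ratio_hist_at
      by (simp add: path_ratio_def ennreal_mult ratio_nonneg prod_nonneg)
    also have "\<dots> = (\<integral>\<^sup>+z. ennreal (path_ratio pe n (hist_at ?t z)) \<partial>P)"
      by (rule ratio_marginal[OF d t g])
    finally show ?case using Suc by (simp add: path_ratio_hist_at)
  qed
  from this[of T] show ?thesis
    using path_ratio_nonneg by (intro integrableI_nonneg) auto
qed

lemma policy_value_derivative:
  assumes T: "1 \<le> T"
  shows "((\<lambda>e. policy_value D P Tr (peps e)) has_real_derivative
    (\<integral>z. reward_to_go D 1 z * (\<Sum>t = 1..T. Hstar t (sa_at t z)) \<partial>P)) (at 0 within {0..<epsbar})"
proof -
  let ?G = "reward_to_go D 1"
  have t1: "1 \<in> {1..T}" using T by simp
  note [measurable] = reward_m[OF t1] reward_m[OF t1, simplified]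
  note B = reward_bound[OF t1]
  have L1: "L1_tendsto P (\<lambda>e z. ?G z * ((path_ratio (peps e) T z - 1) / e))
      (\<lambda>z. ?G z * (\<Sum>t = 1..T. Hstar t (sa_at t z))) (at_right 0)"
    by (rule L1_tendsto_mult_bounded[OF path_ratio_score[OF order_refl] _ B]) simp
  have Gint: "integrable P (\<lambda>z. ?G z * f z)" if f: "integrable P f" for f
  proof (rule Bochner_Integration.integrable_bound)
    show "integrable P (\<lambda>z. max_reward * f z)" using f by simp
    show "(\<lambda>z. ?G z * f z) \<in> borel_measurable P" using borel_measurable_integrable[OF f] by measurable
    show "AE z in P. norm (?G z * f z) \<le> norm (max_reward * f z)"
      using B by eventually_elim (auto simp: abs_mult intro!: mult_right_mono)
  qed
  have pint: "integrable P (path_ratio (peps e) T)" if "dominated (peps e)" for e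
    by (rule path_ratio_integrable[OF that])
  have int: "\<forall>\<^sub>F e in at_right 0. integrable P (\<lambda>z. ?G z * ((path_ratio (peps e) T z - 1) / e))"
    using eventually_dominated
    by eventually_elim (intro Gint integrable_divide Bochner_Integration.integrable_diff pint, auto)
  have lim: "((\<lambda>e. \<integral>z. ?G z * ((path_ratio (peps e) T z - 1) / e) \<partial>P) \<longlongrightarrow>
      (\<integral>z. ?G z * (\<Sum>t = 1..T. Hstar t (sa_at t z)) \<partial>P)) (at_right 0)"
    by (rule L1_tendsto_integral[OF L1 int])
  have v0: "policy_value D P Tr (peps 0) = (\<integral>z. ?G z * 1 \<partial>P)"
    unfolding policy_value_ratio[OF dominated_0 T]
  proof (rule integral_cong_AE)
    show "(\<lambda>z. ?G z * path_ratio (peps 0) T z) \<in> borel_measurable P"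
      using borel_measurable_integrable[OF pint[OF dominated_0]] by measurable
    show "AE z in P. ?G z * path_ratio (peps 0) T z = ?G z * 1"
      using path_ratio_0 by eventually_elim simp
  qed simp
  have "((\<lambda>e. (policy_value D P Tr (peps e) - policy_value D P Tr (peps 0)) / (e - 0)) \<longlongrightarrow>
      (\<integral>z. ?G z * (\<Sum>t = 1..T. Hstar t (sa_at t z)) \<partial>P)) (at_right 0)"
    using lim
  proof (rule Lim_transform_eventually, use eventually_dominated in eventually_elim)
    fix e assume d: "dominated (peps e)"
    have "(\<integral>z. ?G z * ((path_ratio (peps e) T z - 1) / e) \<partial>P) =
        (\<integral>z. (?G z * path_ratio (peps e) T z - ?G z * 1) / e \<partial>P)"
      by (simp add: right_diff_distrib diff_divide_distrib)
    also have "\<dots> = ((\<integral>z. ?G z * path_ratio (peps e) T z \<partial>P) - (\<integral>z. ?G z * 1 \<partial>P)) / e"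
      using Gint[OF pint[OF d]] Gint[of "\<lambda>_. 1"] by simp
    finally show "(\<integral>z. ?G z * ((path_ratio (peps e) T z - 1) / e) \<partial>P) =
        (policy_value D P Tr (peps e) - policy_value D P Tr (peps 0)) / (e - 0)"
      unfolding policy_value_ratio[OF d T] v0 by simp
  qed
  then show ?thesis
    unfolding has_field_derivative_iff at_within_Ico_at_right[OF epsbar_pos] .
qed

text \<open>The reward from time 1 splits into the rewards before \<open>t\<close>, a function of
  the history and so orthogonal to the score, and the discounted reward to go from
  \<open>t\<close>.\<close>

lemma Hstar_reward:
  assumes t: "t \<in> {1..T}"
  shows "integrable P (\<lambda>z. reward_to_go D 1 z * Hstar t (sa_at t z))"
    and "integrable P (\<lambda>z. Hstar t (sa_at t z) * reward_to_go D t z)"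
    and "(\<integral>z. reward_to_go D 1 z * Hstar t (sa_at t z) \<partial>P) =
      discount D ^ (t - 1) * (\<integral>z. Hstar t (sa_at t z) * reward_to_go D t z \<partial>P)"
proof -
  define u :: "('x, 'a) hist \<Rightarrow> real" where "u = (\<lambda>z. \<Sum>k = 1..<t. discount D ^ (k - 1) * out_at k z)"
  have u_m: "u \<in> borel_measurable (hist_space D t)"
    unfolding u_def by (intro borel_measurable_sum borel_measurable_times borel_measurable_const measurable_out_at) auto
  have uh: "u (hist_at t z) = u z" for z
    unfolding u_def by (intro sum.cong) (auto simp: out_at_def hist_at_def)
  have split: "reward_to_go D 1 z = u z + discount D ^ (t - 1) * reward_to_go D t z" for z
  proof -
    have "{1..T} = {1..<t} \<union> {t..T}" using t by auto
    then have "reward_to_go D 1 z = u z + (\<Sum>k = t..T. discount D ^ (k - 1) * out_at k z)"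
      unfolding reward_to_go_def u_def by (simp only:) (rule sum.union_disjoint, auto)
    also have "(\<Sum>k = t..T. discount D ^ (k - 1) * out_at k z) =
        (\<Sum>k = t..T. discount D ^ (t - 1) * (discount D ^ (k - t) * out_at k z))"
      using t by (intro sum.cong) (auto simp: mult.assoc[symmetric] power_add[symmetric])
    finally show ?thesis by (simp add: reward_to_go_def sum_distrib_left)
  qed
  have t1: "1 \<in> {1..T}" using t by auto
  \<comment> \<open>The past rewards are a difference of two quantities bounded by
    \<open>max_reward\<close>, whence the factor 2.\<close>
  have "AE z in P. \<bar>u (hist_at t z)\<bar> \<le> 2 * max_reward"
    using reward_bound[OF t] reward_bound[OF t1]
  proof eventually_elim
    case (elim z)
    have "\<bar>discount D ^ (t - 1) * reward_to_go D t z\<bar> \<le> 1 * \<bar>reward_to_go D t z\<bar>"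
      unfolding abs_mult using discount by (intro mult_right_mono) (auto intro: power_le_one)
    then show ?case using elim split[of z] unfolding uh by linarith
  qed
  note o = score_orthogonal[OF t u_m this, unfolded uh]
  note [measurable] = reward_m[OF t] Hstar_m[OF t] sa_at_P[OF t]
  show i: "integrable P (\<lambda>z. Hstar t (sa_at t z) * reward_to_go D t z)"
  proof (rule Bochner_Integration.integrable_bound)
    show "integrable P (\<lambda>z. max_reward * Hstar t (sa_at t z))" using Hstar_integrable[OF t] by simp
    show "AE z in P. norm (Hstar t (sa_at t z) * reward_to_go D t z) \<le> norm (max_reward * Hstar t (sa_at t z))"
      using reward_bound[OF t]
      by eventually_elim (auto simp: abs_mult mult.commute[of max_reward] intro!: mult_left_mono)
  qed measurable
  have eq: "reward_to_go D 1 z * Hstar t (sa_at t z) =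
      u z * Hstar t (sa_at t z) + discount D ^ (t - 1) * (Hstar t (sa_at t z) * reward_to_go D t z)" for z
    unfolding split by (simp add: algebra_simps)
  show "integrable P (\<lambda>z. reward_to_go D 1 z * Hstar t (sa_at t z))"
    unfolding eq using o(1) i by simp
  show "(\<integral>z. reward_to_go D 1 z * Hstar t (sa_at t z) \<partial>P) =
      discount D ^ (t - 1) * (\<integral>z. Hstar t (sa_at t z) * reward_to_go D t z \<partial>P)"
    unfolding eq using o i by simp
qed

definition "Theta = (\<Sum>t = 1..T. discount D ^ (t - 1) * (\<integral>z. Hstar t (sa_at t z) * reward_to_go D t z \<partial>P))"

lemma policy_value_Theta:
  "((\<lambda>e. policy_value D P Tr (peps e)) has_real_derivative Theta) (at 0 within {0..<epsbar})"
proof (cases "T = 0")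
  case True
  \<comment> \<open>With horizon 0 there is no time 1; the value is identically zero and
    \<open>Theta\<close> is an empty sum.\<close>
  have "policy_value D P Tr pe = 0" for pe unfolding policy_value_def True by simp
  then show ?thesis by (simp add: Theta_def True)
next
  case False
  then have "1 \<le> T" by simp
  moreover have "(\<integral>z. reward_to_go D 1 z * (\<Sum>t = 1..T. Hstar t (sa_at t z)) \<partial>P) = Theta"
    unfolding Theta_def sum_distrib_left
    by (subst Bochner_Integration.integral_sum) (auto simp del: One_nat_def intro!: sum.cong Hstar_reward)
  ultimately show ?thesis using policy_value_derivative by simp
qed

lemma marginal_policy_effect_Theta: "marginal_policy_effect D P Tr peps epsbar = Theta"
  unfolding marginal_policy_effect_def
proof (rule vector_derivative_within)
  show "at (0::real) within {0..<epsbar} \<noteq> bot"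
    unfolding at_within_Ico_at_right[OF epsbar_pos] by simp
  show "((\<lambda>e. policy_value D P Tr (peps e)) has_vector_derivative Theta) (at 0 within {0..<epsbar})"
    using policy_value_Theta by (simp add: has_real_derivative_iff_has_vector_derivative)
qed

lemma influence_mean:
  assumes qB: "\<And>t. t \<in> {1..T} \<Longrightarrow> AE p in sa_law D P t. \<bar>qs t p\<bar> \<le> max_reward"
  shows "integrable P (influence D L qs Hstar)" and "(\<integral>z. influence D L qs Hstar z \<partial>P) = Theta"
proof -
  have summand: "integrable P (\<lambda>z. discount D ^ (t - 1) * (L t (qs t) (sa_at t z) +
       Hstar t (sa_at t z) * (reward_to_go D t z - qs t (sa_at t z)))) \<and>
     (\<integral>z. discount D ^ (t - 1) * (L t (qs t) (sa_at t z) +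
       Hstar t (sa_at t z) * (reward_to_go D t z - qs t (sa_at t z))) \<partial>P) =
     discount D ^ (t - 1) * (\<integral>z. Hstar t (sa_at t z) * reward_to_go D t z \<partial>P)"
    if t: "t \<in> {1..T}" for t
  proof -
    have q: "qs t \<in> Q t" using path t by (auto simp: convolutional_path_def)
    note adj = backward_adjoint[OF t q qB[OF t]]
    note [measurable] = sa_at_P[OF t] borel_measurable_integrable[OF adj(1), simplified]
      borel_measurable_integrable[OF adj(3), simplified]
    have i1: "integrable P (\<lambda>z. L t (qs t) (sa_at t z))"
      using adj(1) unfolding sa_law_def by (subst (asm) integrable_distr_eq) auto
    have i2: "integrable P (\<lambda>z. Hstar t (sa_at t z) * qs t (sa_at t z))"
      using adj(3) unfolding sa_law_def by (subst (asm) integrable_distr_eq) auto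
    have e: "(\<integral>z. L t (qs t) (sa_at t z) \<partial>P) = (\<integral>z. Hstar t (sa_at t z) * qs t (sa_at t z) \<partial>P)"
      using adj(2) unfolding sa_law_def by (subst (asm) (1 2) integral_distr) auto
    have eq: "L t (qs t) (sa_at t z) + Hstar t (sa_at t z) * (reward_to_go D t z - qs t (sa_at t z)) =
      L t (qs t) (sa_at t z) + Hstar t (sa_at t z) * reward_to_go D t z - Hstar t (sa_at t z) * qs t (sa_at t z)" for z
      by (simp add: algebra_simps)
    show ?thesis unfolding eq using i1 i2 e Hstar_reward(2)[OF t] by simp
  qed
  show "integrable P (influence D L qs Hstar)"
    unfolding influence_def[abs_def] using summand by (intro Bochner_Integration.integrable_sum) auto
  show "(\<integral>z. influence D L qs Hstar z \<partial>P) = Theta"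
    unfolding influence_def[abs_def] Theta_def using summand
    by (subst Bochner_Integration.integral_sum) (blast intro: sum.cong)+
qed

end

section \<open>Orthogonality and cross-fitting\<close>

text \<open>\<open>L2_norm\<close> is infinite on functions that are not square integrable, so a
  finite bound carries measurability and integrability with it.\<close>

lemma L2_norm_leD:
  assumes "L2_norm M f \<le> ennreal r" "0 \<le> r"
  shows "f \<in> borel_measurable M" "integrable M (\<lambda>x. (f x)\<^sup>2)" "(\<integral>x. (f x)\<^sup>2 \<partial>M) \<le> r\<^sup>2"
proof -
  have sq: "square_integrable M f"
    using assms by (auto simp: L2_norm_def top_unique split: if_splits)
  then show "f \<in> borel_measurable M" "integrable M (\<lambda>x. (f x)\<^sup>2)" by (auto simp: square_integrable_def)
  have "sqrt (\<integral>x. (f x)\<^sup>2 \<partial>M) \<le> r"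
    using assms sq by (simp add: L2_norm_def)
  then show "(\<integral>x. (f x)\<^sup>2 \<partial>M) \<le> r\<^sup>2" by (rule sqrt_le_D)
qed

lemma L2_product_bound:
  fixes f g :: "'b \<Rightarrow> real"
  assumes f: "L2_norm M f \<le> ennreal a" and g: "L2_norm M g \<le> ennreal b" and ab: "0 < a" "0 < b"
  shows "integrable M (\<lambda>x. f x * g x)" and "\<bar>\<integral>x. f x * g x \<partial>M\<bar> \<le> a * b"
proof -
  note F = L2_norm_leD[OF f less_imp_le[OF ab(1)]] and G = L2_norm_leD[OF g less_imp_le[OF ab(2)]]
  note [measurable] = F(1) G(1)
  \<comment> \<open>Cauchy-Schwarz through a weighted arithmetic-geometric mean: with the weights
    \<open>b / a\<close> and \<open>a / b\<close> each term contributes at most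
    \<open>a * b / 2\<close>.\<close>
  define h where "h = (\<lambda>x. (b / a) / 2 * (f x)\<^sup>2 + (a / b) / 2 * (g x)\<^sup>2)"
  have h: "integrable M h" unfolding h_def using F G ab by auto
  have le: "\<bar>f x * g x\<bar> \<le> h x" for x
  proof -
    have "0 \<le> (b * \<bar>f x\<bar> - a * \<bar>g x\<bar>)\<^sup>2 / (2 * a * b)" using ab by simp
    also have "\<dots> = h x - \<bar>f x * g x\<bar>"
      using ab by (simp add: h_def power2_eq_square abs_mult field_simps)
    finally show ?thesis by simp
  qed
  then show i: "integrable M (\<lambda>x. f x * g x)"
    by (intro Bochner_Integration.integrable_bound[OF h] borel_measurable_times F(1) G(1) AE_I2)
      (auto intro: order_trans[OF le])
  have "\<bar>\<integral>x. f x * g x \<partial>M\<bar> \<le> (\<integral>x. h x \<partial>M)"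
    using i h le by (intro order_trans[OF integral_abs_bound] integral_mono) auto
  also have "\<dots> = (b / a) / 2 * (\<integral>x. (f x)\<^sup>2 \<partial>M) + (a / b) / 2 * (\<integral>x. (g x)\<^sup>2 \<partial>M)"
    unfolding h_def using F G by simp
  also have "\<dots> \<le> (b / a) / 2 * a\<^sup>2 + (a / b) / 2 * b\<^sup>2"
    using F G ab by (intro add_mono mult_left_mono) auto
  also have "\<dots> = a * b" using ab by (simp add: power2_eq_square)
  finally show "\<bar>\<integral>x. f x * g x \<partial>M\<bar> \<le> a * b" .
qed

section \<open>Orthogonality and size of the score errors\<close>

locale asrw_design = perturbed_design D P pol Tr qs Lstar epsbar peps Ker Q L Ymax
  for D :: "('x, 'a) design" and P :: "('x, 'a) hist measure" and pol :: "('x, 'a) policy"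
    and Tr qs Lstar epsbar peps Ker Q L Ymax +
  assumes action_value: "is_action_value D P qs"
    and Hstar_square: "\<forall>t\<in>{1..horizon D}. square_integrable (sa_law D P t) (true_score pol Lstar t)"
begin

abbreviation "sa_alg t \<equiv> vimage_algebra (space P) (sa_at t) (sa_space D t)"

lemma sa_alg_subalgebra: "t \<in> {1..T} \<Longrightarrow> finite_measure_subalgebra P (sa_alg t)"
proof (unfold_locales, unfold subalgebra_def, intro conjI)
  assume t: "t \<in> {1..T}"
  show "space (sa_alg t) = space P" by simp
  show "sets (sa_alg t) \<subseteq> sets P"
    using measurable_space[OF sa_at_P[OF t]] measurable_sets[OF sa_at_P[OF t]]
    by (subst sets_vimage_algebra2) auto
qed

lemma sa_at_alg: "t \<in> {1..T} \<Longrightarrow> sa_at t \<in> sa_alg t \<rightarrow>\<^sub>M sa_space D t"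
  using measurable_space[OF sa_at_P] by (intro measurable_vimage_algebra1) auto

lemma qs_m: "t \<in> {1..T} \<Longrightarrow> qs t \<in> borel_measurable (sa_space D t)"
  using action_value by (auto simp: is_action_value_def)

lemma reward_integrable: "t \<in> {1..T} \<Longrightarrow> integrable P (reward_to_go D t)"
  by (rule integrable_const_bound[OF _ reward_m, where B = max_reward]) (use reward_bound in auto)

lemma AE_sa_law_iff:
  assumes t: "t \<in> {1..T}" and "Measurable.pred (sa_space D t) R"
  shows "(AE p in sa_law D P t. R p) \<longleftrightarrow> (AE z in P. R (sa_at t z))"
  unfolding sa_law_def using assms(2) by (subst AE_distr_iff[OF sa_at_P[OF t]]) auto

text \<open>Conditional expectation is monotone, so \<open>qs\<close> inherits the bound of the
  rewards and thereby meets the boundedness condition of the adjoint identity, like the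
  estimates.\<close>

lemma qs_bound:
  assumes t: "t \<in> {1..T}"
  shows "AE p in sa_law D P t. \<bar>qs t p\<bar> \<le> max_reward"
proof -
  interpret F: finite_measure_subalgebra P "sa_alg t" by (rule sa_alg_subalgebra[OF t])
  note [measurable] = qs_m[OF t]
  let ?ce = "real_cond_exp P (sa_alg t)"
  have c: "AE z in P. ?ce (\<lambda>_. c) z = c" for c
    by (rule F.real_cond_exp_F_meas) auto
  have up: "AE z in P. reward_to_go D t z \<le> max_reward" and lo: "AE z in P. - max_reward \<le> reward_to_go D t z"
    using reward_bound[OF t] by (auto elim!: eventually_mono)
  have "AE z in P. ?ce (reward_to_go D t) z \<le> ?ce (\<lambda>_. max_reward) z"
    by (rule F.real_cond_exp_mono[OF up reward_integrable[OF t]]) simp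
  moreover have "AE z in P. ?ce (\<lambda>_. - max_reward) z \<le> ?ce (reward_to_go D t) z"
    by (rule F.real_cond_exp_mono[OF lo _ reward_integrable[OF t]]) simp
  moreover have "AE z in P. qs t (sa_at t z) = ?ce (reward_to_go D t) z"
    using action_value t by (auto simp: is_action_value_def)
  ultimately have "AE z in P. \<bar>qs t (sa_at t z)\<bar> \<le> max_reward"
    using c[of max_reward] c[of "- max_reward"] by eventually_elim auto
  then show ?thesis by (subst AE_sa_law_iff[OF t]) auto
qed

text \<open>Tower property: against functions of history and action, the reward to go may be
  replaced by its conditional expectation. The products are integrable because rewards are
  bounded.\<close>

lemma action_value_intg:
  assumes t: "t \<in> {1..T}" and f: "f \<in> borel_measurable (sa_space D t)"
    and i: "integrable (sa_law D P t) f"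
  shows "(\<integral>z. f (sa_at t z) * reward_to_go D t z \<partial>P) = (\<integral>z. f (sa_at t z) * qs t (sa_at t z) \<partial>P)"
    and "integrable P (\<lambda>z. f (sa_at t z) * reward_to_go D t z)"
proof -
  interpret F: finite_measure_subalgebra P "sa_alg t" by (rule sa_alg_subalgebra[OF t])
  note [measurable] = qs_m[OF t] f reward_m[OF t] sa_at_P[OF t]
  have fF: "(\<lambda>z. f (sa_at t z)) \<in> borel_measurable (sa_alg t)"
    by (rule measurable_compose[OF sa_at_alg[OF t] f])
  have fi: "integrable P (\<lambda>z. f (sa_at t z))"
    using i unfolding sa_law_def by (subst (asm) integrable_distr_eq) auto
  show int: "integrable P (\<lambda>z. f (sa_at t z) * reward_to_go D t z)"
  proof (rule Bochner_Integration.integrable_bound)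
    show "integrable P (\<lambda>z. max_reward * f (sa_at t z))" using fi by simp
    show "AE z in P. norm (f (sa_at t z) * reward_to_go D t z) \<le> norm (max_reward * f (sa_at t z))"
      using reward_bound[OF t]
      by eventually_elim (auto simp: abs_mult mult.commute[of max_reward] intro!: mult_left_mono)
  qed measurable
  have "AE z in P. qs t (sa_at t z) = real_cond_exp P (sa_alg t) (reward_to_go D t) z"
    using action_value t by (auto simp: is_action_value_def)
  then have "(\<integral>z. f (sa_at t z) * qs t (sa_at t z) \<partial>P) =
      (\<integral>z. f (sa_at t z) * real_cond_exp P (sa_alg t) (reward_to_go D t) z \<partial>P)"
    by (intro integral_cong_AE) (auto elim!: eventually_mono)
  also have "\<dots> = (\<integral>z. f (sa_at t z) * reward_to_go D t z \<partial>P)"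
    by (rule F.real_cond_exp_intg(2)[OF int fF reward_m[OF t]])
  finally show "(\<integral>z. f (sa_at t z) * reward_to_go D t z \<partial>P) = (\<integral>z. f (sa_at t z) * qs t (sa_at t z) \<partial>P)" ..
qed

text \<open>Summed over folds, trajectories and times, these terms make up \<open>n\<close> times
  the difference between estimator and oracle.\<close>

definition score_error :: "nat \<Rightarrow> (('x, 'a) hist \<times> 'a \<Rightarrow> real) \<Rightarrow> (('x, 'a) hist \<times> 'a \<Rightarrow> real) \<Rightarrow>
    ('x, 'a) hist \<Rightarrow> real" where
  "score_error t q H z = asrw_score D t q (L t q) H z -
     discount D ^ (t - 1) * (L t (qs t) (sa_at t z) +
       Hstar t (sa_at t z) * (reward_to_go D t z - qs t (sa_at t z)))"

text \<open>What a favourable training sample guarantees, as a property of fixed functions. The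
  thresholds for \<open>q\<close> and for \<open>H\<close> are separate because their rates differ
  and the bias is governed by their product.\<close>

definition close_nuisance :: "nat \<Rightarrow> real \<Rightarrow> real \<Rightarrow> (('x, 'a) hist \<times> 'a \<Rightarrow> real) \<Rightarrow>
    (('x, 'a) hist \<times> 'a \<Rightarrow> real) \<Rightarrow> bool" where
  "close_nuisance t a b q H \<longleftrightarrow> q \<in> Q t \<and> H \<in> borel_measurable (sa_space D t) \<and>
     (AE p in sa_law D P t. \<bar>q p\<bar> \<le> max_reward) \<and>
     L2_norm (sa_law D P t) (\<lambda>p. q p - qs t p) \<le> ennreal a \<and>
     L2_norm (sa_law D P t) (\<lambda>p. L t q p - L t (qs t) p) \<le> ennreal a \<and>
     L2_norm (sa_law D P t) (\<lambda>p. H p - Hstar t p) \<le> ennreal b"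

lemma Q_m:
  assumes t: "t \<in> {1..T}" and q: "q \<in> Q t"
  shows "q \<in> borel_measurable (sa_space D t)" "L t q \<in> borel_measurable (sa_space D t)"
proof -
  have "is_backward_op D P Ker t (Q t) (L t)" using path t by (auto simp: convolutional_path_def)
  then show "q \<in> borel_measurable (sa_space D t)" "L t q \<in> borel_measurable (sa_space D t)"
    using q by (auto simp: is_backward_op_def)
qed

lemma qs_Q: "t \<in> {1..T} \<Longrightarrow> qs t \<in> Q t"
  using path by (auto simp: convolutional_path_def)

text \<open>Regrouped so that \<open>H - Hstar\<close> multiplies an almost surely bounded factor,
  and the other product pairs the fixed \<open>Hstar\<close> with the bounded error of
  \<open>q\<close>: no two unbounded errors meet.\<close>

lemma score_error_eq:
  "score_error t q H z = discount D ^ (t - 1) *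
    ((L t q (sa_at t z) - L t (qs t) (sa_at t z)) +
     (H (sa_at t z) - Hstar t (sa_at t z)) * (reward_to_go D t z - q (sa_at t z)) -
     Hstar t (sa_at t z) * (q (sa_at t z) - qs t (sa_at t z)))"
  by (simp add: score_error_def asrw_score_def algebra_simps)

text \<open>
  Adjointness of the two operators cancels the first-order errors in \<open>q\<close> and \<open>H\<close>: what is left of
  the mean is the product of the two errors.
\<close>

lemma score_error_mean:
  assumes t: "t \<in> {1..T}" and c: "close_nuisance t a b q H" and ab: "0 < a" "0 < b"
  shows "integrable P (score_error t q H)" and "\<bar>\<integral>z. score_error t q H z \<partial>P\<bar> \<le> a * b"
proof -
  let ?sa = "sa_law D P t"
  interpret sa: prob_space ?sa by (rule prob_sa_law[OF t])
  have q: "q \<in> Q t" and Hm: "H \<in> borel_measurable (sa_space D t)"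
    and B: "AE p in ?sa. \<bar>q p\<bar> \<le> max_reward"
    and na: "L2_norm ?sa (\<lambda>p. q p - qs t p) \<le> ennreal a"
    and nb: "L2_norm ?sa (\<lambda>p. H p - Hstar t p) \<le> ennreal b"
    using c by (auto simp: close_nuisance_def)
  note [measurable] = Q_m[OF t q] Q_m[OF t qs_Q[OF t]] Hm Hstar_m[OF t] sa_at_P[OF t] reward_m[OF t]
  note adj = backward_adjoint[OF t q B] and adjs = backward_adjoint[OF t qs_Q[OF t] qs_bound[OF t]]
  note nb' = L2_norm_leD[OF nb less_imp_le[OF ab(2)]]
  note prod = L2_product_bound[OF nb na ab(2,1)]
  have Hd: "integrable ?sa (\<lambda>p. H p - Hstar t p)"
    by (rule sa.square_integrable_imp_integrable[OF _ nb'(2)]) measurable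
  have Hdq: "integrable ?sa (\<lambda>p. (H p - Hstar t p) * q p)"
  proof (rule Bochner_Integration.integrable_bound)
    show "integrable ?sa (\<lambda>p. max_reward * (H p - Hstar t p))" using Hd by (rule integrable_mult_right)
    show "AE p in ?sa. norm ((H p - Hstar t p) * q p) \<le> norm (max_reward * (H p - Hstar t p))"
      using B by eventually_elim (auto simp: abs_mult mult.commute[of max_reward] intro!: mult_left_mono)
  qed measurable
  have Hdqs: "integrable ?sa (\<lambda>p. (H p - Hstar t p) * qs t p)"
    using Bochner_Integration.integrable_diff[OF Hdq prod(1)] by (simp add: algebra_simps)
  note av = action_value_intg[OF t _ Hd]
  have tr: "integrable P (\<lambda>z. f (sa_at t z)) \<and> (\<integral>z. f (sa_at t z) \<partial>P) = (\<integral>p. f p \<partial>?sa)"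
    if "integrable ?sa f" for f :: "_ \<Rightarrow> real"
  proof -
    have [measurable]: "f \<in> borel_measurable (sa_space D t)" using borel_measurable_integrable[OF that] by simp
    show ?thesis using that unfolding sa_law_def
      by (subst (asm) integrable_distr_eq) (auto simp: integral_distr)
  qed
  let ?c = "discount D ^ (t - 1)"
  have eq: "score_error t q H z = ?c * (L t q (sa_at t z) - L t (qs t) (sa_at t z) +
      (H (sa_at t z) - Hstar t (sa_at t z)) * reward_to_go D t z - (H (sa_at t z) - Hstar t (sa_at t z)) * q (sa_at t z)
      - (Hstar t (sa_at t z) * q (sa_at t z) - Hstar t (sa_at t z) * qs t (sa_at t z)))" for z
  proof -
    have "x - y + h * (g - u) - w * (u - s) = x - y + h * g - h * u - (w * u - w * s)" for x y h g u w s :: real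
      by (simp add: algebra_simps)
    then show ?thesis unfolding score_error_eq by simp
  qed
  have avi: "integrable P (\<lambda>z. (H (sa_at t z) - Hstar t (sa_at t z)) * reward_to_go D t z)"
    by (rule av(2)) measurable
  \<comment> \<open>The error \<open>H - Hstar\<close> is a function of history and action, so
    conditioning replaces the reward to go by \<open>qs\<close> and turns the residual into
    \<open>qs - q\<close>.\<close>
  have ave: "(\<integral>z. (H (sa_at t z) - Hstar t (sa_at t z)) * reward_to_go D t z \<partial>P) =
      (\<integral>p. (H p - Hstar t p) * qs t p \<partial>?sa)"
    using av(1) tr[OF Hdqs] by simp
  have ints: "integrable P (\<lambda>z. L t q (sa_at t z))" "integrable P (\<lambda>z. L t (qs t) (sa_at t z))"
    "integrable P (\<lambda>z. (H (sa_at t z) - Hstar t (sa_at t z)) * q (sa_at t z))"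
    "integrable P (\<lambda>z. Hstar t (sa_at t z) * q (sa_at t z))"
    "integrable P (\<lambda>z. Hstar t (sa_at t z) * qs t (sa_at t z))"
    using tr[OF adj(1)] tr[OF adjs(1)] tr[OF Hdq] tr[OF adj(3)] tr[OF adjs(3)] by auto
  show "integrable P (score_error t q H)"
    unfolding eq using ints avi by (intro integrable_mult_right Bochner_Integration.integrable_diff Bochner_Integration.integrable_add)
  have "(\<integral>z. score_error t q H z \<partial>P) = ?c *
      ((\<integral>z. L t q (sa_at t z) \<partial>P) - (\<integral>z. L t (qs t) (sa_at t z) \<partial>P) +
       (\<integral>z. (H (sa_at t z) - Hstar t (sa_at t z)) * reward_to_go D t z \<partial>P) -
       (\<integral>z. (H (sa_at t z) - Hstar t (sa_at t z)) * q (sa_at t z) \<partial>P) -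
       ((\<integral>z. Hstar t (sa_at t z) * q (sa_at t z) \<partial>P) - (\<integral>z. Hstar t (sa_at t z) * qs t (sa_at t z) \<partial>P)))"
    unfolding eq using ints avi
    by (simp only: integral_mult_right_zero Bochner_Integration.integral_diff Bochner_Integration.integral_add
        Bochner_Integration.integrable_diff Bochner_Integration.integrable_add)
  also have "\<dots> = ?c * ((\<integral>p. (H p - Hstar t p) * qs t p \<partial>?sa) - (\<integral>p. (H p - Hstar t p) * q p \<partial>?sa))"
    unfolding ave using tr[OF adj(1)] tr[OF adjs(1)] tr[OF Hdq] tr[OF adj(3)] tr[OF adjs(3)] adj(2) adjs(2)
    by simp
  also have "\<dots> = ?c * - (\<integral>p. (H p - Hstar t p) * (q p - qs t p) \<partial>?sa)"
    using Hdq Hdqs by (simp add: right_diff_distrib)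
  also have "\<bar>\<dots>\<bar> \<le> 1 * (b * a)"
    unfolding abs_mult abs_minus_cancel using discount prod(2)
    by (intro mult_mono) (auto intro: power_le_one)
  finally show "\<bar>\<integral>z. score_error t q H z \<partial>P\<bar> \<le> a * b" by (simp add: mult.commute)
qed

text \<open>The delicate term is \<open>Hstar * (q - qs)\<close>, whose first factor is unbounded.
  Its square is split at a level \<open>\<kappa>\<close> of \<open>Hstar\<^sup>2\<close>: below, the
  mean square error of \<open>q\<close> counts; above, the bound on \<open>q - qs\<close> and the
  small excess. As \<open>\<kappa>\<close> is chosen before \<open>q\<close> and \<open>H\<close>,
  the estimate is uniform in them.\<close>

lemma score_error_second_moment:
  assumes t: "t \<in> {1..T}" and eta: "0 < \<eta>"
  shows "\<forall>\<^sub>F r in at_right 0. \<forall>q H. close_nuisance t r r q H \<longrightarrow>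
    (\<integral>\<^sup>+z. ennreal ((score_error t q H z)\<^sup>2) \<partial>P) \<le> ennreal \<eta>"
proof -
  let ?sa = "sa_law D P t"
  have G0: "0 \<le> max_reward" by (rule max_reward_nonneg[OF t])
  \<comment> \<open>The square of \<open>2 * max_reward\<close>, which bounds both the residual
    \<open>reward_to_go - q\<close> and the error \<open>q - qs\<close>.\<close>
  define C where "C = 4 * max_reward\<^sup>2"
  have C: "0 \<le> C" by (simp add: C_def)
  have Hsq: "integrable ?sa (\<lambda>p. (Hstar t p)\<^sup>2)"
    using Hstar_square t by (auto simp: square_integrable_def)
  \<comment> \<open>The excess enters with the factor \<open>3 * C\<close>, so it costs at most
    \<open>\<eta> / 2\<close>; the other half is left for the terms of order
    \<open>r\<^sup>2\<close>. The \<open>+ 1\<close> covers \<open>C = 0\<close>.\<close>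
  have "0 < \<eta> / (6 * (C + 1))" using eta C by simp
  from integrable_excess_small[OF Hsq this] obtain \<kappa> where \<kappa>: "0 \<le> \<kappa>"
    "(\<integral>\<^sup>+p. ennreal (max 0 ((Hstar t p)\<^sup>2 - \<kappa>)) \<partial>?sa) < ennreal (\<eta> / (6 * (C + 1)))"
    by auto
  have "((\<lambda>r. 3 * (1 + C + \<kappa>) * r\<^sup>2) \<longlongrightarrow> 3 * (1 + C + \<kappa>) * 0\<^sup>2) (at_right (0::real))"
    by (intro tendsto_intros)
  then have "\<forall>\<^sub>F r in at_right 0. 3 * (1 + C + \<kappa>) * r\<^sup>2 < \<eta> / 2"
    using eta by (intro order_tendstoD(2)) auto
  then show ?thesis
    using eventually_at_right_less[of 0]
  proof eventually_elim
    case (elim r)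
    show ?case
    proof (intro allI impI)
      fix q H assume c: "close_nuisance t r r q H"
      have q: "q \<in> Q t" and Hm: "H \<in> borel_measurable (sa_space D t)"
        and B: "AE p in ?sa. \<bar>q p\<bar> \<le> max_reward"
        and n1: "L2_norm ?sa (\<lambda>p. q p - qs t p) \<le> ennreal r"
        and n2: "L2_norm ?sa (\<lambda>p. L t q p - L t (qs t) p) \<le> ennreal r"
        and n3: "L2_norm ?sa (\<lambda>p. H p - Hstar t p) \<le> ennreal r"
        using c by (auto simp: close_nuisance_def)
      note [measurable] = Q_m[OF t q] Q_m[OF t qs_Q[OF t]] Hm Hstar_m[OF t] sa_at_P[OF t] reward_m[OF t]
      have nn: "(\<integral>\<^sup>+p. ennreal ((f p)\<^sup>2) \<partial>?sa) \<le> ennreal (r\<^sup>2)" if "L2_norm ?sa f \<le> ennreal r" for f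
      proof -
        note l = L2_norm_leD[OF that less_imp_le[OF elim(2)]]
        show ?thesis using l by (subst nn_integral_eq_integral) (auto intro!: ennreal_leI)
      qed
      define d1 where "d1 = (\<lambda>p. ennreal ((q p - qs t p)\<^sup>2))"
      define d2 where "d2 = (\<lambda>p. ennreal ((L t q p - L t (qs t) p)\<^sup>2))"
      define d3 where "d3 = (\<lambda>p. ennreal ((H p - Hstar t p)\<^sup>2))"
      define ex where "ex = (\<lambda>p. ennreal (max 0 ((Hstar t p)\<^sup>2 - \<kappa>)))"
      have [measurable]: "d1 \<in> borel_measurable (sa_space D t)" "d2 \<in> borel_measurable (sa_space D t)"
        "d3 \<in> borel_measurable (sa_space D t)" "ex \<in> borel_measurable (sa_space D t)"
        unfolding d1_def d2_def d3_def ex_def by measurable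
      define g where "g = (\<lambda>p. 3 * (d2 p + (ennreal C * d3 p + (ennreal \<kappa> * d1 p + ennreal C * ex p))))"
      have [measurable]: "g \<in> borel_measurable (sa_space D t)" unfolding g_def by measurable
      have "(\<integral>\<^sup>+z. ennreal ((score_error t q H z)\<^sup>2) \<partial>P) \<le> (\<integral>\<^sup>+z. g (sa_at t z) \<partial>P)"
      proof (rule nn_integral_mono_AE)
        show "AE z in P. ennreal ((score_error t q H z)\<^sup>2) \<le> g (sa_at t z)"
          using reward_bound[OF t] AE_sa_at[OF t B] AE_sa_at[OF t qs_bound[OF t]]
        proof eventually_elim
          case (elim z)
          let ?p = "sa_at t z"
          define x y w where "x = L t q ?p - L t (qs t) ?p"
            and "y = (H ?p - Hstar t ?p) * (reward_to_go D t z - q ?p)"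
            and "w = Hstar t ?p * (q ?p - qs t ?p)"
          have "(score_error t q H z)\<^sup>2 = (discount D ^ (t - 1))\<^sup>2 * (x + y - w)\<^sup>2"
            unfolding score_error_eq x_def y_def w_def by (rule power_mult_distrib)
          also have "\<dots> \<le> 1 * (x + y - w)\<^sup>2"
            using discount by (intro mult_right_mono) (auto intro!: power_le_one)
          \<comment> \<open>The difference of the two sides is the sum of the squares of
            \<open>x - y\<close>, \<open>x + w\<close> and \<open>y + w\<close>.\<close>
          also have "\<dots> \<le> 3 * (x\<^sup>2 + (y\<^sup>2 + w\<^sup>2))"
            using sum_squares_ge_zero[of "x - y" "x + w"] zero_le_power2[of "y + w"]
            by (simp add: power2_eq_square algebra_simps)
          finally have 1: "(score_error t q H z)\<^sup>2 \<le> 3 * (x\<^sup>2 + (y\<^sup>2 + w\<^sup>2))" .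
          have "(reward_to_go D t z - q ?p)\<^sup>2 \<le> (2 * max_reward)\<^sup>2"
            using elim by (intro abs_le_square_iff[THEN iffD1]) auto
          then have 2: "y\<^sup>2 \<le> C * (H ?p - Hstar t ?p)\<^sup>2"
            unfolding y_def power_mult_distrib C_def
            by (subst mult.commute) (intro mult_right_mono, auto)
          have 3: "(q ?p - qs t ?p)\<^sup>2 \<le> C"
          proof -
            have "(q ?p - qs t ?p)\<^sup>2 \<le> (2 * max_reward)\<^sup>2"
              using elim by (intro abs_le_square_iff[THEN iffD1]) auto
            then show ?thesis by (simp add: C_def power_mult_distrib)
          qed
          have "w\<^sup>2 = (Hstar t ?p)\<^sup>2 * (q ?p - qs t ?p)\<^sup>2" by (simp add: w_def power_mult_distrib)
          also have "\<dots> \<le> (\<kappa> + max 0 ((Hstar t ?p)\<^sup>2 - \<kappa>)) * (q ?p - qs t ?p)\<^sup>2"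
            by (intro mult_right_mono) auto
          also have "\<dots> = \<kappa> * (q ?p - qs t ?p)\<^sup>2 + max 0 ((Hstar t ?p)\<^sup>2 - \<kappa>) * (q ?p - qs t ?p)\<^sup>2"
            by (rule distrib_right)
          also have "\<dots> \<le> \<kappa> * (q ?p - qs t ?p)\<^sup>2 + max 0 ((Hstar t ?p)\<^sup>2 - \<kappa>) * C"
            using 3 by (intro add_mono mult_left_mono order_refl) auto
          finally have 4: "w\<^sup>2 \<le> \<kappa> * (q ?p - qs t ?p)\<^sup>2 + C * max 0 ((Hstar t ?p)\<^sup>2 - \<kappa>)"
            by (simp add: mult.commute)
          note 1
          also have "3 * (x\<^sup>2 + (y\<^sup>2 + w\<^sup>2)) \<le> 3 * (x\<^sup>2 + (C * (H ?p - Hstar t ?p)\<^sup>2 +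
              (\<kappa> * (q ?p - qs t ?p)\<^sup>2 + C * max 0 ((Hstar t ?p)\<^sup>2 - \<kappa>))))"
            using 2 4 by (intro mult_left_mono add_mono order_refl) auto
          finally have "ennreal ((score_error t q H z)\<^sup>2) \<le> ennreal (3 * (x\<^sup>2 + (C * (H ?p - Hstar t ?p)\<^sup>2 +
              (\<kappa> * (q ?p - qs t ?p)\<^sup>2 + C * max 0 ((Hstar t ?p)\<^sup>2 - \<kappa>)))))"
            by (rule ennreal_leI)
          also have "\<dots> = g ?p"
            using C \<kappa>(1) unfolding g_def d1_def d2_def d3_def ex_def x_def
            by (simp add: ennreal_mult)
          finally show ?case .
        qed
      qed
      also have "\<dots> = (\<integral>\<^sup>+p. g p \<partial>?sa)"
        unfolding sa_law_def by (subst nn_integral_distr) auto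
      also have "\<dots> = 3 * ((\<integral>\<^sup>+p. d2 p \<partial>?sa) + (ennreal C * (\<integral>\<^sup>+p. d3 p \<partial>?sa) +
          (ennreal \<kappa> * (\<integral>\<^sup>+p. d1 p \<partial>?sa) + ennreal C * (\<integral>\<^sup>+p. ex p \<partial>?sa))))"
        unfolding g_def by (simp add: nn_integral_add nn_integral_cmult)
      also have "\<dots> \<le> 3 * (ennreal (r\<^sup>2) + (ennreal C * ennreal (r\<^sup>2) +
          (ennreal \<kappa> * ennreal (r\<^sup>2) + ennreal C * ennreal (\<eta> / (6 * (C + 1))))))"
        using nn[OF n1] nn[OF n2] nn[OF n3] \<kappa>(2) unfolding d1_def d2_def d3_def ex_def
        by (intro mult_left_mono add_mono) auto
      also have "\<dots> = ennreal (3 * (r\<^sup>2 + (C * r\<^sup>2 + (\<kappa> * r\<^sup>2 + C * (\<eta> / (6 * (C + 1)))))))"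
      proof -
        have "3 * (ennreal u + (ennreal C * ennreal u + (ennreal \<kappa> * ennreal u + ennreal C * ennreal v))) =
          ennreal (3 * (u + (C * u + (\<kappa> * u + C * v))))" if "0 \<le> u" "0 \<le> v" for u v
          using C \<kappa>(1) that by (simp add: ennreal_mult)
        from this[of "r\<^sup>2" "\<eta> / (6 * (C + 1))"] show ?thesis using C eta by simp
      qed
      also have "\<dots> \<le> ennreal \<eta>"
      proof (rule ennreal_leI)
        define e where "e = C * (\<eta> / (6 * (C + 1)))"
        have "e \<le> \<eta> / 6" unfolding e_def using C eta by (simp add: field_simps)
        moreover have "3 * (r\<^sup>2 + (C * r\<^sup>2 + (\<kappa> * r\<^sup>2 + e))) = 3 * (1 + C + \<kappa>) * r\<^sup>2 + 3 * e"
          by (simp add: algebra_simps)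
        ultimately show "3 * (r\<^sup>2 + (C * r\<^sup>2 + (\<kappa> * r\<^sup>2 + C * (\<eta> / (6 * (C + 1)))))) \<le> \<eta>"
          unfolding e_def[symmetric] using elim(1) by linarith
      qed
      finally show "(\<integral>\<^sup>+z. ennreal ((score_error t q H z)\<^sup>2) \<partial>P) \<le> ennreal \<eta>" .
    qed
  qed
qed

lemma close_nuisance_mono:
  assumes "close_nuisance t a b q H" "a \<le> c" "b \<le> c"
  shows "close_nuisance t c c q H"
  using assms unfolding close_nuisance_def by (auto intro: order_trans ennreal_leI)

text \<open>\<open>r\<close> is the small constant inside the stochastic order symbols,
  \<open>a\<close> and \<open>b\<close> are the deterministic rates. The means add up to at most
  \<open>T * r\<^sup>2 * a * b\<close> in modulus, so \<open>n\<close> times the square is at most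
  \<open>T\<^sup>2 * r ^ 4\<close>, and one \<open>r\<close> serves all \<open>n\<close> at
  once.\<close>

lemma sum_score_error_small:
  assumes eta: "0 < \<eta>"
  shows "\<forall>\<^sub>F r in at_right 0. \<forall>n q H a b. (\<forall>t\<in>{1..T}. close_nuisance t (r * a) (r * b) (q t) (H t)) \<longrightarrow>
    0 < a \<longrightarrow> a \<le> 1 \<longrightarrow> 0 < b \<longrightarrow> b \<le> 1 \<longrightarrow> real n * (a * b)\<^sup>2 \<le> 1 \<longrightarrow>
    (\<integral>\<^sup>+z. ennreal ((\<Sum>t = 1..T. score_error t (q t) (H t) z)\<^sup>2) \<partial>P) \<le> ennreal \<eta> \<and>
    real n * (\<integral>z. (\<Sum>t = 1..T. score_error t (q t) (H t) z) \<partial>P)\<^sup>2 \<le> \<eta>"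
proof -
  \<comment> \<open>One factor of the horizon comes from Cauchy-Schwarz for the sum over times, one
    from adding the bounds; the \<open>+ 1\<close> covers horizon 0.\<close>
  define \<eta>' where "\<eta>' = \<eta> / (real T + 1)\<^sup>2"
  have eta': "0 < \<eta>'" "real T * (real T * \<eta>') \<le> \<eta>"
  proof -
    show "0 < \<eta>'" using eta by (simp add: \<eta>'_def)
    have "real T * (real T * \<eta>') \<le> (real T + 1)\<^sup>2 * \<eta>'"
      using \<open>0 < \<eta>'\<close> unfolding mult.assoc[symmetric] power2_eq_square by (intro mult_right_mono mult_mono) auto
    also have "\<dots> = \<eta>" by (simp add: \<eta>'_def)
    finally show "real T * (real T * \<eta>') \<le> \<eta>" .
  qed
  have "\<forall>\<^sub>F r in at_right 0. \<forall>t\<in>{1..T}. \<forall>q H. close_nuisance t r r q H \<longrightarrow>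
      (\<integral>\<^sup>+z. ennreal ((score_error t q H z)\<^sup>2) \<partial>P) \<le> ennreal \<eta>'"
    using score_error_second_moment[OF _ eta'(1)] by (intro eventually_ball_finite) auto
  moreover have "\<forall>\<^sub>F r in at_right (0::real). (real T)\<^sup>2 * r ^ 4 < \<eta>"
  proof -
    have "((\<lambda>r. (real T)\<^sup>2 * r ^ 4) \<longlongrightarrow> (real T)\<^sup>2 * 0 ^ 4) (at_right (0::real))" by (intro tendsto_intros)
    then show ?thesis using eta by (intro order_tendstoD(2)) auto
  qed
  ultimately show ?thesis
    using eventually_at_right_less[of 0]
  proof eventually_elim
    case (elim r)
    show ?case
    proof (intro allI impI conjI)
      fix n :: nat and q H :: "nat \<Rightarrow> ('x, 'a) hist \<times> 'a \<Rightarrow> real" and a b :: real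
      assume c: "\<forall>t\<in>{1..T}. close_nuisance t (r * a) (r * b) (q t) (H t)"
        and ab: "0 < a" "a \<le> 1" "0 < b" "b \<le> 1" "real n * (a * b)\<^sup>2 \<le> 1"
      let ?E = "\<lambda>z. \<Sum>t = 1..T. score_error t (q t) (H t) z"
      have c': "close_nuisance t r r (q t) (H t)" if "t \<in> {1..T}" for t
        using c that ab elim(3) by (auto intro!: close_nuisance_mono mult_right_le_one_le simp: mult_left_le)
      have mean: "integrable P (score_error t (q t) (H t)) \<and> \<bar>\<integral>z. score_error t (q t) (H t) z \<partial>P\<bar> \<le> (r * a) * (r * b)"
        if "t \<in> {1..T}" for t
        using score_error_mean[OF that, of "r * a" "r * b" "q t" "H t"] c that ab elim(3) by auto
      have m [measurable]: "score_error t (q t) (H t) \<in> borel_measurable P" if "t \<in> {1..T}" for t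
        using mean[OF that] by auto
      have "(\<integral>\<^sup>+z. ennreal ((?E z)\<^sup>2) \<partial>P) \<le>
          (\<integral>\<^sup>+z. ennreal (real T) * (\<Sum>t = 1..T. ennreal ((score_error t (q t) (H t) z)\<^sup>2)) \<partial>P)"
      proof (rule nn_integral_mono)
        fix z
        have "(?E z)\<^sup>2 \<le> (\<Sum>t = 1..T. (score_error t (q t) (H t) z)\<^sup>2) * card {1..T}"
          by (rule sum_squared_le_sum_of_squares)
        then show "ennreal ((?E z)\<^sup>2) \<le>
            ennreal (real T) * (\<Sum>t = 1..T. ennreal ((score_error t (q t) (H t) z)\<^sup>2))"
          by (subst sum_ennreal) (auto simp: ennreal_mult[symmetric] mult.commute sum_nonneg intro!: ennreal_leI)
      qed
      also have "\<dots> = ennreal (real T) * (\<Sum>t = 1..T. \<integral>\<^sup>+z. ennreal ((score_error t (q t) (H t) z)\<^sup>2) \<partial>P)"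
      proof -
        have mm: "(\<lambda>z. ennreal ((score_error t (q t) (H t) z)\<^sup>2)) \<in> borel_measurable P" if "t \<in> {1..T}" for t
          using m[OF that] by measurable
        show ?thesis
          by (subst nn_integral_cmult, rule borel_measurable_sum, erule mm, subst nn_integral_sum, erule mm, rule refl)
      qed
      also have "\<dots> \<le> ennreal (real T) * (\<Sum>t = 1..T. ennreal \<eta>')"
        using elim(1) c' by (intro mult_left_mono sum_mono) auto
      also have "\<dots> = ennreal (real T * (real T * \<eta>'))"
        using eta' by (simp add: ennreal_mult ennreal_of_nat_eq_real_of_nat)
      also have "\<dots> \<le> ennreal \<eta>" using eta' by (intro ennreal_leI)
      finally show "(\<integral>\<^sup>+z. ennreal ((?E z)\<^sup>2) \<partial>P) \<le> ennreal \<eta>" .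
      have "\<bar>\<integral>z. ?E z \<partial>P\<bar> =
          \<bar>\<Sum>t = 1..T. \<integral>z. score_error t (q t) (H t) z \<partial>P\<bar>"
        using mean by (subst Bochner_Integration.integral_sum) auto
      also have "\<dots> \<le> (\<Sum>t = 1..T. (r * a) * (r * b))"
        using mean by (intro order_trans[OF sum_abs] sum_mono) auto
      also have "\<dots> = real T * (r\<^sup>2 * (a * b))" by (simp add: power2_eq_square mult_ac)
      finally have "\<bar>\<integral>z. ?E z \<partial>P\<bar>\<^sup>2 \<le> (real T * (r\<^sup>2 * (a * b)))\<^sup>2"
        by (intro power_mono) auto
      then have "real n * (\<integral>z. ?E z \<partial>P)\<^sup>2 \<le> real n * (real T * (r\<^sup>2 * (a * b)))\<^sup>2"
        by (intro mult_left_mono) auto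
      also have "\<dots> = ((real T)\<^sup>2 * r ^ 4) * (real n * (a * b)\<^sup>2)"
        by (simp add: power_mult_distrib mult_ac)
      also have "\<dots> \<le> ((real T)\<^sup>2 * r ^ 4) * 1" using ab by (intro mult_left_mono) auto
      also have "\<dots> \<le> \<eta>" using elim(2) by simp
      finally show "real n * (\<integral>z. ?E z \<partial>P)\<^sup>2 \<le> \<eta>" .
    qed
  qed
qed

section \<open>The remainder on one scoring fold\<close>

lemma score_error_joint_m:
  assumes t: "t \<in> {1..T}"
    and m: "(\<lambda>(d, p). qf d p) \<in> borel_measurable (X \<Otimes>\<^sub>M sa_space D t)"
      "(\<lambda>(d, p). L t (qf d) p) \<in> borel_measurable (X \<Otimes>\<^sub>M sa_space D t)"
      "(\<lambda>(d, p). Hf d p) \<in> borel_measurable (X \<Otimes>\<^sub>M sa_space D t)"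
  shows "(\<lambda>(d, z). score_error t (qf d) (Hf d) z) \<in> borel_measurable (X \<Otimes>\<^sub>M P)"
proof -
  note [measurable] = Q_m[OF t qs_Q[OF t]] Hstar_m[OF t] sa_at_P[OF t] reward_m[OF t]
  have j: "(\<lambda>x. (fst x, sa_at t (snd x))) \<in> X \<Otimes>\<^sub>M P \<rightarrow>\<^sub>M X \<Otimes>\<^sub>M sa_space D t" by measurable
  have [measurable]: "(\<lambda>x. qf (fst x) (sa_at t (snd x))) \<in> borel_measurable (X \<Otimes>\<^sub>M P)"
    "(\<lambda>x. L t (qf (fst x)) (sa_at t (snd x))) \<in> borel_measurable (X \<Otimes>\<^sub>M P)"
    "(\<lambda>x. Hf (fst x) (sa_at t (snd x))) \<in> borel_measurable (X \<Otimes>\<^sub>M P)"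
    using measurable_compose[OF j m(1)] measurable_compose[OF j m(2)] measurable_compose[OF j m(3)] by simp_all
  show ?thesis unfolding score_error_eq split_beta' by measurable
qed

text \<open>Outside three events, one for each norm exceeding \<open>r\<close> times its rate, the
  training sample is favourable and the conditional Chebyshev bound applies. The tolerance
  \<open>\<eta>\<close> fixes \<open>r\<close>, and only then does \<open>n\<close> grow.\<close>

lemma fold_remainder:
  fixes N :: "'n measure" and Zs :: "nat \<Rightarrow> 'n \<Rightarrow> ('x, 'a) hist"
    and qh Hh :: "nat \<Rightarrow> nat \<Rightarrow> (nat \<Rightarrow> ('x, 'a) hist) \<Rightarrow> ('x, 'a) hist \<times> 'a \<Rightarrow> real"
  assumes N: "prob_space N"
    and ind: "prob_space.indep_vars N (\<lambda>_. traj_space D) Zs UNIV"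
    and law: "\<And>i. distr N (traj_space D) (Zs i) = P"
    and I: "\<And>n. I n \<subseteq> {..<n}"
    and m: "\<And>n t. t \<in> {1..T} \<Longrightarrow>
      (\<lambda>(d, p). qh n t d p) \<in> borel_measurable ((\<Pi>\<^sub>M i\<in>{..<n} - I n. traj_space D) \<Otimes>\<^sub>M sa_space D t) \<and>
      (\<lambda>(d, p). L t (qh n t d) p) \<in> borel_measurable ((\<Pi>\<^sub>M i\<in>{..<n} - I n. traj_space D) \<Otimes>\<^sub>M sa_space D t) \<and>
      (\<lambda>(d, p). Hh n t d p) \<in> borel_measurable ((\<Pi>\<^sub>M i\<in>{..<n} - I n. traj_space D) \<Otimes>\<^sub>M sa_space D t)"
    and cls: "\<And>n t. t \<in> {1..T} \<Longrightarrow> AE w in N. qh n t (training n (I n) (\<lambda>i. Zs i w)) \<in> Q t \<and>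
      Hh n t (training n (I n) (\<lambda>i. Zs i w)) \<in> borel_measurable (sa_space D t)"
    and bd: "\<And>n t. t \<in> {1..T} \<Longrightarrow> AE w in N. AE s in hist_law D P t.
      \<forall>a\<in>act_set D t. \<bar>qh n t (training n (I n) (\<lambda>i. Zs i w)) (s, a)\<bar> \<le> max_reward"
    and alpha: "0 \<le> \<alpha>" "0 \<le> \<beta>" "\<alpha> + \<beta> \<ge> 1 / 2"
    and rq: "little_o_p N (\<lambda>n w. SUP t\<in>{1..T}. L2_norm (sa_law D P t)
         (\<lambda>p. qh n t (training n (I n) (\<lambda>i. Zs i w)) p - qs t p)) (\<lambda>n. real n powr (- \<alpha>))"
    and rL: "little_o_p N (\<lambda>n w. SUP t\<in>{1..T}. L2_norm (sa_law D P t)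
         (\<lambda>p. L t (qh n t (training n (I n) (\<lambda>i. Zs i w))) p - L t (qs t) p)) (\<lambda>n. real n powr (- \<alpha>))"
    and rH: "little_o_p N (\<lambda>n w. SUP t\<in>{1..T}. L2_norm (sa_law D P t)
         (\<lambda>p. Hh n t (training n (I n) (\<lambda>i. Zs i w)) p - Hstar t p)) (\<lambda>n. real n powr (- \<beta>))"
  shows "tendsto_in_prob N (\<lambda>n w. (\<Sum>i\<in>I n. \<Sum>t = 1..T.
    score_error t (qh n t (training n (I n) (\<lambda>i. Zs i w))) (Hh n t (training n (I n) (\<lambda>i. Zs i w))) (Zs i w)) / sqrt n) 0"
proof -
  interpret N: prob_space N by fact
  define S where "S = traj_space D"
  have sPS: "sets P = sets S" by (simp add: S_def sets_P)
  have Zm [measurable]: "Zs i \<in> N \<rightarrow>\<^sub>M S" for i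
    using ind unfolding N.indep_vars_def S_def by auto
  define d where "d = (\<lambda>n w. training n (I n) (\<lambda>i. Zs i w))"
  have d_m [measurable]: "d n \<in> N \<rightarrow>\<^sub>M (\<Pi>\<^sub>M i\<in>{..<n} - I n. S)" for n
    unfolding d_def training_def by measurable
  define G where "G = (\<lambda>n (d, z). \<Sum>t = 1..T. score_error t (qh n t d) (Hh n t d) z)"
  \<comment> \<open>Freezing the training sample by Fubini needs joint measurability. As
    \<open>L t\<close> is an arbitrary map on functions, the dependence of
    \<open>L t (qh n t d)\<close> on \<open>d\<close> is covered by its own part of
    \<open>m\<close>.\<close>
  have G_m [measurable]: "G n \<in> borel_measurable ((\<Pi>\<^sub>M i\<in>{..<n} - I n. S) \<Otimes>\<^sub>M S)" for n
  proof -
    have "G n \<in> borel_measurable ((\<Pi>\<^sub>M i\<in>{..<n} - I n. S) \<Otimes>\<^sub>M P)"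
      unfolding G_def split_beta'
    proof (rule borel_measurable_sum)
      fix t assume "t \<in> {1..T}"
      then show "(\<lambda>x. score_error t (qh n t (fst x)) (Hh n t (fst x)) (snd x))
          \<in> borel_measurable ((\<Pi>\<^sub>M i\<in>{..<n} - I n. S) \<Otimes>\<^sub>M P)"
        using score_error_joint_m[of t "qh n t" "\<Pi>\<^sub>M i\<in>{..<n} - I n. S" "Hh n t"] m[of t n]
        by (simp add: split_beta' S_def)
    qed
    then show ?thesis using sPS by (simp cong: measurable_cong_sets sets_pair_measure_cong)
  qed
  define R where "R = (\<lambda>n w. (\<Sum>i\<in>I n. G n (d n w, Zs i w)) / sqrt n)"
  have R_m [measurable]: "R n \<in> borel_measurable N" for n unfolding R_def by measurable
  define good where "good = (\<lambda>\<eta> n w. (\<integral>\<^sup>+z. ennreal ((G n (d n w, z))\<^sup>2) \<partial>P) \<le> ennreal \<eta> \<and>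
      real n * (\<integral>z. G n (d n w, z) \<partial>P)\<^sup>2 \<le> \<eta>)"
  define bad where "bad = (\<lambda>\<eta> n. N.prob {w \<in> space N. \<not> good \<eta> n w})"
  define W1 where "W1 = (\<lambda>n w. SUP t\<in>{1..T}. L2_norm (sa_law D P t) (\<lambda>p. qh n t (d n w) p - qs t p))"
  define W2 where "W2 = (\<lambda>n w. SUP t\<in>{1..T}. L2_norm (sa_law D P t) (\<lambda>p. L t (qh n t (d n w)) p - L t (qs t) p))"
  define W3 where "W3 = (\<lambda>n w. SUP t\<in>{1..T}. L2_norm (sa_law D P t) (\<lambda>p. Hh n t (d n w) p - Hstar t p))"
  have W: "little_o_p N W1 (\<lambda>n. real n powr (- \<alpha>))" "little_o_p N W2 (\<lambda>n. real n powr (- \<alpha>))"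
    "little_o_p N W3 (\<lambda>n. real n powr (- \<beta>))"
    using rq rL rH by (simp_all add: W1_def W2_def W3_def d_def)
  then have [measurable]: "W1 n \<in> borel_measurable N" "W2 n \<in> borel_measurable N" "W3 n \<in> borel_measurable N" for n
    by (auto simp: little_o_p_def)
  have bad: "bad \<eta> \<longlonglongrightarrow> 0" if eta: "0 < \<eta>" for \<eta>
  proof -
    note eventually_conj[OF sum_score_error_small[OF eta] eventually_at_right_less[of 0]]
    then obtain r where r: "0 < r" and small: "\<And>n q H a b. (\<forall>t\<in>{1..T}. close_nuisance t (r * a) (r * b) (q t) (H t)) \<Longrightarrow>
        0 < a \<Longrightarrow> a \<le> 1 \<Longrightarrow> 0 < b \<Longrightarrow> b \<le> 1 \<Longrightarrow> real n * (a * b)\<^sup>2 \<le> 1 \<Longrightarrow>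
        (\<integral>\<^sup>+z. ennreal ((\<Sum>t = 1..T. score_error t (q t) (H t) z)\<^sup>2) \<partial>P) \<le> ennreal \<eta> \<and>
        real n * (\<integral>z. (\<Sum>t = 1..T. score_error t (q t) (H t) z) \<partial>P)\<^sup>2 \<le> \<eta>"
      using eventually_happens'[OF trivial_limit_at_right_real] by blast
    let ?A1 = "\<lambda>n. {w \<in> space N. W1 n w > ennreal (r * real n powr (- \<alpha>))}"
    let ?A2 = "\<lambda>n. {w \<in> space N. W2 n w > ennreal (r * real n powr (- \<alpha>))}"
    let ?A3 = "\<lambda>n. {w \<in> space N. W3 n w > ennreal (r * real n powr (- \<beta>))}"
    have lim: "(\<lambda>n. N.prob (?A1 n) + N.prob (?A2 n) + N.prob (?A3 n)) \<longlonglongrightarrow> 0"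
      using W r unfolding little_o_p_def by (intro tendsto_add_zero) auto
    show ?thesis
    proof (rule Lim_null_comparison[OF _ lim])
      show "\<forall>\<^sub>F n in sequentially. norm (bad \<eta> n) \<le> N.prob (?A1 n) + N.prob (?A2 n) + N.prob (?A3 n)"
        \<comment> \<open>At \<open>n = 0\<close> both rates are 0, since
          \<open>0 powr x = 0\<close>; they are positive only from \<open>n = 1\<close> on.\<close>
        using eventually_gt_at_top[of 0]
      proof eventually_elim
        case (elim n)
        define a b where "a = real n powr (- \<alpha>)" and "b = real n powr (- \<beta>)"
        have ab: "0 < a" "a \<le> 1" "0 < b" "b \<le> 1" "real n * (a * b)\<^sup>2 \<le> 1"
        proof -
          show "0 < a" "a \<le> 1" "0 < b" "b \<le> 1"
            using elim alpha powr_mono[of "- \<alpha>" 0 "real n"] powr_mono[of "- \<beta>" 0 "real n"]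
            by (auto simp: a_def b_def)
          have "a * b = real n powr (- (\<alpha> + \<beta>))" using elim by (simp add: a_def b_def powr_add[symmetric])
          also have "\<dots> \<le> real n powr (- (1 / 2))" using elim alpha by (intro powr_mono) auto
          finally have "(a * b)\<^sup>2 \<le> (real n powr (- (1 / 2)))\<^sup>2"
            using \<open>0 < a\<close> \<open>0 < b\<close> by (intro power_mono) auto
          also have "\<dots> = 1 / real n"
            using elim by (simp add: powr_minus powr_half_sqrt power_inverse inverse_eq_divide power_divide)
          finally show "real n * (a * b)\<^sup>2 \<le> 1" using elim by (simp add: field_simps)
        qed
        have "AE w in N. \<forall>t\<in>{1..T}. qh n t (d n w) \<in> Q t \<and> Hh n t (d n w) \<in> borel_measurable (sa_space D t) \<and>
            (AE s in hist_law D P t. \<forall>a\<in>act_set D t. \<bar>qh n t (d n w) (s, a)\<bar> \<le> max_reward)"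
          using cls bd unfolding d_def by (intro AE_finite_allI) (auto intro: AE_conjI)
        \<comment> \<open>Class membership and the bound on the estimates hold for almost every
          sample, so the three events cover the bad event only up to a null set.\<close>
        then have ae: "AE w in N. w \<in> {w \<in> space N. \<not> good \<eta> n w} \<longrightarrow> w \<in> (?A1 n \<union> ?A2 n) \<union> ?A3 n"
        proof (rule AE_mp, intro AE_I2 impI)
          fix w assume w: "w \<in> space N"
            and c: "\<forall>t\<in>{1..T}. qh n t (d n w) \<in> Q t \<and> Hh n t (d n w) \<in> borel_measurable (sa_space D t) \<and>
              (AE s in hist_law D P t. \<forall>a\<in>act_set D t. \<bar>qh n t (d n w) (s, a)\<bar> \<le> max_reward)"
            and b: "w \<in> {w \<in> space N. \<not> good \<eta> n w}"
          show "w \<in> (?A1 n \<union> ?A2 n) \<union> ?A3 n"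
          proof (rule ccontr)
            assume "w \<notin> (?A1 n \<union> ?A2 n) \<union> ?A3 n"
            then have le: "W1 n w \<le> ennreal (r * a)" "W2 n w \<le> ennreal (r * a)" "W3 n w \<le> ennreal (r * b)"
              using w by (auto simp: a_def b_def not_less)
            have "close_nuisance t (r * a) (r * b) (qh n t (d n w)) (Hh n t (d n w))" if t: "t \<in> {1..T}" for t
              unfolding close_nuisance_def
            proof (intro conjI)
              show q: "qh n t (d n w) \<in> Q t" "Hh n t (d n w) \<in> borel_measurable (sa_space D t)" using c t by auto
              note [measurable] = Q_m[OF t q(1)] pol_m[OF t]
              have "AE p in base_law t. \<bar>qh n t (d n w) p\<bar> \<le> max_reward"
              proof (rule AE_hist_act[OF t])
                have "AE s in hist_law D P t. \<forall>a\<in>act_set D t. \<bar>qh n t (d n w) (s, a)\<bar> \<le> max_reward" using c t by auto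
                then show "AE s in hist_law D P t. AE a in act_space D t. \<bar>qh n t (d n w) (s, a)\<bar> \<le> max_reward"
                  by (rule AE_mp, intro AE_I2 impI) (use space_act[of t] in auto)
              qed measurable
              then show "AE p in sa_law D P t. \<bar>qh n t (d n w) p\<bar> \<le> max_reward"
                unfolding sa_law_density[OF t] by (subst AE_density) (auto elim: eventually_mono)
              show "L2_norm (sa_law D P t) (\<lambda>p. qh n t (d n w) p - qs t p) \<le> ennreal (r * a)"
                using le(1) t unfolding W1_def by (meson SUP_upper order_trans)
              show "L2_norm (sa_law D P t) (\<lambda>p. L t (qh n t (d n w)) p - L t (qs t) p) \<le> ennreal (r * a)"
                using le(2) t unfolding W2_def by (meson SUP_upper order_trans)
              show "L2_norm (sa_law D P t) (\<lambda>p. Hh n t (d n w) p - Hstar t p) \<le> ennreal (r * b)"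
                using le(3) t unfolding W3_def by (meson SUP_upper order_trans)
            qed
            then have "good \<eta> n w"
              using small[of a b "\<lambda>t. qh n t (d n w)" "\<lambda>t. Hh n t (d n w)" n] ab by (simp add: good_def G_def)
            with b show False by simp
          qed
        qed
        have "bad \<eta> n \<le> N.prob ((?A1 n \<union> ?A2 n) \<union> ?A3 n)"
          unfolding bad_def by (rule N.finite_measure_mono_AE[OF ae]) measurable
        also have "\<dots> \<le> N.prob (?A1 n \<union> ?A2 n) + N.prob (?A3 n)" by (intro measure_Un_le) measurable
        also have "\<dots> \<le> N.prob (?A1 n) + N.prob (?A2 n) + N.prob (?A3 n)"
          by (intro add_right_mono measure_Un_le) measurable
        finally show ?case by (simp add: bad_def)
      qed
    qed
  qed
  have "tendsto_in_prob N R 0"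
    unfolding tendsto_in_prob_def
  proof (intro conjI allI impI)
    fix \<delta> :: real assume \<delta>: "0 < \<delta>"
    show "(\<lambda>n. N.prob {w \<in> space N. \<bar>R n w - 0\<bar> > \<delta>}) \<longlonglongrightarrow> 0"
    proof (rule tendstoI)
      fix x :: real assume x: "0 < x"
      \<comment> \<open>Makes the Chebyshev term equal to \<open>x / 2\<close>; the other half goes
        to the probability of an unfavourable training sample.\<close>
      define \<eta> where "\<eta> = x * \<delta>\<^sup>2 / 4"
      have eta: "0 < \<eta>" "2 * \<eta> / \<delta>\<^sup>2 = x / 2" using x \<delta> by (auto simp: \<eta>_def)
      have "\<forall>\<^sub>F n in sequentially. bad \<eta> n < x / 2"
        using bad[OF eta(1)] x by (intro order_tendstoD(2)) auto
      then show "\<forall>\<^sub>F n in sequentially. dist (N.prob {w \<in> space N. \<bar>R n w - 0\<bar> > \<delta>}) 0 < x"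
        using eventually_gt_at_top[of 0]
      proof eventually_elim
        case (elim n)
        have Ic: "finite (I n)" "I n \<inter> ({..<n} - I n) = {}" "card (I n) \<le> n"
          using I[of n] card_mono[of "{..<n}" "I n"] by (auto intro: finite_subset)
        have "{w \<in> space N. \<bar>R n w - 0\<bar> > \<delta>} = {w \<in> space N. \<delta> * sqrt n < \<bar>\<Sum>i\<in>I n. G n (d n w, Zs i w)\<bar>}"
          using elim by (auto simp: R_def abs_divide field_simps)
        also have "N.prob \<dots> \<le> bad \<eta> n + 2 * \<eta> / \<delta>\<^sup>2"
          unfolding bad_def good_def d_def training_def
          by (rule N.cond_chebyshev[OF ind[folded S_def] law[folded S_def] Ic elim(2) G_m eta(1) \<delta>])
        finally show ?case using elim eta by simp
      qed
    qed
  qed (rule R_m)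
  then show ?thesis by (simp add: R_def G_def d_def)
qed

end

section \<open>From the fold remainders to the limit law\<close>

lemma sqrt_mult_inverse: "sqrt (real n) * (1 / real n * x) = x / sqrt (real n)"
proof -
  \<comment> \<open>At \<open>n = 0\<close> both sides are 0, as division by zero gives 0.\<close>
  have "sqrt (real n) * (1 / real n) = 1 / sqrt (real n)"
    by (cases "n = 0") (simp_all add: field_simps)
  then show ?thesis by (metis mult.assoc mult.commute mult_1 times_divide_eq_right)
qed

context asrw_design
begin

lemma asrw_oracle_influence:
  "asrw_oracle D L qs Hstar n z = 1 / real n * (\<Sum>i<n. influence D L qs Hstar (z i))"
proof -
  have "asrw_oracle D L qs Hstar n z = 1 / real n * (\<Sum>t = 1..T. \<Sum>i<n. discount D ^ (t - 1) *
      (L t (qs t) (sa_at t (z i)) + Hstar t (sa_at t (z i)) * (reward_to_go D t (z i) - qs t (sa_at t (z i)))))"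
    unfolding asrw_oracle_def by (rule sum_distrib_left[symmetric])
  then show ?thesis unfolding influence_def by (subst sum.swap) simp
qed

text \<open>The folds partition the sample, so the oracle average can be grouped by folds too and
  subtracted term by term.\<close>

lemma estimator_minus_oracle:
  assumes "disjoint_family_on I {..<K}" and U: "(\<Union>k<K. I k) = {..<n}"
  shows "sqrt n * (asrw_estimator D L K I qh Hh n z - asrw_oracle D L qs Hstar n z) =
    (\<Sum>k<K. (\<Sum>i\<in>I k. \<Sum>t = 1..T.
      score_error t (qh k t (training n (I k) z)) (Hh k t (training n (I k) z)) (z i)) / sqrt n)"
proof -
  have fin: "finite (I k)" if "k < K" for k
    using U that finite_subset[of "I k" "{..<n}"] by blast
  have "(\<Sum>i<n. influence D L qs Hstar (z i)) = (\<Sum>k<K. \<Sum>i\<in>I k. influence D L qs Hstar (z i))"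
    unfolding U[symmetric] using assms(1) fin
    by (intro sum.UNION_disjoint) (auto simp: disjoint_family_on_def)
  then have "asrw_estimator D L K I qh Hh n z - asrw_oracle D L qs Hstar n z = 1 / real n *
      (\<Sum>k<K. \<Sum>i\<in>I k. \<Sum>t = 1..T.
        score_error t (qh k t (training n (I k) z)) (Hh k t (training n (I k) z)) (z i))"
    unfolding asrw_oracle_influence asrw_estimator_def Let_def influence_def score_error_def
    by (simp only: right_diff_distrib sum_subtractf)
  then show ?thesis by (simp only: sqrt_mult_inverse sum_divide_distrib)
qed

text \<open>\<open>est\<close> is any sequence asymptotically equivalent to the oracle. The oracle
  is an i.i.d. average of influence values with mean \<open>Theta\<close>, so the limit theorem with
  remainder applies after centring.\<close>

lemma asrw_asymptotic_normality:
  fixes N :: "'n measure" and Zs :: "nat \<Rightarrow> 'n \<Rightarrow> ('x, 'a) hist"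
  assumes N: "prob_space N"
    and ind: "prob_space.indep_vars N (\<lambda>_. traj_space D) Zs UNIV"
    and law: "\<And>i. distr N (traj_space D) (Zs i) = P"
    and sq: "square_integrable P (influence D L qs Hstar)"
    and rem: "tendsto_in_prob N (\<lambda>n w. sqrt n * (est n w - asrw_oracle D L qs Hstar n (\<lambda>i. Zs i w))) 0"
  shows "weak_conv_m (\<lambda>n. distr N borel (\<lambda>w. sqrt n * (est n w - Theta)))
    (normal_law 0 (variance (influence D L qs Hstar)))"
proof -
  interpret N: prob_space N by fact
  let ?\<phi> = "influence D L qs Hstar"
  have mean: "(\<integral>z. ?\<phi> z \<partial>P) = Theta" and \<phi>i: "integrable P ?\<phi>"
    using influence_mean[OF qs_bound] by auto
  have \<phi>2: "integrable P (\<lambda>z. (?\<phi> z)\<^sup>2)" and \<phi>m: "?\<phi> \<in> borel_measurable P"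
    using sq by (auto simp: square_integrable_def)
  have \<phi>S [measurable]: "?\<phi> \<in> borel_measurable (traj_space D)"
    using \<phi>m by (simp cong: measurable_cong_sets add: sets_P)
  have Zm [measurable]: "Zs i \<in> N \<rightarrow>\<^sub>M traj_space D" for i
    using ind unfolding N.indep_vars_def by auto
  define X where "X = (\<lambda>i w. ?\<phi> (Zs i w) - Theta)"
  have sqd: "integrable P (\<lambda>z. (?\<phi> z - Theta)\<^sup>2)"
    unfolding power2_diff using \<phi>i \<phi>2 by auto
  have X: "weak_conv_m (\<lambda>n. distr N borel (\<lambda>w. (\<Sum>i<n. X i w) / sqrt n +
       sqrt n * (est n w - asrw_oracle D L qs Hstar n (\<lambda>i. Zs i w))))
    (normal_law 0 (\<integral>w. (X 0 w)\<^sup>2 \<partial>N))"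
  proof (rule clt_perturbed[OF N _ _ _ _ rem])
    show "N.indep_vars (\<lambda>_. borel) X UNIV"
      unfolding X_def by (rule N.indep_vars_compose2[OF ind]) measurable
    show "distr N borel (X i) = distr P borel (\<lambda>z. ?\<phi> z - Theta)" for i
      unfolding law[of i, symmetric] X_def by (subst distr_distr) (auto simp: comp_def)
    show "integrable N (\<lambda>w. (X 0 w)\<^sup>2)"
      using sqd unfolding law[of 0, symmetric] X_def by (subst (asm) integrable_distr_eq) auto
    have "(\<integral>z. ?\<phi> z - Theta \<partial>P) = 0" using mean \<phi>i by (simp add: prob_space)
    then show "(\<integral>w. X 0 w \<partial>N) = 0"
      unfolding law[of 0, symmetric] X_def by (subst (asm) integral_distr) auto
  qed
  have v: "(\<integral>w. (X 0 w)\<^sup>2 \<partial>N) = variance ?\<phi>"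
    unfolding mean unfolding law[of 0, symmetric] X_def by (subst integral_distr) auto
  have "(\<Sum>i<n. X i w) / sqrt n + sqrt n * (est n w - asrw_oracle D L qs Hstar n (\<lambda>i. Zs i w)) =
      sqrt n * (est n w - Theta)" for n w
  proof (cases "n = 0")
    case False
    have "(\<Sum>i<n. X i w) / sqrt n = sqrt n * (1 / n * (\<Sum>i<n. X i w))"
      by (rule sqrt_mult_inverse[symmetric])
    also have "1 / n * (\<Sum>i<n. X i w) = 1 / n * (\<Sum>i<n. ?\<phi> (Zs i w)) - Theta"
      using False by (simp add: X_def sum_subtractf field_simps)
    finally show ?thesis by (simp add: asrw_oracle_influence algebra_simps)
  qed simp
  with X show ?thesis unfolding v by simp
qed

end

theorem theorem4:
  fixes D :: "('x, 'a) design"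
    and P :: "('x, 'a) hist measure"
    and pol :: "('x, 'a) policy"
    and Tr :: "nat \<Rightarrow> ('x, 'a) hist \<times> 'a \<Rightarrow> ('x \<times> real) measure"
    and M :: "'w measure"
    and Z :: "'w \<Rightarrow> ('x, 'a) hist"
    and PO :: "nat \<Rightarrow> (nat \<Rightarrow> 'a) \<Rightarrow> 'w \<Rightarrow> 'x \<times> real"
    and qs Hs Lstar :: "nat \<Rightarrow> ('x, 'a) hist \<times> 'a \<Rightarrow> real"
    and epsbar :: real
    and peps :: "real \<Rightarrow> ('x, 'a) policy"
    and Ker :: "nat \<Rightarrow> real \<Rightarrow> ('x, 'a) hist \<times> 'a \<Rightarrow> 'a measure"
    and Q :: "nat \<Rightarrow> (('x, 'a) hist \<times> 'a \<Rightarrow> real) set"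
    and L :: "nat \<Rightarrow> (('x, 'a) hist \<times> 'a \<Rightarrow> real) \<Rightarrow> ('x, 'a) hist \<times> 'a \<Rightarrow> real"
    and N :: "'n measure"
    and Zs :: "nat \<Rightarrow> 'n \<Rightarrow> ('x, 'a) hist"
    and K :: nat
    and I :: "nat \<Rightarrow> nat \<Rightarrow> nat set"
    and qh Hh :: "nat \<Rightarrow> nat \<Rightarrow> nat \<Rightarrow> (nat \<Rightarrow> ('x, 'a) hist) \<Rightarrow> ('x, 'a) hist \<times> 'a \<Rightarrow> real"
    and Ymax Gmax alpha_q alpha_H :: real
  defines "Hs \<equiv> true_score pol Lstar"
    and "Gmax \<equiv> Ymax * (\<Sum>k<horizon D. discount D ^ k)"
  assumes "design D"
    \<comment> \<open>observed law, potential outcomes, status-quo policy\<close>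
    and "prob_space M" and "Z \<in> M \<rightarrow>\<^sub>M traj_space D" and "P = distr M (traj_space D) Z"
    and "consistency D M Z PO"
    and "sequential_unconfoundedness D M Z PO"
    and "status_quo D P pol"
    and "is_transition D P Tr"
    and "is_action_value D P qs"
    and "convolutional_path D P pol qs epsbar peps Ker Lstar Q L"
    \<comment> \<open>(i)\<close>
    and "\<forall>t\<in>{1..horizon D}. integrable P (reward_to_go D t)"
    and "\<forall>t\<in>{1..horizon D}. integrable P (\<lambda>z. Hs t (sa_at t z) * reward_to_go D t z)"
    and "\<forall>t\<in>{1..horizon D}.
      (\<integral>\<^sup>+z. (\<integral>\<^sup>+a. ennreal \<bar>qs t (hist_at t z, a) * Lstar t (hist_at t z, a)\<bar> \<partial>act_space D t) \<partial>P) < \<infinity>"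
    and "\<forall>t\<in>{1..horizon D}.
      (\<integral>\<^sup>+z. (\<integral>\<^sup>+a. ennreal (\<bar>L t (qs t) (hist_at t z, a)\<bar> * pol t (hist_at t z, a)) \<partial>act_space D t) \<partial>P) < \<infinity>"
    \<comment> \<open>(ii)\<close>
    and "\<forall>t\<in>{1..horizon D}. \<exists>Dt. integrable P Dt \<and>
      (\<forall>\<^sub>F e in at_right 0. AE z in P.
         (\<integral>\<^sup>+a. ennreal \<bar>qs t (hist_at t z, a) *
              ((peps e t (hist_at t z, a) - pol t (hist_at t z, a)) / e)\<bar> \<partial>act_space D t)
         \<le> ennreal (Dt z))"
    and "\<forall>t\<in>{1..horizon D}. \<exists>Dt. Dt \<in> borel_measurable (sa_space D t) \<and>
      (\<forall>\<^sub>F e in at_right 0. AE p in sa_law D P t. \<bar>backward_quotient Ker t (qs t) e p\<bar> \<le> Dt p) \<and>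
      (\<integral>\<^sup>+z. (\<integral>\<^sup>+a. ennreal (Dt (hist_at t z, a) * pol t (hist_at t z, a)) \<partial>act_space D t) \<partial>P) < \<infinity>"
    \<comment> \<open>(iii) and second moment\<close>
    and "\<forall>t\<in>{1..horizon D}. square_integrable P (reward_to_go D t) \<and>
      square_integrable (sa_law D P t) (qs t) \<and> square_integrable (sa_law D P t) (Hs t)"
    and "square_integrable P (influence D L qs Hs)"
    \<comment> \<open>i.i.d. sample and folds\<close>
    and "prob_space N"
    and "prob_space.indep_vars N (\<lambda>_. traj_space D) Zs UNIV"
    and "\<forall>i. distr N (traj_space D) (Zs i) = P"
    and "\<forall>n. disjoint_family_on (I n) {..<K} \<and> (\<Union>k<K. I n k) = {..<n}"
    \<comment> \<open>nuisance estimates: measurability in the training sample and in (s, a)\<close>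
    and "\<forall>n. \<forall>k<K. \<forall>t\<in>{1..horizon D}.
      (\<lambda>(d, p). qh n k t d p) \<in>
        borel_measurable ((\<Pi>\<^sub>M i\<in>{..<n} - I n k. traj_space D) \<Otimes>\<^sub>M sa_space D t) \<and>
      (\<lambda>(d, p). L t (qh n k t d) p) \<in>
        borel_measurable ((\<Pi>\<^sub>M i\<in>{..<n} - I n k. traj_space D) \<Otimes>\<^sub>M sa_space D t) \<and>
      (\<lambda>(d, p). Hh n k t d p) \<in>
        borel_measurable ((\<Pi>\<^sub>M i\<in>{..<n} - I n k. traj_space D) \<Otimes>\<^sub>M sa_space D t)"
    \<comment> \<open>nuisance estimates: class membership, moments and bound, given the training sample\<close>
    and "\<forall>n. \<forall>k<K. \<forall>t\<in>{1..horizon D}. AE w in N.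
      qh n k t (training n (I n k) (\<lambda>i. Zs i w)) \<in> Q t \<and>
      square_integrable (sa_law D P t) (qh n k t (training n (I n k) (\<lambda>i. Zs i w))) \<and>
      square_integrable (sa_law D P t) (Hh n k t (training n (I n k) (\<lambda>i. Zs i w)))"
    and "\<forall>t\<in>{1..horizon D}. AE z in P. \<bar>out_at t z\<bar> \<le> Ymax"
    and "\<forall>n. \<forall>k<K. \<forall>t\<in>{1..horizon D}. AE w in N. AE s in hist_law D P t.
      \<forall>a\<in>act_set D t. \<bar>qh n k t (training n (I n k) (\<lambda>i. Zs i w)) (s, a)\<bar> \<le> Gmax"
    \<comment> \<open>rates\<close>
    and "0 \<le> alpha_q" and "0 \<le> alpha_H" and "alpha_q + alpha_H \<ge> 1 / 2"
    and "\<forall>k<K. little_o_p N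
      (\<lambda>n w. SUP t\<in>{1..horizon D}. L2_norm (sa_law D P t)
         (\<lambda>p. qh n k t (training n (I n k) (\<lambda>i. Zs i w)) p - qs t p))
      (\<lambda>n. real n powr (- alpha_q))"
    and "\<forall>k<K. little_o_p N
      (\<lambda>n w. SUP t\<in>{1..horizon D}. L2_norm (sa_law D P t)
         (\<lambda>p. L t (qh n k t (training n (I n k) (\<lambda>i. Zs i w))) p - L t (qs t) p))
      (\<lambda>n. real n powr (- alpha_q))"
    and "\<forall>k<K. little_o_p N
      (\<lambda>n w. SUP t\<in>{1..horizon D}. L2_norm (sa_law D P t)
         (\<lambda>p. Hh n k t (training n (I n k) (\<lambda>i. Zs i w)) p - Hs t p))
      (\<lambda>n. real n powr (- alpha_H))"
  shows "(\<lambda>e. policy_value D P Tr (peps e)) differentiable (at 0 within {0..<epsbar}) \<and>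
    tendsto_in_prob N
      (\<lambda>n w. sqrt n * (asrw_estimator D L K (I n) (qh n) (Hh n) n (\<lambda>i. Zs i w) -
                        asrw_oracle D L qs Hs n (\<lambda>i. Zs i w))) 0 \<and>
    weak_conv_m
      (\<lambda>n. distr N borel (\<lambda>w. sqrt n * (asrw_estimator D L K (I n) (qh n) (Hh n) n (\<lambda>i. Zs i w) -
                                        marginal_policy_effect D P Tr peps epsbar)))
      (normal_law 0 (prob_space.variance P (influence D L qs Hs)))"
proof -
  have N: "prob_space N" by fact
  interpret N: prob_space N by (rule N)
  have pP: "prob_space P"
    using \<open>prob_space M\<close> \<open>Z \<in> M \<rightarrow>\<^sub>M traj_space D\<close> \<open>P = distr M (traj_space D) Z\<close>
    by (simp add: prob_space.prob_space_distr)
  have sP: "sets P = sets (traj_space D)"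
    using \<open>P = distr M (traj_space D) Z\<close> by simp
  have Hs: "Hs = true_score pol Lstar" by (simp add: Hs_def)
  have sq: "\<forall>t\<in>{1..horizon D}. square_integrable (sa_law D P t) (true_score pol Lstar t)"
    using \<open>\<forall>t\<in>{1..horizon D}. square_integrable P (reward_to_go D t) \<and>
      square_integrable (sa_law D P t) (qs t) \<and> square_integrable (sa_law D P t) (Hs t)\<close>
    unfolding Hs by blast
  interpret asrw_design D P pol Tr qs Lstar epsbar peps Ker Q L Ymax
  proof (intro asrw_design.intro perturbed_design.intro observed_design.intro
      asrw_design_axioms.intro perturbed_design_axioms.intro)
    show "design D" "status_quo D P pol" "is_transition D P Tr"
      "convolutional_path D P pol qs epsbar peps Ker Lstar Q L"
      "\<forall>t\<in>{1..horizon D}. AE z in P. \<bar>out_at t z\<bar> \<le> Ymax" "is_action_value D P qs" by fact+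
  qed (fact pP sP sq)+
  let ?d = "\<lambda>n k w. training n (I n k) (\<lambda>i. Zs i w)"
  have G: "max_reward = Gmax" by (simp add: max_reward_def Gmax_def)
  have law: "distr N (traj_space D) (Zs i) = P" for i using \<open>\<forall>i. distr N (traj_space D) (Zs i) = P\<close> by blast
  have folds: "disjoint_family_on (I n) {..<K}" "(\<Union>k<K. I n k) = {..<n}" for n
    using \<open>\<forall>n. disjoint_family_on (I n) {..<K} \<and> (\<Union>k<K. I n k) = {..<n}\<close> by auto
  have "tendsto_in_prob N (\<lambda>n w. (\<Sum>i\<in>I n k. \<Sum>t = 1..T.
      score_error t (qh n k t (?d n k w))
        (Hh n k t (?d n k w)) (Zs i w)) / sqrt n) 0" if k: "k < K" for k
  proof (rule fold_remainder[OF N _ law, where \<alpha> = alpha_q and \<beta> = alpha_H])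
    show "prob_space.indep_vars N (\<lambda>_. traj_space D) Zs UNIV" by fact
    show "I n k \<subseteq> {..<n}" for n using folds(2)[of n] k by blast
    show "0 \<le> alpha_q" "0 \<le> alpha_H" "alpha_q + alpha_H \<ge> 1 / 2" by fact+
    fix n t assume t: "t \<in> {1..T}"
    let ?X = "(\<Pi>\<^sub>M i\<in>{..<n} - I n k. traj_space D) \<Otimes>\<^sub>M sa_space D t"
    show "(\<lambda>(d, p). qh n k t d p) \<in> borel_measurable ?X \<and>
      (\<lambda>(d, p). L t (qh n k t d) p) \<in> borel_measurable ?X \<and>
      (\<lambda>(d, p). Hh n k t d p) \<in> borel_measurable ?X"
      using assms(25) k t by blast
    have "AE w in N. qh n k t (?d n k w) \<in> Q t \<and>
      square_integrable (sa_law D P t) (qh n k t (?d n k w)) \<and>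
      square_integrable (sa_law D P t) (Hh n k t (?d n k w))"
      using assms(26) k t by blast
    then show "AE w in N. qh n k t (?d n k w) \<in> Q t \<and>
      Hh n k t (?d n k w) \<in> borel_measurable (sa_space D t)"
      by (rule AE_mp) (auto simp: square_integrable_def)
    show "AE w in N. AE s in hist_law D P t.
      \<forall>a\<in>act_set D t. \<bar>qh n k t (?d n k w) (s, a)\<bar> \<le> max_reward"
      unfolding G using assms(28) k t by blast
  next
    show "little_o_p N (\<lambda>n w. SUP t\<in>{1..T}. L2_norm (sa_law D P t)
        (\<lambda>p. qh n k t (?d n k w) p - qs t p)) (\<lambda>n. real n powr (- alpha_q))"
      "little_o_p N (\<lambda>n w. SUP t\<in>{1..T}. L2_norm (sa_law D P t)
        (\<lambda>p. L t (qh n k t (?d n k w)) p - L t (qs t) p)) (\<lambda>n. real n powr (- alpha_q))"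
      "little_o_p N (\<lambda>n w. SUP t\<in>{1..T}. L2_norm (sa_law D P t)
        (\<lambda>p. Hh n k t (?d n k w) p - true_score pol Lstar t p)) (\<lambda>n. real n powr (- alpha_H))"
      using assms(32-34) k unfolding Hs by blast+
  qed
  then have rem: "tendsto_in_prob N
      (\<lambda>n w. sqrt n * (asrw_estimator D L K (I n) (qh n) (Hh n) n (\<lambda>i. Zs i w) -
                        asrw_oracle D L qs (true_score pol Lstar) n (\<lambda>i. Zs i w))) 0"
    unfolding estimator_minus_oracle[OF folds] by (intro tendsto_in_prob_sum[OF N]) auto
  have infl: "square_integrable P (influence D L qs (true_score pol Lstar))"
    using \<open>square_integrable P (influence D L qs Hs)\<close> unfolding Hs .
  \<comment> \<open>The target is a \<open>vector_derivative\<close>, a choice operator with a value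
    even where no derivative exists; differentiability makes that value the right
    derivative.\<close>
  have diff: "(\<lambda>e. policy_value D P Tr (peps e)) differentiable (at 0 within {0..<epsbar})"
    using policy_value_Theta by (auto simp: has_field_derivative_def differentiable_def)
  show ?thesis
    unfolding Hs marginal_policy_effect_Theta
    using diff rem asrw_asymptotic_normality[OF N _ law infl rem]
      \<open>prob_space.indep_vars N (\<lambda>_. traj_space D) Zs UNIV\<close> by blast
qed

end
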